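(* Let $A, B > 1$ be fixed constants such that $\gamma_{A,B} = 1$, where $\gamma_{A,B} = \mathrm{Cap}(\mathbb{D}_1\cup\mathbb{D}_2)$ is the logarithmic capacity of the union of the two disks $$\mathbb{D}_1 = \mathbb{D}\left(\frac{1}{A^2-1}, \frac{A}{A^2-1}\right), \qquad \mathbb{D}_2 = \mathbb{D}\left(\frac{B^2}{1-B^2}, \frac{B}{B^2-1}\right).$$ (1) There is a constant $C_2 = C_2(A,B) > 0$ such that there is no integer-valued polynomial $P$, not identically zero, that satisfies both $$\sum_{n\in\mathbb{N}} |P(n)|^2 A^{-2n} \le C_2 \quad\text{and}\quad \sum_{n\in\mathbb{N}^+} |P(-n)|^2 B^{-2n} \le C_2.$$ (2) There is a constant $C_3 = C_3(A,B) > 0$ such that there are infinitely many integer-valued polynomials $P$ satisfying $$\sum_{n\in\mathbb{N}} \frac{|P(n)|^2}{n+1} A^{-2n} \le C_3 \quad\text{and}\quad \sum_{n\in\mathbb{N}^+} \frac{|P(-n)|^2}{n+1} B^{-2n} \le C_3.$$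
   Context: Notation: $\mathbb{N} = \{0,1,2,\dots\}$, $\mathbb{N}^+ = \{1,2,3,\dots\}$. $\mathbb{D}(a,r)$ is the disk in $\mathbb{C}$ with center $a$ and radius $r$. An integer-valued polynomial is a polynomial (of arbitrary degree) that takes integer values on $\mathbb{N}$ (equivalently, on $\mathbb{Z}$). The logarithmic capacity of a compact set $E\subset\mathbb{C}$ is $$\mathrm{Cap}(E) = \exp\left(-\inf_\nu \int_{E\times E} \log\frac{1}{|z-w|}\, d\nu(z)\, d\nu(w)\right),$$ the infimum being over probability measures $\nu$ supported on $E$; the disks $\mathbb{D}_1,\mathbb{D}_2$ are taken closed when computing the capacity. *)

theory Defs
  imports "HOL-Probability.Probability" "HOL-Computational_Algebra.Polynomial"
begin

text \<open>The value on the diagonal has to be given explicitly, since \<open>ln (1 / 0) = 0\<close> in HOL.\<close>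

definition log_kernel :: "complex \<Rightarrow> complex \<Rightarrow> ereal" where
  "log_kernel z w = (if z = w then \<infinity> else ereal (ln (1 / cmod (z - w))))"

text \<open>
  The energy may be infinite, so it is taken as an extended real: the integral of the positive part
  minus the integral of the negative part (\<^const>\<open>e2ennreal\<close> sends negative values to 0).
  For a finite measure with bounded support the second integral is finite.
\<close>

definition log_energy :: "complex measure \<Rightarrow> ereal" where
  "log_energy \<nu> =
     enn2ereal (\<integral>\<^sup>+ (z, w). e2ennreal (log_kernel z w) \<partial>(\<nu> \<Otimes>\<^sub>M \<nu>)) -
     enn2ereal (\<integral>\<^sup>+ (z, w). e2ennreal (- log_kernel z w) \<partial>(\<nu> \<Otimes>\<^sub>M \<nu>))"

definition prob_measures_on :: "complex set \<Rightarrow> complex measure set" where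
  "prob_measures_on E = {\<nu>. prob_space \<nu> \<and> sets \<nu> = sets borel \<and> emeasure \<nu> E = 1}"

definition min_log_energy :: "complex set \<Rightarrow> ereal" where
  "min_log_energy E = (INF \<nu> \<in> prob_measures_on E. log_energy \<nu>)"

text \<open>
  For compact \<open>E\<close> the infimum is never \<open>-\<infinity>\<close>; when it is \<open>\<infinity>\<close> the capacity is
  \<open>exp (-\<infinity>) = 0\<close>.
\<close>

definition log_capacity :: "complex set \<Rightarrow> real" where
  "log_capacity E =
     (if min_log_energy E = \<infinity> then 0 else exp (- real_of_ereal (min_log_energy E)))"

definition disk1 :: "real \<Rightarrow> complex set" where
  "disk1 A = cball (of_real (1 / (A\<^sup>2 - 1))) (A / (A\<^sup>2 - 1))"

definition disk2 :: "real \<Rightarrow> complex set" where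
  "disk2 B = cball (of_real (B\<^sup>2 / (1 - B\<^sup>2))) (B / (B\<^sup>2 - 1))"

definition gamma_AB :: "real \<Rightarrow> real \<Rightarrow> real" where
  "gamma_AB A B = log_capacity (disk1 A \<union> disk2 B)"

definition integer_valued :: "complex poly \<Rightarrow> bool" where
  "integer_valued P \<longleftrightarrow> (\<forall>n::nat. poly P (of_nat n) \<in> \<int>)"

end

theory Submission
  imports Defs "HOL-Complex_Analysis.Complex_Analysis" "HOL-Real_Asymp.Real_Asymp"
begin

text \<open>
  Put \<open>F(z) = (\<Sum>n\<ge>0. P(n) z\<^sup>n)\<close>. This is a rational function whose only pole is 1, equal to
  \<open>- (\<Sum>n\<ge>1. P(-n) z powi (-n))\<close> near infinity, and \<open>P\<close> is integer-valued iff \<open>F\<close> is \<open>w\<close> times an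
  integer polynomial in \<open>w = 1 / (1 - z) = u + 1\<close>. The sums in (1) and (2) are the Hardy and Bergman norms of
  \<open>F\<close> on \<open>cmod z < 1 / A\<close> and \<open>cmod z > B\<close>, so everything is governed by Green's function of the
  annulus in between with pole 1, which has an explicit Laurent series, and by its Robin constant, the logarithm
  of \<open>gamma_AB A B\<close>. For (1), pair \<open>F\<close> with a function having a zero of order \<open>degree P\<close> at 1 and bounded
  modulus on the two circles: this extracts \<open>fact (degree P) * lead_coeff P\<close>, a nonzero integer. For (2),
  the principal parts at 1 of the inverses of such functions give polynomials with leading coefficient
  \<open>1 / fact k\<close> and squared norm \<open>O(1 / (k + 1))\<close>; the gain over a bounded norm comes from the decay of these
  functions inside the disks, and it is exactly what Minkowski's pigeonhole argument needs to produce
  arbitrarily many integer combinations of bounded norm. The capacity is identified by exhibiting the equilibrium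
  measure for one inequality and by a Fekete point estimate for the other.
\<close>

text \<open>At capacity exactly 1 there is no exponential room: every loss must be bounded
  independently of the degree. The obstacle is that Green's function of an annulus has no
  single-valued conjugate, its period being governed by \<open>rho0 A B\<close>, which need not be
  rational; so no power of the associated multivalued function need be single-valued. A twist by an
  integer power of \<open>z\<close> repairs this at the cost of at most one power of a radius on
  each circle.

  The weight in (2) is a matter of dimension. A ball of bounded radius in dimension \<open>N\<close>
  has volume about \<open>N powr (- N / 2)\<close> up to exponential factors, so generators of
  bounded length would not suffice for the pigeonhole. Squared lengths of order
  \<open>1 / (k + 1)\<close> reduce the covolume by about \<open>sqrt (fact N)\<close>, which is the
  same size.

  The values of a nonzero polynomial on all integers are absolutely summable on no circle. They are
  therefore only paired with coefficient sequences that converge on both circles, and summation by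
  parts takes the place of contour integration.\<close>

section \<open>Laurent series as absolutely summable bilateral sequences\<close>

no_notation Infinite_Set_Sum.abs_summable_on (infix "abs'_summable'_on" 50)

text \<open>Bilateral sequences stand for Laurent series. Summability is required on one circle at a time, since
  the same rational function has different expansions on both sides of its pole \<open>1\<close>; \<open>leval c z\<close> is
  junk unless \<open>lsummable (cmod z) c\<close> holds.\<close>

definition lsummable :: "real \<Rightarrow> (int \<Rightarrow> complex) \<Rightarrow> bool" where
  "lsummable r c \<longleftrightarrow> (\<lambda>j. norm (c j) * r powi j) summable_on UNIV"

definition leval :: "(int \<Rightarrow> complex) \<Rightarrow> complex \<Rightarrow> complex" where
  "leval c z = (\<Sum>\<^sub>\<infinity>j. c j * z powi j)"

definition lconv :: "(int \<Rightarrow> complex) \<Rightarrow> (int \<Rightarrow> complex) \<Rightarrow> int \<Rightarrow> complex" where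
  "lconv c d j = (\<Sum>\<^sub>\<infinity>i. c i * d (j - i))"

text \<open>On the level of series this is multiplication by \<open>1 - z\<close>, on sequences it is the backward difference.\<close>

definition ldiff :: "(int \<Rightarrow> complex) \<Rightarrow> int \<Rightarrow> complex" where
  "ldiff c j = c j - c (j - 1)"

lemma norm_powi_term: "norm (c * z powi j) = norm c * cmod z powi j" for c z :: complex
  by (simp add: norm_mult norm_power_int)

lemma lsummableD:
  assumes "lsummable r c" "cmod z = r"
  shows "(\<lambda>j. c j * z powi j) abs_summable_on UNIV"
  using assms unfolding lsummable_def norm_powi_term by simp

lemma summable_on_minus:
  fixes f g :: "'a \<Rightarrow> 'b :: real_normed_vector"
  assumes "f summable_on A" "g summable_on A"
  shows "(\<lambda>x. f x - g x) summable_on A"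
  using summable_on_add[OF assms(1) summable_on_uminus[THEN iffD2, OF assms(2)]] by simp

lemma infsum_minus:
  fixes f g :: "'a \<Rightarrow> 'b :: real_normed_vector"
  assumes "f summable_on A" "g summable_on A"
  shows "(\<Sum>\<^sub>\<infinity>x\<in>A. f x - g x) = infsum f A - infsum g A"
  using infsum_add[OF assms(1) summable_on_uminus[THEN iffD2, OF assms(2)]] by (simp add: infsum_uminus)

lemma leval_has_sum:
  assumes "lsummable r c" "cmod z = r"
  shows "((\<lambda>j. c j * z powi j) has_sum leval c z) UNIV"
  unfolding leval_def using abs_summable_summable[OF lsummableD[OF assms]] by (rule has_sum_infsum)

lemma lsummable_shift:
  assumes "lsummable r c" "r > 0"
  shows "lsummable r (\<lambda>j. c (j + m))"
proof -
  have "(\<lambda>j. (norm (c j) * r powi j) * r powi (-m)) summable_on UNIV"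
    using assms(1) unfolding lsummable_def by (intro summable_on_cmult_left)
  then have "(\<lambda>j. (norm (c (j+m)) * r powi (j+m)) * r powi (-m)) summable_on UNIV"
    by (subst summable_on_reindex_bij_betw[where g="\<lambda>j. j+m" and B=UNIV and f="\<lambda>j. (norm (c j) * r powi j) * r powi (-m)"])
       (auto intro!: bij_betwI[where g="\<lambda>j. j-m"])
  moreover have "(norm (c (j+m)) * r powi (j+m)) * r powi (-m) = norm (c (j+m)) * r powi j" for j
    using assms(2) by (simp add: power_int_add power_int_minus)
  ultimately show ?thesis unfolding lsummable_def by simp
qed

lemma leval_shift:
  assumes "lsummable r c" "r > 0" "cmod z = r"
  shows "leval (\<lambda>j. c (j + m)) z = z powi (-m) * leval c z"
proof -
  have z: "z \<noteq> 0" using assms by auto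
  have "((\<lambda>j. (c j * z powi j) * z powi (-m)) has_sum leval c z * z powi (-m)) UNIV"
    by (intro has_sum_cmult_left leval_has_sum[OF assms(1,3)])
  then have "((\<lambda>j. (c (j+m) * z powi (j+m)) * z powi (-m)) has_sum leval c z * z powi (-m)) UNIV"
    by (subst has_sum_reindex_bij_betw[where g="\<lambda>j. j+m" and B=UNIV and f="\<lambda>j. (c j * z powi j) * z powi (-m)"])
       (auto intro!: bij_betwI[where g="\<lambda>j. j-m"])
  moreover have "(c (j+m) * z powi (j+m)) * z powi (-m) = c (j+m) * z powi j" for j
    using z by (simp add: power_int_add power_int_minus)
  ultimately have "((\<lambda>j. c (j+m) * z powi j) has_sum leval c z * z powi (-m)) UNIV" by simp
  then show ?thesis unfolding leval_def[of "\<lambda>j. c (j + m)"] by (simp add: infsumI mult.commute)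
qed

lemma lsummable_add:
  assumes "lsummable r c" "lsummable r d" "r > 0"
  shows "lsummable r (\<lambda>j. c j + d j)"
proof -
  have "(\<lambda>j. norm (c j) * r powi j + norm (d j) * r powi j) summable_on UNIV"
    using assms unfolding lsummable_def by (intro summable_on_add)
  then show ?thesis unfolding lsummable_def
    by (rule summable_on_comparison_test)
       (use assms(3) in \<open>auto simp: norm_triangle_ineq simp flip: distrib_right intro!: mult_right_mono\<close>)
qed

lemma leval_add:
  assumes "lsummable r c" "lsummable r d" "cmod z = r"
  shows "leval (\<lambda>j. c j + d j) z = leval c z + leval d z"
  using has_sum_add[OF leval_has_sum[OF assms(1,3)] leval_has_sum[OF assms(2,3)]]
  unfolding leval_def[of "\<lambda>j. c j + d j"] by (simp add: infsumI distrib_right)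

lemma lsummable_cmult:
  assumes "lsummable r c"
  shows "lsummable r (\<lambda>j. k * c j)"
  using summable_on_cmult_right[OF assms[unfolded lsummable_def], of "norm k"]
  unfolding lsummable_def by (simp add: norm_mult mult.assoc)

lemma leval_cmult: "leval (\<lambda>j. k * c j) z = k * leval c z"
  unfolding leval_def by (simp add: mult.assoc infsum_cmult_right')

lemma lsummable_ldiff:
  assumes "lsummable r c" "r > 0"
  shows "lsummable r (ldiff c)"
proof -
  have "lsummable r (\<lambda>j. c j + (-1) * c (j + (-1)))"
    by (rule lsummable_add[OF assms(1) lsummable_cmult[OF lsummable_shift[OF assms]] assms(2)])
  then show ?thesis by (simp add: ldiff_def[abs_def])
qed

lemma leval_ldiff:
  assumes "lsummable r c" "r > 0" "cmod z = r"
  shows "leval (ldiff c) z = (1 - z) * leval c z"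
proof -
  have "ldiff c = (\<lambda>j. c j + (-1) * c (j + (-1)))"
    by (auto simp: ldiff_def)
  then have "leval (ldiff c) z = leval c z + leval (\<lambda>j. (-1) * c (j + (-1))) z"
    using leval_add[OF assms(1) lsummable_cmult[OF lsummable_shift[OF assms(1,2)]] assms(3)] by (simp only:)
  also have "\<dots> = leval c z + (-1) * (z powi (-(-1)) * leval c z)"
    using assms by (simp only: leval_cmult leval_shift)
  finally show ?thesis by (simp add: algebra_simps)
qed

lemma lsummable_ldiff_pow:
  assumes "lsummable r c" "r > 0"
  shows "lsummable r ((ldiff ^^ k) c)"
  by (induction k) (auto intro: lsummable_ldiff assms)

lemma leval_ldiff_pow:
  assumes "lsummable r c" "r > 0" "cmod z = r"
  shows "leval ((ldiff ^^ k) c) z = (1 - z) ^ k * leval c z"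
proof (induction k)
  case (Suc k)
  have "leval ((ldiff ^^ Suc k) c) z = (1 - z) * leval ((ldiff ^^ k) c) z"
    using leval_ldiff[OF lsummable_ldiff_pow[OF assms(1,2)] assms(2,3)] by simp
  then show ?case by (simp add: Suc algebra_simps)
qed auto

lemma abs_summable_prod:
  fixes f :: "'a \<Rightarrow> complex" and g :: "'b \<Rightarrow> complex"
  assumes "f abs_summable_on A" "g abs_summable_on B"
  shows "(\<lambda>(x,y). f x * g y) abs_summable_on A \<times> B"
  unfolding Infinite_Sum.abs_summable_on_Sigma_iff
proof
  show "\<forall>x\<in>A. (\<lambda>y. case (x, y) of (x, y) \<Rightarrow> f x * g y) abs_summable_on B"
    using assms by (auto simp: norm_mult intro!: summable_on_cmult_right)
  have "(\<lambda>x. norm (f x) * infsum (\<lambda>y. norm (g y)) B) summable_on A"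
    using assms by (intro summable_on_cmult_left)
  moreover have "0 \<le> infsum (\<lambda>y. norm (g y)) B" by (intro infsum_nonneg) auto
  ultimately show "(\<lambda>x. infsum (\<lambda>y. norm (case (x, y) of (x, y) \<Rightarrow> f x * g y)) B) abs_summable_on A"
    by (simp add: norm_mult infsum_cmult_right')
qed

text \<open>All three facts come from one absolutely convergent double series, sheared by
  \<open>(i, l) \<mapsto> (i + l, i)\<close>. The first two are read off at the positive point of
  the circle.\<close>

lemma
  assumes c: "lsummable r c" and d: "lsummable r d" and r: "r > 0"
  shows lconv_summable: "(\<lambda>i. c i * d (j - i)) abs_summable_on UNIV"
    and lsummable_lconv: "lsummable r (lconv c d)"
    and leval_lconv: "cmod z = r \<Longrightarrow> leval (lconv c d) z = leval c z * leval d z"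
proof -
  have main: "(\<lambda>i. c i * d (j - i)) abs_summable_on UNIV \<and> (\<lambda>j. lconv c d j * z powi j) abs_summable_on UNIV
      \<and> ((\<lambda>j. lconv c d j * z powi j) has_sum (leval c z * leval d z)) UNIV"
    if z: "cmod z = r" for z j
  proof -
    have z0: "z \<noteq> 0" using r z by auto
    define F where "F = (\<lambda>(i,l). (c i * z powi i) * (d l * z powi l))"
    define H where "H = (\<lambda>(j,i). (c i * d (j - i)) * z powi j)"
    have FA: "F abs_summable_on UNIV \<times> UNIV"
      unfolding F_def by (rule abs_summable_prod[OF lsummableD[OF c z] lsummableD[OF d z]])
    have HF: "H (j,i) = F (i, j - i)" for j i
      using z0 by (simp add: H_def F_def power_int_diff field_simps)
    have bij: "bij_betw (\<lambda>(j,i). (i, j - i)) (UNIV \<times> UNIV :: (int\<times>int) set) (UNIV \<times> UNIV)"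
      by (rule bij_betwI[where g="\<lambda>(i,l). (i + l, i)"]) auto
    have H': "H = (\<lambda>x. F ((\<lambda>(j,i). (i, j - i)) x))" using HF by auto
    have HA: "H abs_summable_on UNIV \<times> UNIV"
      unfolding H' using FA by (subst summable_on_reindex_bij_betw[OF bij, where f="\<lambda>x. norm (F x)"])
    have Hs: "(\<lambda>i. H (j,i)) abs_summable_on UNIV" and Ho: "(\<lambda>j. infsum (\<lambda>i. norm (H (j, i))) UNIV) abs_summable_on UNIV" for j
      using HA unfolding Infinite_Sum.abs_summable_on_Sigma_iff by auto
    have cs: "(\<lambda>i. c i * d (j - i)) abs_summable_on UNIV" for j
    proof -
      have "(\<lambda>i. norm (H (j,i)) * norm (z powi (-j))) summable_on UNIV"
        by (intro summable_on_cmult_left Hs)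
      moreover have "norm (H (j,i)) * norm (z powi (-j)) = norm (c i * d (j - i))" for i
        using z0 by (simp add: H_def power_int_minus mult.assoc flip: norm_mult)
      ultimately show ?thesis by simp
    qed
    have inner: "((\<lambda>i. H (j,i)) has_sum lconv c d j * z powi j) UNIV" for j
      unfolding H_def lconv_def prod.case
      by (rule has_sum_cmult_left[OF has_sum_infsum[OF abs_summable_summable[OF cs]]])
    have nrm: "norm (lconv c d j * z powi j) \<le> infsum (\<lambda>i. norm (H (j, i))) UNIV" for j
      using norm_infsum_bound[OF Hs[of j]] infsumI[OF inner[of j]] by simp
    have A: "(\<lambda>j. lconv c d j * z powi j) abs_summable_on UNIV"
      by (rule Infinite_Sum.abs_summable_on_comparison_test[OF Ho]) (use nrm in \<open>smt (verit) real_norm_def\<close>)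
    have "(F has_sum (leval c z * leval d z)) (UNIV \<times> UNIV)"
    proof -
      have "((\<lambda>i. (c i * z powi i) * leval d z) has_sum leval c z * leval d z) UNIV"
        by (rule has_sum_cmult_left[OF leval_has_sum[OF c z]])
      moreover have "((\<lambda>l. F (i,l)) has_sum (c i * z powi i) * leval d z) UNIV" for i
        unfolding F_def prod.case by (rule has_sum_cmult_right[OF leval_has_sum[OF d z]])
      ultimately show ?thesis
        using abs_summable_summable[OF FA]
        by (intro has_sum_SigmaI[where g="\<lambda>i. (c i * z powi i) * leval d z"]) auto
    qed
    then have "(H has_sum (leval c z * leval d z)) (UNIV \<times> UNIV)"
      unfolding H' by (subst has_sum_reindex_bij_betw[OF bij, where f=F])
    then have "((\<lambda>j. lconv c d j * z powi j) has_sum (leval c z * leval d z)) UNIV"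
      by (rule has_sum_SigmaD) (use inner in auto)
    then show ?thesis using cs A by blast
  qed
  have rr: "cmod (of_real r) = r" using r by simp
  from main[OF rr] show "(\<lambda>i. c i * d (j - i)) abs_summable_on UNIV" by blast
  from main[OF rr, THEN conjunct2, THEN conjunct1] show "lsummable r (lconv c d)"
    unfolding lsummable_def norm_powi_term rr .
  show "leval (lconv c d) z = leval c z * leval d z" if "cmod z = r"
    using main[OF that] unfolding leval_def[of "lconv c d"] by (auto intro: infsumI)
qed

lemma ldiff_lconv:
  assumes "lsummable r c" "lsummable r d" "r > 0"
  shows "ldiff (lconv c d) = lconv c (ldiff d)"
proof
  fix j
  have "lconv c (ldiff d) j = (\<Sum>\<^sub>\<infinity>i. c i * d (j - i) + - (c i * d ((j - 1) - i)))"
    unfolding lconv_def ldiff_def by (simp add: algebra_simps)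
  also have "\<dots> = (\<Sum>\<^sub>\<infinity>i. c i * d (j - i)) + (\<Sum>\<^sub>\<infinity>i. - (c i * d ((j - 1) - i)))"
    using abs_summable_summable[OF lconv_summable[OF assms]]
    by (intro infsum_add) (simp_all add: summable_on_uminus)
  finally show "ldiff (lconv c d) j = lconv c (ldiff d) j"
    by (simp add: ldiff_def lconv_def infsum_uminus)
qed

section \<open>Integration over circles and Parseval's identity\<close>

text \<open>Termwise integration, justified by the Weierstrass test. The left end \<open>t\<close>
  stays free because the two boundary circles are later traversed on consecutive intervals of length
  \<open>2 * pi\<close>.\<close>

lemma has_integral_leval:
  fixes c :: "int \<Rightarrow> complex" and t :: real
  assumes "lsummable 1 c"
  shows "((\<lambda>\<theta>. leval c (cis \<theta>)) has_integral (2 * pi * c 0)) {t..t + 2*pi}"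
proof -
  let ?F = "finite_subsets_at_top (UNIV :: int set)"
  have u: "uniform_limit {t..t + 2*pi} (\<lambda>X y. \<Sum>j\<in>X. c j * cis y powi j) (\<lambda>y. leval c (cis y)) ?F"
    unfolding leval_def
    by (rule Weierstrass_m_test_general[where M="\<lambda>j. norm (c j)"])
       (use assms in \<open>auto simp: norm_powi_term lsummable_def\<close>)
  have ci: "cis y powi j = cis (of_int j * y)" for y j
    by (simp add: cis_power_int mult.commute)
  obtain I J where I: "\<And>X. ((\<lambda>y. \<Sum>j\<in>X. c j * cis y powi j) has_integral I X) {t..t + 2*pi}"
    and J: "((\<lambda>y. leval c (cis y)) has_integral J) {t..t + 2*pi}" and lim: "(I \<longlongrightarrow> J) ?F"
    by (rule uniform_limit_integral[OF u])
       (auto simp: ci cis_conv_exp intro!: continuous_intros)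
  have term0: "((\<lambda>y. c j * cis y powi j) has_integral (if j = 0 then 2*pi*c 0 else 0)) {t..t + 2*pi}" for j
  proof (cases "j = 0")
    case True
    then show ?thesis using has_integral_const_real[of "c 0 :: complex" t "t + 2*pi"] by (simp add: scaleR_conv_of_real)
  next
    case False
    have "((\<lambda>y. c j * cis (of_int j * y)) has_integral
        (c j * cis (of_int j * (t + 2*pi)) / (\<i> * of_int j) - c j * cis (of_int j * t) / (\<i> * of_int j))) {t..t + 2*pi}"
    proof (rule fundamental_theorem_of_calculus)
      fix x :: real
      show "((\<lambda>y. c j * cis (of_int j * y) / (\<i> * of_int j)) has_vector_derivative c j * cis (of_int j * x))
            (at x within {t..t + 2*pi})"
        unfolding cis_conv_exp using False
        by (auto intro!: derivative_eq_intros has_vector_derivative_real_field simp: field_simps)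
    qed auto
    moreover have "cis (of_int j * (t + 2*pi)) = cis (of_int j * t)"
      using cis_multiple_2pi[of "of_int j"] by (simp add: distrib_left cis_mult[symmetric] mult.commute mult.left_commute)
    ultimately show ?thesis using False by (simp add: ci)
  qed
  have "I X = (\<Sum>j\<in>X. if j = 0 then 2*pi*c 0 else 0)" if "finite X" for X
    by (rule has_integral_unique[OF I has_integral_sum[OF that term0]])
  then have "eventually (\<lambda>X. I X = 2*pi*c 0) ?F"
    unfolding eventually_finite_subsets_at_top by (intro exI[of _ "{0}"]) auto
  then have "(I \<longlongrightarrow> 2*pi*c 0) ?F" by (rule tendsto_eventually)
  then have "J = 2*pi*c 0" using lim tendsto_unique[OF finite_subsets_at_top_neq_bot] by blast
  then show ?thesis using J by simp
qed

text \<open>After rescaling to the unit circle, \<open>d\<close> is convolved with its reversed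
  conjugate \<open>e\<close>: on the circle the product is the squared modulus, and its coefficient
  at 0 is the sum of squares. Summability of the squares is an instance of
  \<open>lconv_summable\<close>.\<close>

lemma parseval_bound:
  assumes c: "lsummable r c" and r: "r > 0" and M: "\<And>z. cmod z = r \<Longrightarrow> cmod (leval c z) \<le> M"
  shows "(\<lambda>j. (norm (c j))\<^sup>2 * (r powi j)\<^sup>2) summable_on UNIV"
    and "(\<Sum>\<^sub>\<infinity>j. (norm (c j))\<^sup>2 * (r powi j)\<^sup>2) \<le> M\<^sup>2"
proof -
  define d where "d j = c j * of_real r powi j" for j
  define e where "e j = cnj (d (-j))" for j
  have d1: "lsummable 1 d"
    using c r unfolding lsummable_def d_def by (simp add: norm_mult norm_power_int)
  have e1: "lsummable 1 e"
    using d1 unfolding lsummable_def e_def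
    by (subst summable_on_reindex_bij_witness[where T=UNIV and i=uminus and j=uminus and h="\<lambda>j. norm (d j) * 1 powi j"]) auto
  have ld: "leval d z = leval c (of_real r * z)" for z
    unfolding leval_def d_def by (simp add: power_int_mult_distrib mult.assoc)
  have le: "leval e z = cnj (leval d z)" if "cmod z = 1" for z
  proof -
    have zc: "cnj z = inverse z" using that by (metis complex_cnj_cnj complex_norm_square inverse_unique mult.commute of_real_1 power_one)
    have "leval e z = (\<Sum>\<^sub>\<infinity>j. cnj (d j * z powi j))"
      unfolding leval_def e_def
      by (rule infsum_reindex_bij_witness[where i=uminus and j=uminus]) (auto simp: zc power_int_minus power_int_inverse)
    also have "\<dots> = cnj (leval d z)" unfolding leval_def by (rule infsum_cnj)
    finally show ?thesis .
  qed
  have lc: "leval (lconv d e) (cis t) = of_real ((cmod (leval d (cis t)))\<^sup>2)" for t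
    using leval_lconv[OF d1 e1, of "cis t"] le[of "cis t"] by (simp add: complex_norm_square[symmetric])
  have s2: "(\<lambda>i. (norm (c i))\<^sup>2 * (r powi i)\<^sup>2) summable_on UNIV"
    and l0: "lconv d e 0 = of_real (\<Sum>\<^sub>\<infinity>i. (norm (c i))\<^sup>2 * (r powi i)\<^sup>2)"
  proof -
    have de: "d i * e (0 - i) = of_real ((norm (c i))\<^sup>2 * (r powi i)\<^sup>2)" for i
    proof -
      have "d i * e (0 - i) = of_real ((norm (d i))\<^sup>2)" by (simp add: e_def complex_norm_square[symmetric])
      then show ?thesis using r by (simp add: d_def norm_mult norm_power_int power_mult_distrib)
    qed
    have "(\<lambda>i. d i * e (0 - i)) abs_summable_on UNIV" by (rule lconv_summable[OF d1 e1 zero_less_one])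
    then show s2: "(\<lambda>i. (norm (c i))\<^sup>2 * (r powi i)\<^sup>2) summable_on UNIV"
      using r unfolding de by (simp add: norm_mult norm_power norm_power_int)
    show "lconv d e 0 = of_real (\<Sum>\<^sub>\<infinity>i. (norm (c i))\<^sup>2 * (r powi i)\<^sup>2)"
      unfolding lconv_def de by (rule infsumI[OF has_sum_of_real[OF has_sum_infsum[OF s2]]])
  qed
  show "(\<lambda>j. (norm (c j))\<^sup>2 * (r powi j)\<^sup>2) summable_on UNIV" by (rule s2)
  have "((\<lambda>t. leval (lconv d e) (cis t)) has_integral (2*pi*lconv d e 0)) {0..2*pi}"
    using has_integral_leval[OF lsummable_lconv[OF d1 e1], of 0] by simp
  then have hi: "((\<lambda>t. (cmod (leval d (cis t)))\<^sup>2) has_integral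
      (2*pi*(\<Sum>\<^sub>\<infinity>i. (norm (c i))\<^sup>2 * (r powi i)\<^sup>2))) {0..2*pi}"
    unfolding lc l0 by (auto dest!: has_integral_Re)
  have "2*pi*(\<Sum>\<^sub>\<infinity>i. (norm (c i))\<^sup>2 * (r powi i)\<^sup>2) \<le> M\<^sup>2 * 2*pi"
  proof (rule has_integral_le[OF hi])
    show "((\<lambda>t. M\<^sup>2) has_integral M\<^sup>2 * 2*pi) {0..2*pi}"
      using has_integral_const_real[of "M\<^sup>2" 0 "2*pi"] by (simp add: mult_ac)
    show "(cmod (leval d (cis t)))\<^sup>2 \<le> M\<^sup>2" if "t \<in> {0..2*pi}" for t
      unfolding ld using r by (intro power_mono M) (auto simp: norm_mult)
  qed
  then show "(\<Sum>\<^sub>\<infinity>j. (norm (c j))\<^sup>2 * (r powi j)\<^sup>2) \<le> M\<^sup>2" by simp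
qed

text \<open>A single term of Parseval gives Cauchy's estimate without a contour integral.\<close>

lemma coeff_bound:
  assumes c: "lsummable r c" and r: "r > 0" and M: "\<And>z. cmod z = r \<Longrightarrow> cmod (leval c z) \<le> M"
  shows "norm (c j) * r powi j \<le> M"
proof -
  have M0: "M \<ge> 0" using M[of "of_real r"] r by (smt (verit) norm_ge_zero norm_of_real)
  have "sum (\<lambda>j. (norm (c j))\<^sup>2 * (r powi j)\<^sup>2) {j} \<le> (\<Sum>\<^sub>\<infinity>j. (norm (c j))\<^sup>2 * (r powi j)\<^sup>2)"
    by (rule finite_sum_le_infsum[OF parseval_bound(1)[OF assms]]) auto
  also have "\<dots> \<le> M\<^sup>2" by (rule parseval_bound(2)[OF assms])
  finally have "(norm (c j) * r powi j)\<^sup>2 \<le> M\<^sup>2" by (simp add: power_mult_distrib)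
  then show ?thesis using M0 by (rule power2_le_imp_le)
qed

section \<open>Division by powers of \<open>1 - z\<close> on the two sides of the pole\<close>

definition lunit :: "int \<Rightarrow> complex" where "lunit j = (if j = 0 then 1 else 0)"
text \<open>The expansions of \<open>1 / (1 - z)\<close> for \<open>cmod z < 1\<close> and for \<open>cmod z > 1\<close>.\<close>

definition lgeo_left :: "int \<Rightarrow> complex" where "lgeo_left j = (if j \<ge> 0 then 1 else 0)"
definition lgeo_right :: "int \<Rightarrow> complex" where "lgeo_right j = (if j < 0 then -1 else 0)"

lemma lsummable_lunit: "lsummable r lunit"
  unfolding lsummable_def by (rule summable_on_cong_neutral[THEN iffD1, of _ "{0}"]) (auto simp: lunit_def)

lemma leval_lunit: "leval lunit z = 1"
proof -
  have "leval lunit z = (\<Sum>\<^sub>\<infinity>j\<in>{0}. lunit j * z powi j)"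
    unfolding leval_def by (rule infsum_cong_neutral) (auto simp: lunit_def)
  then show ?thesis by (simp add: lunit_def)
qed

lemma lconv_lunit: "lconv c lunit = c"
proof
  fix j
  have "lconv c lunit j = (\<Sum>\<^sub>\<infinity>i\<in>{j}. c i * lunit (j - i))"
    unfolding lconv_def by (rule infsum_cong_neutral) (auto simp: lunit_def)
  then show "lconv c lunit j = c j" by (simp add: lunit_def)
qed


lemma summable_on_int_iff:
  fixes f :: "int \<Rightarrow> 'a :: banach"
  shows "f summable_on UNIV \<longleftrightarrow> (\<lambda>n::nat. f (int n)) summable_on UNIV \<and> (\<lambda>n::nat. f (- int n)) summable_on {1..}"
proof -
  have 1: "(\<lambda>n::nat. f (int n)) summable_on UNIV \<longleftrightarrow> f summable_on {0..}"
    by (rule summable_on_reindex_bij_witness[where i=nat and j=int]) auto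
  have 2: "(\<lambda>n::nat. f (- int n)) summable_on {1..} \<longleftrightarrow> f summable_on {..<0}"
    by (rule summable_on_reindex_bij_witness[where i="\<lambda>n. nat (-n)" and j="\<lambda>n. - int n"]) auto
  have U: "(UNIV::int set) = {0..} \<union> {..<0}" by auto
  show ?thesis unfolding 1 2
    using summable_on_subset_banach[of f UNIV "{0..}"] summable_on_subset_banach[of f UNIV "{..<0}"]
      summable_on_Un_disjoint[of f "{0..}" "{..<0}"] U by (auto simp: disjoint_iff)
qed

lemma infsum_int_split:
  fixes f :: "int \<Rightarrow> 'a :: banach"
  assumes "f summable_on UNIV"
  shows "infsum f UNIV = (\<Sum>\<^sub>\<infinity>n::nat. f (int n)) + (\<Sum>\<^sub>\<infinity>n\<in>{1::nat..}. f (- int n))"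
proof -
  have 1: "(\<Sum>\<^sub>\<infinity>n::nat. f (int n)) = infsum f {0..}"
    by (rule infsum_reindex_bij_witness[where i=nat and j=int]) auto
  have 2: "(\<Sum>\<^sub>\<infinity>n\<in>{1::nat..}. f (- int n)) = infsum f {..<0}"
    by (rule infsum_reindex_bij_witness[where i="\<lambda>n. nat (-n)" and j="\<lambda>n. - int n"]) auto
  have U: "(UNIV::int set) = {0..} \<union> {..<0}" by auto
  show ?thesis unfolding 1 2
    by (subst U, rule infsum_Un_disjoint) (auto intro: summable_on_subset_banach[OF assms])
qed

lemma summable_on_geometric: "0 \<le> r \<Longrightarrow> r < 1 \<Longrightarrow> (\<lambda>n::nat. r ^ n) summable_on A" for r :: real
  by (rule summable_on_subset_banach[OF norm_summable_imp_summable_on]) (auto intro: summable_geometric)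

lemma lsummable_lgeo_left: "0 < r \<Longrightarrow> r < 1 \<Longrightarrow> lsummable r lgeo_left"
  unfolding lsummable_def summable_on_int_iff
  by (auto simp: lgeo_left_def summable_on_geometric intro!: summable_on_0)

lemma lsummable_lgeo_right: "1 < r \<Longrightarrow> lsummable r lgeo_right"
  unfolding lsummable_def summable_on_int_iff
proof (intro conjI)
  assume r: "1 < r"
  have "(\<lambda>n::nat. inverse r ^ n) summable_on {1..}"
    using r by (intro summable_on_geometric) (auto simp: inverse_less_1_iff)
  then show "(\<lambda>n. norm (lgeo_right (- int n)) * r powi (- int n)) summable_on {1..}"
    by (rule summable_on_cong[THEN iffD1, rotated]) (auto simp: lgeo_right_def power_int_minus power_inverse)
qed (auto simp: lgeo_right_def)

lemma ldiff_lgeo_left: "ldiff lgeo_left = lunit" and ldiff_lgeo_right: "ldiff lgeo_right = lunit"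
  by (auto simp: ldiff_def lgeo_left_def lgeo_right_def lunit_def fun_eq_iff)

lemma ldiff_lconv_lgeo_left: "0 < r \<Longrightarrow> r < 1 \<Longrightarrow> lsummable r c \<Longrightarrow> ldiff (lconv c lgeo_left) = c"
  using ldiff_lconv[of r c lgeo_left] by (simp add: lsummable_lgeo_left ldiff_lgeo_left lconv_lunit)

lemma ldiff_lconv_lgeo_right: "1 < r \<Longrightarrow> lsummable r c \<Longrightarrow> ldiff (lconv c lgeo_right) = c"
  using ldiff_lconv[of r c lgeo_right] by (simp add: lsummable_lgeo_right ldiff_lgeo_right lconv_lunit)

text \<open>Division by \<open>1 - z\<close> amounts to partial sums from minus infinity inside the
  unit circle and to negated tails outside it.\<close>

abbreviation lsum_left where "lsum_left \<equiv> \<lambda>c. lconv c lgeo_left"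
abbreviation lsum_right where "lsum_right \<equiv> \<lambda>c. lconv c lgeo_right"

lemma lsummable_lsum_left_pow: "0 < r \<Longrightarrow> r < 1 \<Longrightarrow> lsummable r c \<Longrightarrow> lsummable r ((lsum_left ^^ k) c)"
  by (induction k) (auto intro!: lsummable_lconv lsummable_lgeo_left)

lemma lsummable_lsum_right_pow: "1 < r \<Longrightarrow> lsummable r c \<Longrightarrow> lsummable r ((lsum_right ^^ k) c)"
  by (induction k) (auto intro!: lsummable_lconv lsummable_lgeo_right)

lemma ldiff_lsum_left_pow: "0 < r \<Longrightarrow> r < 1 \<Longrightarrow> lsummable r c \<Longrightarrow> (ldiff ^^ k) ((lsum_left ^^ k) c) = c"
proof (induction k)
  case (Suc k)
  have "(ldiff ^^ Suc k) ((lsum_left ^^ Suc k) c) = (ldiff ^^ k) (ldiff (lsum_left ((lsum_left ^^ k) c)))"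
    by (simp add: funpow_swap1)
  then show ?case using Suc ldiff_lconv_lgeo_left[of r "(lsum_left ^^ k) c"] by (simp add: lsummable_lsum_left_pow)
qed auto

lemma ldiff_lsum_right_pow: "1 < r \<Longrightarrow> lsummable r c \<Longrightarrow> (ldiff ^^ k) ((lsum_right ^^ k) c) = c"
proof (induction k)
  case (Suc k)
  have "(ldiff ^^ Suc k) ((lsum_right ^^ Suc k) c) = (ldiff ^^ k) (ldiff (lsum_right ((lsum_right ^^ k) c)))"
    by (simp add: funpow_swap1)
  then show ?case using Suc ldiff_lconv_lgeo_right[of r "(lsum_right ^^ k) c"] by (simp add: lsummable_lsum_right_pow)
qed auto

lemma leval_lsum_left_pow:
  assumes "0 < r" "r < 1" "lsummable r c" "cmod z = r"
  shows "leval ((lsum_left ^^ k) c) z = leval c z / (1 - z) ^ k"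
proof -
  have "leval c z = (1 - z) ^ k * leval ((lsum_left ^^ k) c) z"
    using leval_ldiff_pow[OF lsummable_lsum_left_pow[OF assms(1-3), of k] assms(1,4), of k]
    by (simp add: ldiff_lsum_left_pow[OF assms(1-3)])
  moreover have "z \<noteq> 1" using assms by auto
  ultimately show ?thesis by (simp add: field_simps)
qed

lemma leval_lsum_right_pow:
  assumes "1 < r" "lsummable r c" "cmod z = r"
  shows "leval ((lsum_right ^^ k) c) z = leval c z / (1 - z) ^ k"
proof -
  have "leval c z = (1 - z) ^ k * leval ((lsum_right ^^ k) c) z"
    using leval_ldiff_pow[OF lsummable_lsum_right_pow[OF assms(1-2), of k] _ assms(3), of k] assms(1)
    by (simp add: ldiff_lsum_right_pow[OF assms(1-2)])
  moreover have "z \<noteq> 1" using assms by auto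
  ultimately show ?thesis by (simp add: field_simps)
qed

text \<open>The two expansions of \<open>1 / (1 - z)\<close> differ by the constant sequence 1, so
  the convolutions differ by the sum of \<open>c\<close>. This turns a value at the pole into the
  top difference of a polynomial sequence.\<close>

lemma lsum_left_minus_lsum_right:
  assumes "lsummable 1 c"
  shows "lsum_left c j - lsum_right c j = leval c 1"
proof -
  have s: "c abs_summable_on UNIV" using assms by (simp add: lsummable_def)
  have A: "(\<lambda>i. c i * lgeo_left (j - i)) summable_on UNIV"
    by (rule abs_summable_summable, rule Infinite_Sum.abs_summable_on_comparison_test[OF s]) (auto simp: lgeo_left_def)
  have B: "(\<lambda>i. c i * lgeo_right (j - i)) summable_on UNIV"
    by (rule abs_summable_summable, rule Infinite_Sum.abs_summable_on_comparison_test[OF s]) (auto simp: lgeo_right_def)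
  have "lconv c lgeo_left j = lconv c lgeo_right j + (\<Sum>\<^sub>\<infinity>i. c i * lgeo_left (j - i) - c i * lgeo_right (j - i))"
    unfolding lconv_def using A B by (simp add: infsum_minus summable_on_minus)
  also have "(\<lambda>i. c i * lgeo_left (j - i) - c i * lgeo_right (j - i)) = c"
    by (auto simp: lgeo_left_def lgeo_right_def fun_eq_iff)
  finally show ?thesis by (simp add: leval_def)
qed

section \<open>Polynomial sequences and their generating functions\<close>

lemma ldiff_pow_diff: "(ldiff ^^ k) (\<lambda>j. f j - g j) = (\<lambda>j. (ldiff ^^ k) f j - (ldiff ^^ k) g j)"
  by (induction k) (auto simp: ldiff_def fun_eq_iff)

text \<open>The polynomials \<open>(n + i) gchoose i\<close> are the right basis here because for \<open>i > 0\<close> they vanish at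
  \<open>-1\<close> and their backward difference is the preceding one.\<close>

lemma newton_expansion:
  assumes "(ldiff ^^ k) p = (\<lambda>_. 0)"
  shows "p n = (\<Sum>i<k. (ldiff ^^ i) p (-1) * ((of_int n + of_nat i) gchoose i))"
  using assms
proof (induction k arbitrary: p n)
  case (Suc k)
  define e where "e i n = ((of_int n + of_nat i :: complex) gchoose i)" for i and n :: int
  have e_diff: "e (Suc i) n - e (Suc i) (n - 1) = e i n" for i n
    using gbinomial_Suc_Suc[of "of_int n + of_nat i :: complex" i] by (simp add: e_def add_ac)
  have e_m1: "e (Suc i) (-1) = 0" for i
  proof -
    have "e (Suc i) (-1) = (of_nat i :: complex) gchoose Suc i" by (simp add: e_def)
    also have "\<dots> = of_nat (i choose Suc i)" by (rule binomial_gbinomial[symmetric])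
    finally show ?thesis by simp
  qed
  have q: "ldiff p n = (\<Sum>i<k. (ldiff ^^ Suc i) p (-1) * e i n)" for n
    unfolding e_def using Suc.IH[of "ldiff p" n] Suc.prems by (simp add: funpow_swap1)
  define s where "s n = (\<Sum>i<Suc k. (ldiff ^^ i) p (-1) * e i n)" for n
  have s': "s n = p (-1) + (\<Sum>i<k. (ldiff ^^ Suc i) p (-1) * e (Suc i) n)" for n
    unfolding s_def by (subst sum.lessThan_Suc_shift) (simp add: e_def)
  have s1: "s (-1) = p (-1)" unfolding s' by (simp add: e_m1)
  have sd: "s n - s (n - 1) = p n - p (n - 1)" for n
    using q[of n] unfolding s' ldiff_def[of p] by (simp add: sum_subtractf[symmetric] right_diff_distrib[symmetric] e_diff)
  have "s n = p n" for n
  proof (induction n rule: int_induct[where k="-1"])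
    case (step1 i) then show ?case using sd[of "i+1"] by simp
  next
    case (step2 i) then show ?case using sd[of i] by simp
  qed (simp add: s1)
  then show ?case by (simp add: s_def e_def)
qed simp

text \<open>For \<open>s = 1\<close> this is the generating function of \<open>p\<close> on the nonnegative integers, for \<open>s = 0\<close>
  minus the one on the negative integers: both are expansions of the same rational function.\<close>

lemma leval_cut:
  assumes "(ldiff ^^ k) p = (\<lambda>_. 0)" "lsummable r (\<lambda>j. if j \<ge> 0 then s * p j else (s - 1) * p j)" "r > 0" "cmod z = r" "z \<noteq> 1"
  shows "leval (\<lambda>j. if j \<ge> 0 then s * p j else (s - 1) * p j) z = (\<Sum>i<k. (ldiff ^^ i) p (-1) * (1 / (1 - z)) ^ Suc i)"
  using assms(1,2)
proof (induction k arbitrary: p)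
  case 0
  then show ?case by (auto simp: leval_def intro!: infsum_0)
next
  case (Suc k)
  define T where "T p = (\<lambda>j. if j \<ge> (0::int) then s * p j else (s - 1) * p j :: complex)" for p
  have Tp: "lsummable r (T p)" using Suc.prems(2) by (simp add: T_def)
  \<comment> \<open>Cutting and differencing fail to commute only at \<open>j = 0\<close>, and the
    defect there is \<open>- p (-1)\<close> whatever \<open>s\<close> is; this is why both
    expansions have the same sum.\<close>
  have rec: "T (ldiff p) = (\<lambda>j. ldiff (T p) j + (- p (-1)) * lunit j)"
  proof
    fix j :: int
    consider "j < 0" | "j = 0" | "j > 0" by linarith
    then show "T (ldiff p) j = ldiff (T p) j + (- p (-1)) * lunit j"
      by cases (auto simp: T_def ldiff_def lunit_def algebra_simps)
  qed
  have sl: "lsummable r (ldiff (T p))" by (rule lsummable_ldiff[OF Tp assms(3)])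
  have lT: "lsummable r (T (ldiff p))"
    unfolding rec by (rule lsummable_add[OF sl lsummable_cmult[OF lsummable_lunit] assms(3)])
  have "leval (T (ldiff p)) z = (1 - z) * leval (T p) z + (- p (-1)) * 1"
    unfolding rec leval_add[OF sl lsummable_cmult[OF lsummable_lunit] assms(4)] leval_cmult leval_lunit
      leval_ldiff[OF Tp assms(3,4)] ..
  moreover have "leval (T (ldiff p)) z = (\<Sum>i<k. (ldiff ^^ Suc i) p (-1) * (1 / (1 - z)) ^ Suc i)"
    using Suc.IH[of "ldiff p"] Suc.prems(1) lT by (simp add: T_def funpow_swap1)
  ultimately have "(1 - z) * leval (T p) z = p (-1) + (\<Sum>i<k. (ldiff ^^ Suc i) p (-1) * (1 / (1 - z)) ^ Suc i)"
    by simp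
  then have "leval (T p) z = (1 / (1 - z)) * (p (-1) + (\<Sum>i<k. (ldiff ^^ Suc i) p (-1) * (1 / (1 - z)) ^ Suc i))"
    using assms(5) by (simp add: field_simps)
  also have "\<dots> = (\<Sum>i<Suc k. (ldiff ^^ i) p (-1) * (1 / (1 - z)) ^ Suc i)"
    by (subst sum.lessThan_Suc_shift) (simp add: sum_distrib_left distrib_left mult_ac)
  finally show ?case by (simp add: T_def)
qed

text \<open>Summation by parts under summability of the products alone. This form is made for
  polynomial sequences, to which \<open>ldiff_lconv\<close> cannot be applied because no circle
  carries them.\<close>

lemma lconv_ldiff_swap:
  assumes "\<And>j. (\<lambda>i. f i * h (j - i)) abs_summable_on UNIV"
  shows "lconv f ((ldiff ^^ N) h) = lconv ((ldiff ^^ N) f) h"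
  using assms
proof (induction N arbitrary: f)
  case (Suc N)
  note s = abs_summable_summable[OF Suc.prems]
  have sh: "(\<lambda>i. f (i - 1) * h (j - i)) abs_summable_on UNIV" for j
    using Suc.prems[of "j - 1"]
    by (subst summable_on_reindex_bij_witness[where i="\<lambda>i. i + 1" and j="\<lambda>i. i - 1" and T=UNIV and h="\<lambda>i. norm (f i * h (j - 1 - i))"])
       (auto simp: algebra_simps)
  have ds: "(\<lambda>i. ldiff f i * h (j - i)) abs_summable_on UNIV" for j
  proof -
    have "(\<lambda>i. norm (f i * h (j - i)) + norm (f (i - 1) * h (j - i))) summable_on UNIV"
      by (rule summable_on_add[OF Suc.prems sh])
    then show ?thesis
      by (rule summable_on_comparison_test) (auto simp: ldiff_def left_diff_distrib norm_triangle_ineq4)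
  qed
  let ?g = "(ldiff ^^ N) h"
  have gs: "(\<lambda>i. f i * ?g (j - i)) abs_summable_on UNIV" for j
    using Suc.prems
  proof (induction N arbitrary: j)
    case (Suc N)
    have "(\<lambda>i. norm (f i * (ldiff ^^ N) h (j - i)) + norm (f i * (ldiff ^^ N) h (j - 1 - i))) summable_on UNIV"
      by (intro summable_on_add Suc)
    then show ?case
    proof (rule summable_on_comparison_test)
      fix i :: int
      have "f i * (ldiff ^^ Suc N) h (j - i) = f i * (ldiff ^^ N) h (j - i) - f i * (ldiff ^^ N) h (j - 1 - i)"
        by (simp add: ldiff_def[of "(ldiff ^^ N) h"] right_diff_distrib diff_diff_eq add.commute)
      then show "norm (f i * (ldiff ^^ Suc N) h (j - i)) \<le> norm (f i * (ldiff ^^ N) h (j - i)) + norm (f i * (ldiff ^^ N) h (j - 1 - i))"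
        by (simp only: norm_triangle_ineq4)
    qed auto
  qed simp
  have eq: "lconv (ldiff f) h j = lconv f (ldiff h) j" if "\<And>j. (\<lambda>i. f i * h (j - i)) abs_summable_on UNIV" for f h :: "int \<Rightarrow> complex" and j
  proof -
    note s = abs_summable_summable[OF that]
    have b: "bij_betw (\<lambda>i::int. i - 1) UNIV UNIV" by (rule bij_betwI[where g="\<lambda>i. i+1"]) auto
    have e: "f (i - 1) * h (j - i) = (\<lambda>i. f i * h (j - 1 - i)) (i - 1)" for i by (simp add: algebra_simps)
    have sh: "(\<lambda>i. f (i - 1) * h (j - i)) summable_on UNIV"
      unfolding e by (subst summable_on_reindex_bij_betw[OF b]) (rule s)
    have "lconv (ldiff f) h j = (\<Sum>\<^sub>\<infinity>i. f i * h (j - i) - f (i - 1) * h (j - i))"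
      by (simp add: lconv_def ldiff_def left_diff_distrib)
    also have "\<dots> = (\<Sum>\<^sub>\<infinity>i. f i * h (j - i)) - (\<Sum>\<^sub>\<infinity>i. f (i - 1) * h (j - i))"
      by (rule infsum_minus[OF s sh])
    also have "(\<Sum>\<^sub>\<infinity>i. f (i - 1) * h (j - i)) = (\<Sum>\<^sub>\<infinity>i. f i * h (j - 1 - i))"
      unfolding e by (rule infsum_reindex_bij_betw[OF b])
    also have "(\<Sum>\<^sub>\<infinity>i. f i * h (j - i)) - (\<Sum>\<^sub>\<infinity>i. f i * h (j - 1 - i)) = (\<Sum>\<^sub>\<infinity>i. f i * h (j - i) - f i * h (j - 1 - i))"
      by (rule infsum_minus[OF s s, symmetric])
    also have "\<dots> = lconv f (ldiff h) j" by (simp add: lconv_def ldiff_def right_diff_distrib algebra_simps)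
    finally show ?thesis .
  qed
  have "lconv f ((ldiff ^^ Suc N) h) = lconv (ldiff f) ?g"
    using eq[OF gs] by (auto simp: fun_eq_iff)
  also have "\<dots> = lconv ((ldiff ^^ N) (ldiff f)) h" by (rule Suc.IH[OF ds])
  finally show ?case by (simp add: funpow_swap1)
qed simp

section \<open>Green's function of the annulus\<close>

text \<open>In the coordinate \<open>z\<close> with \<open>u = z / (1 - z)\<close> the two disks become \<open>cmod z \<le> 1 / A\<close> and \<open>cmod z \<ge> B\<close>, and
  \<open>u = \<infinity>\<close> becomes \<open>z = 1\<close>. The Fourier coefficients of the densities of the equilibrium measure on the
  circles of radius \<open>1 / A\<close> and \<open>B\<close> are \<open>x = rho A B n\<close> and \<open>y = rho B A n\<close>: they solve
  \<open>A ^ n * x + B powi (-n) * y = 1\<close> and \<open>A powi (-n) * x + B ^ n * y = 1\<close>. For \<open>n = 0\<close> the formula gives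
  the junk value 0; the masses of the circles are \<open>rho0 A B\<close> and \<open>rho0 B A\<close>.\<close>

definition rho :: "real \<Rightarrow> real \<Rightarrow> nat \<Rightarrow> real" where
  "rho A B n = (B ^ n - inverse B ^ n) / ((A * B) ^ n - inverse (A * B) ^ n)"

definition rho0 :: "real \<Rightarrow> real \<Rightarrow> real" where
  "rho0 A B = ln B / (ln A + ln B)"

text \<open>Up to a constant factor, dividing the Fourier coefficients of a circle density by
  \<open>n\<close> gives those of its logarithmic potential. The term \<open>n = 0\<close> is 0; the
  total mass is treated apart through \<open>rho0\<close>.\<close>

definition HP :: "real \<Rightarrow> real \<Rightarrow> complex \<Rightarrow> complex" where
  "HP A B w = (\<Sum>n. of_real (rho A B n / n) * w ^ n)"

text \<open>What remains of Green's function, as a holomorphic function, once the logarithms of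
  \<open>z\<close> and \<open>1 - z\<close> are split off. The first series converges for
  \<open>1 / A\<^sup>2 < cmod z\<close>, the second for \<open>cmod z < B\<^sup>2\<close>.\<close>

definition LL :: "real \<Rightarrow> real \<Rightarrow> complex \<Rightarrow> complex" where
  "LL A B z = - (HP A B (1 / (of_real A * z)) + HP B A (z / of_real B))"

text \<open>Green's function of the annulus with pole 1, continued across both boundary circles; \<open>robin\<close> is the
  logarithm of the capacity.\<close>

definition green :: "real \<Rightarrow> real \<Rightarrow> complex \<Rightarrow> real" where
  "green A B z = rho0 A B * ln (cmod z) + rho0 B A * ln B - ln (cmod (1 - z)) + Re (LL A B z)"

definition robin :: "real \<Rightarrow> real \<Rightarrow> real" where
  "robin A B = - Re (LL A B 1) - rho0 B A * ln B"

locale annulus =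
  fixes A B :: real
  assumes A1: "A > 1" and B1: "B > 1"
begin

text \<open>Inversion \<open>z \<mapsto> 1 / z\<close> exchanges the two circles, so facts about the
  inner circle are transferred to the outer one by swapping \<open>A\<close> and
  \<open>B\<close>.\<close>

lemma sym: "annulus B A" using A1 B1 by unfold_locales

lemma AB_pow: "inverse (A * B) ^ n < (A * B) ^ n" if "n > 0"
proof -
  have "A * B > 1" using A1 B1 less_1_mult by blast
  then have "(A*B) ^ n > 1" using that by (intro one_less_power) auto
  moreover have "inverse ((A*B) ^ n) < 1" using calculation by (simp add: inverse_less_1_iff)
  ultimately show ?thesis by (simp only: power_inverse)
qed

lemma rho_nonneg: "rho A B n \<ge> 0"
proof (cases "n = 0")
  case False
  have "inverse B \<le> 1" using B1 by (simp add: inverse_le_1_iff)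
  then have "inverse B ^ n \<le> B ^ n" using B1 by (intro power_mono) auto
  then show ?thesis unfolding rho_def using AB_pow[of n] False by (intro divide_nonneg_pos) auto
qed (simp add: rho_def)

lemma rho_le: "rho A B n \<le> inverse A ^ n"
proof (cases "n = 0")
  case False
  have "inverse A ^ n \<le> 1" using A1 by (intro power_le_one) (auto simp: inverse_le_1_iff)
  moreover have "inverse A ^ n \<ge> 0" "inverse B ^ n \<ge> 0" using A1 B1 by auto
  ultimately have "inverse A ^ n * inverse A ^ n * inverse B ^ n \<le> 1 * 1 * inverse B ^ n"
    by (intro mult_mono) auto
  moreover have "inverse A ^ n * (A*B) ^ n = B ^ n" using A1 by (simp add: power_mult_distrib power_inverse)
  moreover have "inverse (A*B) ^ n = inverse A ^ n * inverse B ^ n" by (simp add: power_mult_distrib)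
  ultimately have "inverse A ^ n * ((A*B) ^ n - inverse (A*B) ^ n) \<ge> B ^ n - inverse B ^ n"
    by (simp add: right_diff_distrib mult.assoc)
  then show ?thesis unfolding rho_def using AB_pow[of n] False by (simp add: divide_le_eq)
qed (simp add: rho_def)

lemma rho_eq: "n > 0 \<Longrightarrow> A ^ n * rho A B n + inverse B ^ n * rho B A n = 1"
proof -
  assume n: "n > 0"
  have d: "(A * B) ^ n - inverse (A * B) ^ n \<noteq> 0" using AB_pow[OF n] by simp
  have "A ^ n * (B ^ n - inverse B ^ n) + inverse B ^ n * (A ^ n - inverse A ^ n) = (A * B) ^ n - inverse (A * B) ^ n"
    by (simp add: algebra_simps power_mult_distrib inverse_mult_distrib)
  then show ?thesis unfolding rho_def mult.commute[of B A] using d by (simp add: add_divide_distrib[symmetric])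
qed

lemma ln_pos: "ln A > 0" "ln B > 0" using A1 B1 by auto

lemma rho0_sum: "rho0 A B + rho0 B A = 1"
  using ln_pos unfolding rho0_def by (simp add: add.commute add_divide_distrib[symmetric])

lemma rho0_eq: "rho0 A B * ln A = rho0 B A * ln B"
  unfolding rho0_def by (simp add: add.commute)

lemma HP_summable: "cmod w < A \<Longrightarrow> summable (\<lambda>n. norm (of_real (rho A B n / n) * w ^ n))"
proof (rule summable_comparison_test'[where N=0])
  assume w: "cmod w < A"
  show "summable (\<lambda>n. (cmod w / A) ^ n)" using w A1 by (intro summable_geometric) auto
  fix n :: nat
  have "rho A B n / n \<le> inverse A ^ n / 1"
  proof (cases "n = 0")
    case False
    then show ?thesis using rho_le[of n] rho_nonneg[of n] A1 by (intro frac_le) auto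
  qed (simp add: rho_def)
  then have "rho A B n / n * cmod w ^ n \<le> inverse A ^ n / 1 * cmod w ^ n" by (rule mult_right_mono) simp
  then have "rho A B n / n * cmod w ^ n \<le> (cmod w / A) ^ n"
    by (simp add: power_divide power_inverse divide_inverse power_mult_distrib mult.commute)
  moreover have "norm (of_real (rho A B n / n) * w ^ n) = rho A B n / n * cmod w ^ n"
    unfolding norm_mult norm_power norm_of_real using rho_nonneg[of n] by simp
  ultimately show "norm (norm (of_real (rho A B n / n) * w ^ n)) \<le> (cmod w / A) ^ n"
    by (metis abs_norm_cancel real_norm_def)
qed

lemma HP_sums: "cmod w < A \<Longrightarrow> (\<lambda>n. of_real (rho A B n / n) * w ^ n) sums HP A B w"
  unfolding HP_def by (rule summable_sums[OF summable_norm_cancel[OF HP_summable]])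

lemma HP_holomorphic: "HP A B holomorphic_on ball 0 A"
  by (rule power_series_holomorphic[where a="\<lambda>n. of_real (rho A B n / n)"]) (use HP_sums in auto)

lemma HP_cnj: "HP A B (cnj w) = cnj (HP A B w)" if "cmod w < A"
proof -
  have "(\<lambda>n. cnj (of_real (rho A B n / n) * w ^ n)) sums cnj (HP A B w)"
    using HP_sums[OF that] by (simp only: sums_cnj)
  then have "(\<lambda>n. of_real (rho A B n / n) * cnj w ^ n) sums cnj (HP A B w)" by simp
  then show ?thesis unfolding HP_def by (simp add: sums_iff)
qed

lemma LL_inverse: "z \<noteq> 0 \<Longrightarrow> LL A B (1 / z) = LL B A z"
  unfolding LL_def by (simp add: field_simps)

lemma green_inverse: assumes "z \<noteq> 0" shows "green A B (1 / z) = green B A z"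
\<comment> \<open>At the pole \<open>ln 0 = 0\<close> in HOL, so the quotient rule for logarithms
  used below does not cover this point.\<close>
proof (cases "z = 1")
  case True
  then show ?thesis unfolding green_def using LL_inverse[of 1] rho0_eq by simp
next
  case False
  have "cmod (1 - 1/z) = cmod (1 - z) / cmod z"
    using assms by (simp add: norm_divide[symmetric] diff_divide_distrib norm_minus_commute)
  then have "ln (cmod (1 - 1/z)) = ln (cmod (1 - z)) - ln (cmod z)"
    using False assms by (simp add: ln_div)
  moreover have "ln (cmod (1/z)) = - ln (cmod z)" using assms by (simp add: norm_divide ln_div)
  moreover have "rho0 A B * ln (cmod z) = ln (cmod z) - rho0 B A * ln (cmod z)"
    using rho0_sum by (metis add_diff_cancel_right' left_diff_distrib mult_1)
  ultimately show ?thesis unfolding green_def using LL_inverse[OF assms] rho0_eq by simp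
qed

text \<open>This is \<open>rho_eq\<close> summed against \<open>z ^ n / n\<close>. It trades the
  singular term \<open>ln (1 - z)\<close> of Green's function for values of
  \<open>HP A B\<close>.\<close>

lemma HP_identity:
  assumes "cmod z < 1"
  shows "HP A B (of_real A * z) + HP B A (z / of_real B) = - ln (1 - z)"
proof -
  have Bz: "cmod (z / of_real B) < B" using assms B1 by (simp add: norm_divide divide_less_eq) (smt (verit) mult_less_cancel_left1)
  have Az: "cmod (of_real A * z) < A" using assms A1 by (simp add: norm_mult)
  have s1: "(\<lambda>n. - ((- (-z)) ^ n) / of_nat n) sums ln (1 + (-z))" by (rule Ln_series') (use assms in auto)
  have s2: "(\<lambda>n. of_real (rho B A n / n) * (z / of_real B) ^ n) sums HP B A (z / of_real B)"
    by (rule annulus.HP_sums[OF sym Bz])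
  have s3: "(\<lambda>n. - (- ((- (-z)) ^ n) / of_nat n) - of_real (rho B A n / n) * (z / of_real B) ^ n) sums (- ln (1 + (-z)) - HP B A (z / of_real B))"
    by (intro sums_diff sums_minus s1 s2)
  have "(- (- ((- (-z)) ^ n) / of_nat n) - of_real (rho B A n / n) * (z / of_real B) ^ n) = of_real (rho A B n / n) * (of_real A * z) ^ n" for n
  proof (cases "n = 0")
    case False
    have "complex_of_real (A ^ n * rho A B n) = 1 - of_real (inverse B ^ n * rho B A n)"
      using rho_eq[of n] False by (metis add_diff_cancel_right' neq0_conv of_real_1 of_real_diff)
    then have "complex_of_real (rho A B n) * of_real A ^ n = 1 - of_real (rho B A n) / of_real B ^ n"
      by (simp add: power_inverse divide_inverse mult.commute)
    then have "complex_of_real (rho A B n / n) * (of_real A * z) ^ n = (1 - of_real (rho B A n) / of_real B ^ n) * (z ^ n / of_nat n)"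
      by (metis (no_types, lifting) mult.assoc mult.commute of_real_divide of_real_of_nat_eq power_mult_distrib times_divide_eq_left times_divide_eq_right)
    then show ?thesis by (simp add: power_divide algebra_simps)
  qed (simp add: rho_def)
  with s3 have "(\<lambda>n. of_real (rho A B n / n) * (of_real A * z) ^ n) sums (- ln (1 + (-z)) - HP B A (z / of_real B))" by simp
  then have "HP A B (of_real A * z) = - ln (1 - z) - HP B A (z / of_real B)" unfolding HP_def by (simp add: sums_iff)
  then show ?thesis by simp
qed

text \<open>In terms of \<open>w = A * z\<close> the points \<open>w\<close> and
  \<open>1 / w\<close> enter with opposite signs, so oddness under reflection in the inner circle
  becomes visible, and with it the vanishing on that circle.\<close>

lemma green_inner:
  assumes "1 / A\<^sup>2 < cmod z" "cmod z < 1"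
  shows "green A B z = rho0 A B * ln (A * cmod z) + Re (HP A B (of_real A * z) - HP A B (1 / (of_real A * z)))"
proof -
  have z0: "z \<noteq> 0" using assms(1) A1 by auto
  have H: "HP A B (of_real A * z) = - ln (1 - z) - HP B A (z / of_real B)"
    using HP_identity[OF assms(2)] by (simp add: algebra_simps)
  have nz: "1 - z \<noteq> 0" using assms by auto
  have "Re (ln (1 - z)) = ln (cmod (1 - z))" using nz by simp
  moreover have "ln (A * cmod z) = ln A + ln (cmod z)" using A1 z0 by (simp add: ln_mult)
  ultimately show ?thesis unfolding green_def H LL_def using rho0_eq by (simp add: algebra_simps)
qed

lemma green_inner_circle:
  assumes "cmod z = 1 / A" shows "green A B z = 0"
proof -
  have 1: "1 / A\<^sup>2 < cmod z" "cmod z < 1" unfolding assms using A1 by (auto simp: power2_eq_square field_simps)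
  have z: "1 / (of_real A * z) = cnj (of_real A * z)"
  proof -
    define w where "w = of_real A * z"
    have w1: "cmod w = 1" using assms A1 by (simp add: w_def norm_mult)
    have "w * cnj w = 1" using w1 complex_norm_square[of w] by simp
    moreover have "w \<noteq> 0" using w1 by auto
    ultimately show ?thesis unfolding w_def[symmetric] by (auto simp: divide_eq_eq mult.commute)
  qed
  have "cmod (of_real A * z) < A" using assms A1 by (simp add: norm_mult)
  then have "HP A B (1 / (of_real A * z)) = cnj (HP A B (of_real A * z))" unfolding z by (rule HP_cnj)
  then show ?thesis unfolding green_inner[OF 1] using assms A1 by simp
qed

text \<open>Schwarz reflection made explicit; it will turn positivity in the annulus into negativity
  beyond the inner circle.\<close>

lemma green_reflect:
  assumes "1 / A\<^sup>2 < cmod z" "cmod z < 1"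
  shows "green A B (1 / (of_real (A\<^sup>2) * cnj z)) = - green A B z"
proof -
  define y where "y = 1 / (of_real (A\<^sup>2) * cnj z)"
  have z0: "z \<noteq> 0" using assms(1) A1 by auto
  have cy: "cmod y = 1 / (A\<^sup>2 * cmod z)" unfolding y_def using A1 by (simp add: norm_divide norm_mult norm_power)
  have 1: "1 / A\<^sup>2 < cmod y" "cmod y < 1"
    unfolding cy using assms A1 z0 by (auto simp: field_simps)
  have a: "of_real A * y = cnj (1 / (of_real A * z))" "1 / (of_real A * y) = cnj (of_real A * z)"
    unfolding y_def using A1 z0 by (auto simp: power2_eq_square field_simps)
  have c1: "cmod (1 / (of_real A * z)) < A" using assms(1) A1 z0 by (simp add: norm_divide norm_mult power2_eq_square field_simps)
  have c2: "cmod (of_real A * z) < A" using assms(2) A1 by (simp add: norm_mult)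
  have "ln (A * cmod y) = - ln (A * cmod z)"
  proof -
    have "A * cmod y = inverse (A * cmod z)" unfolding cy using A1 z0 by (simp add: power2_eq_square field_simps)
    then show ?thesis using A1 z0 by (simp only: ln_inverse)
  qed
  moreover have "HP A B (of_real A * y) = cnj (HP A B (1 / (of_real A * z)))"
    unfolding a(1) by (rule HP_cnj[OF c1])
  moreover have "HP A B (1 / (of_real A * y)) = cnj (HP A B (of_real A * z))"
    by (subst a(2)) (rule HP_cnj[OF c2])
  ultimately show ?thesis
    unfolding y_def[symmetric] green_inner[OF 1] green_inner[OF assms] by simp
qed

lemma LL_holomorphic: "LL A B holomorphic_on {z. 1 / A\<^sup>2 < cmod z \<and> cmod z < B\<^sup>2}"
proof -
  let ?S = "{z. 1 / A\<^sup>2 < cmod z \<and> cmod z < B\<^sup>2}"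
  have "(HP A B \<circ> (\<lambda>z. 1 / (of_real A * z))) holomorphic_on ?S"
  proof (rule holomorphic_on_compose_gen[OF _ HP_holomorphic])
    show "(\<lambda>z. 1 / (complex_of_real A * z)) holomorphic_on ?S"
      using A1 by (intro holomorphic_intros) auto
    show "(\<lambda>z. 1 / (complex_of_real A * z)) ` ?S \<subseteq> ball 0 A"
    proof (clarsimp simp: norm_divide norm_mult)
      fix z :: complex assume z: "1 / A\<^sup>2 < cmod z"
      then have "z \<noteq> 0" using A1 by auto
      moreover have "1 < cmod z * A\<^sup>2" using z A1 by (simp add: divide_less_eq)
      ultimately show "1 / (\<bar>A\<bar> * cmod z) < A" using A1 by (simp add: divide_less_eq power2_eq_square mult_ac)
    qed
  qed
  moreover have "(HP B A \<circ> (\<lambda>z. z / of_real B)) holomorphic_on ?S"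
  proof (rule holomorphic_on_compose_gen[OF _ annulus.HP_holomorphic[OF sym]])
    show "(\<lambda>z. z / complex_of_real B) holomorphic_on ?S"
      using B1 by (intro holomorphic_intros) auto
    show "(\<lambda>z. z / complex_of_real B) ` ?S \<subseteq> ball 0 B"
      using B1 by (auto simp: norm_divide power2_eq_square divide_less_eq)
  qed
  ultimately show ?thesis unfolding LL_def o_def by (intro holomorphic_intros)
qed

lemma green_outer_circle:
  assumes "cmod z = B" shows "green A B z = 0"
proof -
  have "z \<noteq> 0" using assms B1 by auto
  then have "green A B z = green B A (1 / z)" using annulus.green_inverse[OF sym, of z] by simp
  also have "\<dots> = 0" by (rule annulus.green_inner_circle[OF sym]) (use assms in \<open>simp add: norm_divide\<close>)
  finally show ?thesis .
qed

text \<open>The multivalued function with modulus \<open>exp (- green A B z)\<close> becomes single-valued on a strip in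
  the coordinate \<open>ln z\<close>, and its modulus is periodic there, so the maximum modulus principle applies.\<close>

lemma green_pos:
  assumes z: "1 / A < cmod z" "cmod z < B" "z \<noteq> 1"
  shows "green A B z > 0"
proof (rule ccontr)
  assume neg: "\<not> ?thesis"
  \<comment> \<open>The factor \<open>1 - exp s\<close> cancels the pole of Green's function, so
    \<open>h\<close> vanishes at 0; this zero contradicts constancy at the end.\<close>
  define h where "h s = (1 - exp s) * exp (- (of_real (rho0 A B) * s + of_real (rho0 B A * ln B) + LL A B (exp s)))" for s
  define T where "T = {s. - 2 * ln A < Re s \<and> Re s < 2 * ln B}"
  define S where "S = {s. - ln A < Re s \<and> Re s < ln B}"
  have expT: "1 / A\<^sup>2 < cmod (exp s) \<and> cmod (exp s) < B\<^sup>2" if "s \<in> T" for s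
  proof -
    have "exp (- (2 * ln A)) < exp (Re s)" "exp (Re s) < exp (2 * ln B)" using that by (auto simp: T_def)
    moreover have "exp (- (2 * ln A)) = 1 / A\<^sup>2" "exp (2 * ln B) = B\<^sup>2"
      using A1 B1 by (auto simp: exp_minus exp_double divide_inverse)
    ultimately show ?thesis by simp
  qed
  have "(LL A B \<circ> exp) holomorphic_on T"
    by (rule holomorphic_on_compose_gen[OF _ LL_holomorphic]) (use expT in \<open>auto intro!: holomorphic_intros\<close>)
  then have holT: "h holomorphic_on T"
    unfolding h_def o_def by (intro holomorphic_intros)
  have ST: "S \<subseteq> T" unfolding S_def T_def using ln_pos by auto
  have nh: "cmod (h s) = cmod (1 - exp s) * exp (- (rho0 A B * Re s + rho0 B A * ln B + Re (LL A B (exp s))))" for s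
    unfolding h_def by (simp add: norm_mult)
  have hg: "cmod (h s) = exp (- green A B (exp s))" if "exp s \<noteq> 1" for s
    unfolding nh green_def using that by (simp add: exp_diff exp_add exp_minus field_simps)
  have bd: "cmod (h s) = 1" if "Re s = - ln A \<or> Re s = ln B" for s
  proof -
    have "exp s \<noteq> 1"
    proof
      assume "exp s = 1"
      then have "exp (Re s) = 1" using norm_exp_eq_Re[of s] by simp
      then show False using that ln_pos by auto
    qed
    moreover have "green A B (exp s) = 0"
    proof (cases "Re s = - ln A")
      case True
      then have "cmod (exp s) = 1 / A" using A1 by (simp add: exp_minus divide_inverse)
      then show ?thesis by (rule green_inner_circle)
    next
      case False
      then have "cmod (exp s) = B" using that B1 by simp
      then show ?thesis by (rule green_outer_circle)
    qed
    ultimately show ?thesis using hg by simp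
  qed
  define K where "K = cbox (Complex (- ln A) 0) (Complex (ln B) (2 * pi))"
  have KT: "K \<subseteq> T" unfolding K_def T_def using ln_pos by (auto simp: in_cbox_complex_iff)
  have "continuous_on K (\<lambda>s. cmod (h s))"
    by (intro continuous_intros holomorphic_on_imp_continuous_on holomorphic_on_subset[OF holT KT])
  moreover have "K \<noteq> {}" unfolding K_def using ln_pos by (auto simp: box_ne_empty Basis_complex_def)
  ultimately obtain s0 where s0: "s0 \<in> K" "\<And>s. s \<in> K \<Longrightarrow> cmod (h s) \<le> cmod (h s0)"
    using continuous_attains_sup[of K "\<lambda>s. cmod (h s)"] unfolding K_def by auto
  have max: "cmod (h s) \<le> cmod (h s0)" if "s \<in> S" for s
  proof -
    \<comment> \<open>The modulus depends on \<open>s\<close> only through \<open>Re s\<close> and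
      \<open>exp s\<close>. Moving the imaginary part into one period therefore lets the compact
      rectangle \<open>K\<close> capture the maximum over the whole strip.\<close>
    define s' where "s' = Complex (Re s) (Arg2pi (exp s))"
    have "s' = of_real (Re s) + \<i> * of_real (Arg2pi (exp s))" by (simp add: s'_def complex_eq_iff)
    then have "exp s' = exp s" using Arg2pi_eq[of "exp s"] by (simp add: exp_add exp_of_real)
    then have "cmod (h s) = cmod (h s')" unfolding nh by (simp add: s'_def)
    moreover have "s' \<in> K" using that Arg2pi_ge_0[of "exp s"] Arg2pi_lt_2pi[of "exp s"]
      unfolding K_def S_def by (auto simp: in_cbox_complex_iff s'_def)
    ultimately show ?thesis using s0(2) by simp
  qed
  have zz: "z \<noteq> 0" using z(1) A1 by auto
  define s1 where "s1 = Ln z"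
  have s1: "exp s1 = z" using zz by (simp add: s1_def)
  have s1S: "s1 \<in> S"
  proof -
    have "ln (1 / A) < ln (cmod z)" "ln (cmod z) < ln B" using z A1 B1 zz by (auto simp del: ln_less_cancel_iff intro!: ln_less_cancel_iff[THEN iffD2])
    then show ?thesis using zz A1 by (simp add: S_def s1_def ln_div)
  qed
  have h1: "cmod (h s1) \<ge> 1" using hg[of s1] neg z(3) s1 by simp
  \<comment> \<open>A maximum on the boundary lines has value 1, and by the assumption on
    \<open>z\<close> it is then also attained at the interior point \<open>s1\<close>.\<close>
  obtain s2 where s2: "s2 \<in> S" "\<And>s. s \<in> S \<Longrightarrow> cmod (h s) \<le> cmod (h s2)" "cmod (h s2) \<ge> 1"
  proof (cases "s0 \<in> S")
    case True then show ?thesis using that[of s0] max h1 max[OF s1S] by auto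
  next
    case False
    then have "cmod (h s0) = 1" using s0(1) by (intro bd) (auto simp: S_def K_def in_cbox_complex_iff)
    then have "cmod (h s) \<le> cmod (h s1)" if "s \<in> S" for s using max[OF that] h1 by linarith
    then show ?thesis using that[of s1] h1 s1S by blast
  qed
  have oS: "open S" unfolding S_def
    by (intro open_Collect_conj open_halfspace_Re_lt open_halfspace_Re_gt)
  have cS: "connected S"
  proof -
    have "S = {s. Re s > - ln A} \<inter> {s. Re s < ln B}" by (auto simp: S_def)
    then show ?thesis by (auto intro!: convex_connected convex_Int convex_halfspace_Re_lt convex_halfspace_Re_gt)
  qed
  have "h constant_on S"
    by (rule maximum_modulus_principle[OF holomorphic_on_subset[OF holT ST] oS cS oS order_refl s2(1)]) (rule s2(2))
  moreover have "0 \<in> S" using ln_pos by (simp add: S_def)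
  ultimately have "h s2 = h 0" using s2(1) unfolding constant_on_def by metis
  then show False using s2(3) by (simp add: h_def)
qed

end

section \<open>Laurent coefficients of exponentials of Green's function\<close>

lemma ball_expansion:
  assumes "f holomorphic_on ball 0 R"
  obtains c :: "int \<Rightarrow> complex" where "\<And>r. 0 < r \<Longrightarrow> r < R \<Longrightarrow> lsummable r c"
    "\<And>z. 0 < cmod z \<Longrightarrow> cmod z < R \<Longrightarrow> leval c z = f z"
proof
  define a where "a n = (deriv ^^ n) f 0 / fact n" for n
  define c where "c j = (if j \<ge> 0 then a (nat j) else 0)" for j :: int
  have sm: "(\<lambda>n. a n * z ^ n) sums f z" if "cmod z < R" for z
    using holomorphic_power_series[OF assms, of z] that by (simp add: a_def)
  have as: "summable (\<lambda>n. norm (a n * z ^ n))" if "cmod z < R" for z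
  proof -
    define y where "y = (cmod z + R) / 2"
    have y: "cmod z < y" "y < R" using that by (auto simp: y_def)
    have "summable (\<lambda>n. a n * (of_real y :: complex) ^ n)"
      using sm[of "of_real y"] y norm_ge_zero[of z] by (auto simp: sums_iff)
    then show ?thesis by (rule powser_insidea) (use y norm_ge_zero[of z] in auto)
  qed
  show ls: "lsummable r c" if "0 < r" "r < R" for r
  proof -
    have "(\<lambda>n. norm (a n) * r ^ n) summable_on UNIV"
      using as[of "of_real r"] that by (intro norm_summable_imp_summable_on) (auto simp: norm_mult norm_power)
    moreover have "(\<lambda>n. norm (c (- int n)) * r powi (- int n)) summable_on {1..}"
      by (rule summable_on_0) (auto simp: c_def)
    ultimately show ?thesis unfolding lsummable_def summable_on_int_iff by (simp add: c_def)
  qed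
  show "leval c z = f z" if "0 < cmod z" "cmod z < R" for z
  proof -
    have "leval c z = (\<Sum>\<^sub>\<infinity>n::nat. c (int n) * z powi int n) + (\<Sum>\<^sub>\<infinity>n\<in>{1::nat..}. c (- int n) * z powi (- int n))"
      unfolding leval_def
      by (rule infsum_int_split) (rule abs_summable_summable[OF lsummableD[OF ls[OF that] refl]])
    also have "(\<Sum>\<^sub>\<infinity>n\<in>{1::nat..}. c (- int n) * z powi (- int n)) = 0"
      by (rule infsum_0) (auto simp: c_def)
    also have "(\<Sum>\<^sub>\<infinity>n::nat. c (int n) * z powi int n) = (\<Sum>\<^sub>\<infinity>n. a n * z ^ n)" by (simp add: c_def)
    also have "\<dots> = f z" using norm_summable_imp_has_sum[OF as[OF that(2)] sm[OF that(2)]] by (rule infsumI)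
    finally show ?thesis by simp
  qed
qed

lemma lsummable_reflect:
  assumes "lsummable (inverse r) c" "r > 0"
  shows "lsummable r (\<lambda>j. c (- j))"
  using assms unfolding lsummable_def
  by (subst summable_on_reindex_bij_witness[where i=uminus and j=uminus and T=UNIV and h="\<lambda>j. norm (c j) * inverse r powi j"])
     (auto simp: power_int_minus power_int_inverse)

lemma leval_reflect: "leval (\<lambda>j. c (- j)) z = leval c (inverse z)"
  unfolding leval_def
  by (rule infsum_reindex_bij_witness[where i=uminus and j=uminus]) (auto simp: power_int_minus power_int_inverse)

context annulus
begin

text \<open>\<open>LL\<close> is a function of \<open>1 / z\<close> plus a function of
  \<open>z\<close>, so the exponential factors into two Taylor series, and their convolution is the
  Laurent series. The exponent \<open>s\<close> may be any real number, but \<open>m\<close> must be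
  an integer.\<close>

lemma laurent_exists:
  obtains \<psi> where "\<And>r. 1 / A\<^sup>2 < r \<Longrightarrow> r < B\<^sup>2 \<Longrightarrow> lsummable r \<psi>"
    "\<And>z. 1 / A\<^sup>2 < cmod z \<Longrightarrow> cmod z < B\<^sup>2 \<Longrightarrow>
      leval \<psi> z = z powi m * exp (of_real s * (LL A B z + of_real (rho0 B A * ln B)))"
proof -
  have "(\<lambda>w. exp (- of_real s * (HP A B \<circ> (\<lambda>w. w / of_real A)) w)) holomorphic_on ball 0 (A\<^sup>2)"
    using A1 by (intro holomorphic_intros holomorphic_on_compose_gen[OF _ HP_holomorphic])
       (auto simp: norm_divide divide_less_eq power2_eq_square)
  then obtain c1 where c1: "\<And>r. 0 < r \<Longrightarrow> r < A\<^sup>2 \<Longrightarrow> lsummable r c1"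
    "\<And>z. 0 < cmod z \<Longrightarrow> cmod z < A\<^sup>2 \<Longrightarrow> leval c1 z = exp (- of_real s * (HP A B (z / of_real A)))"
    by (rule ball_expansion) (auto simp: o_def)
  have "(\<lambda>w. exp (- of_real s * (HP B A \<circ> (\<lambda>w. w / of_real B)) w)) holomorphic_on ball 0 (B\<^sup>2)"
    using B1 by (intro holomorphic_intros holomorphic_on_compose_gen[OF _ annulus.HP_holomorphic[OF sym]])
       (auto simp: norm_divide divide_less_eq power2_eq_square)
  then obtain c2 where c2: "\<And>r. 0 < r \<Longrightarrow> r < B\<^sup>2 \<Longrightarrow> lsummable r c2"
    "\<And>z. 0 < cmod z \<Longrightarrow> cmod z < B\<^sup>2 \<Longrightarrow> leval c2 z = exp (- of_real s * (HP B A (z / of_real B)))"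
    by (rule ball_expansion) (auto simp: o_def)
  define K where "K = exp (of_real (s * (rho0 B A * ln B)) :: complex)"
  define d where "d = lconv (\<lambda>j. c1 (- j)) c2"
  have iA: "0 < r \<and> inverse r < A\<^sup>2 \<and> 0 < inverse r" if "1 / A\<^sup>2 < r" for r :: real
  proof -
    have "0 < r" using that A1 by (smt (verit) zero_le_divide_1_iff zero_le_power2)
    then show ?thesis using that A1 by (simp add: field_simps)
  qed
  have ls1: "lsummable r (\<lambda>j. c1 (- j))" if "1 / A\<^sup>2 < r" for r
    by (rule lsummable_reflect) (use c1(1)[of "inverse r"] iA[OF that] in auto)
  have ls: "lsummable r d" if "1 / A\<^sup>2 < r" "r < B\<^sup>2" for r
    unfolding d_def using that iA[OF that(1)] by (intro lsummable_lconv ls1 c2(1)) auto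
  show ?thesis
  proof (rule that[of "\<lambda>j. K * d (j + (-m))"])
    show "lsummable r (\<lambda>j. K * d (j + (-m)))" if "1 / A\<^sup>2 < r" "r < B\<^sup>2" for r
      by (rule lsummable_cmult[OF lsummable_shift[OF ls[OF that]]]) (use iA[OF that(1)] in simp)
    fix z assume z: "1 / A\<^sup>2 < cmod z" "cmod z < B\<^sup>2"
    have "leval (\<lambda>j. K * d (j + (-m))) z = K * (z powi (-(-m)) * leval d z)"
      unfolding leval_cmult using leval_shift[OF ls[OF z] _ refl, of "-m"] iA[OF z(1)] by simp
    also have "leval d z = leval (\<lambda>j. c1 (- j)) z * leval c2 z"
      unfolding d_def using iA[OF z(1)] by (intro leval_lconv[OF ls1[OF z(1)] c2(1)[OF _ z(2)]]) auto
    also have "\<dots> = exp (- of_real s * HP A B (inverse z / of_real A)) * exp (- of_real s * HP B A (z / of_real B))"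
      unfolding leval_reflect using iA[OF z(1)] z by (subst c1(2), simp_all add: norm_inverse c2(2))
    finally show "leval (\<lambda>j. K * d (j + (-m))) z = z powi m * exp (of_real s * (LL A B z + of_real (rho0 B A * ln B)))"
      by (simp add: K_def LL_def exp_add[symmetric] exp_diff exp_minus field_simps)
  qed
qed

text \<open>The exponent \<open>m - s * rho0 A B\<close> measures the failure of single-valuedness;
  for \<open>m\<close> within 1 of \<open>s * rho0 A B\<close> the first factor is bounded on a
  fixed circle uniformly in \<open>s\<close>. The last factor is cancelled later by a power of
  \<open>1 - z\<close>.\<close>

lemma norm_laurent_factor:
  assumes "z \<noteq> 0"  "z \<noteq> 1"
  shows "cmod (z powi m * exp (of_real s * (LL A B z + of_real (rho0 B A * ln B)))) =
     cmod z powr (of_int m - s * rho0 A B) * exp (s * green A B z) * cmod (1 - z) powr s"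
proof -
  have "cmod (z powi m * exp (of_real s * (LL A B z + of_real (rho0 B A * ln B)))) =
      cmod z powr of_int m * exp (s * (Re (LL A B z) + rho0 B A * ln B))"
    using assms by (simp add: norm_mult norm_power_int powr_real_of_int')
  also have "\<dots> = exp (of_int m * ln (cmod z) + s * (Re (LL A B z) + rho0 B A * ln B))"
    using assms by (simp add: powr_def exp_add)
  also have "\<dots> = exp ((of_int m - s * rho0 A B) * ln (cmod z) + s * green A B z + s * ln (cmod (1 - z)))"
    unfolding green_def by (simp add: algebra_simps)
  finally show ?thesis using assms by (simp add: powr_def exp_add)
qed

lemma LL_one_real: "LL A B 1 = of_real (Re (LL A B 1))"
proof -
  have "cmod (1 / of_real A) < A" "cmod (1 / of_real B) < B" using A1 B1 by (auto simp: norm_divide divide_less_eq) (smt (verit) mult_less_cancel_left1)+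
  then have "cnj (LL A B 1) = LL A B 1"
    unfolding LL_def using HP_cnj[of "1 / of_real A"] annulus.HP_cnj[OF sym, of "1 / of_real B"] by simp
  then show ?thesis by (metis Reals_cnj_iff of_real_Re)
qed

text \<open>The value at the pole is where the capacity enters both halves of the theorem.\<close>

lemma exp_LL_one: "exp (of_real s * (LL A B 1 + of_real (rho0 B A * ln B))) = of_real (exp (- s * robin A B))"
  unfolding robin_def exp_of_real[symmetric] by (subst LL_one_real) (simp add: algebra_simps)

lemma green_continuous: "continuous_on {z. 1 / A\<^sup>2 < cmod z \<and> cmod z < B\<^sup>2 \<and> z \<noteq> 1} (green A B)"
proof -
  have "continuous_on {z. 1 / A\<^sup>2 < cmod z \<and> cmod z < B\<^sup>2 \<and> z \<noteq> 1} (LL A B)"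
    by (rule continuous_on_subset[OF holomorphic_on_imp_continuous_on[OF LL_holomorphic]]) auto
  moreover have "z \<noteq> 0" if "1 / A\<^sup>2 < cmod z" for z using that by auto
  ultimately show ?thesis unfolding green_def[abs_def] by (intro continuous_intros) auto
qed

end

section \<open>The lower bound for integer-valued polynomials\<close>

lemma infsum_cauchy_schwarz:
  fixes a b :: "'a \<Rightarrow> real"
  assumes a: "(\<lambda>x. (a x)\<^sup>2) summable_on S" and b: "(\<lambda>x. (b x)\<^sup>2) summable_on S"
  shows "(\<lambda>x. \<bar>a x * b x\<bar>) summable_on S"
    and "(\<Sum>\<^sub>\<infinity>x\<in>S. \<bar>a x * b x\<bar>) \<le> sqrt (\<Sum>\<^sub>\<infinity>x\<in>S. (a x)\<^sup>2) * sqrt (\<Sum>\<^sub>\<infinity>x\<in>S. (b x)\<^sup>2)"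
proof -
  have fin: "(\<Sum>x\<in>F. \<bar>a x * b x\<bar>) \<le> sqrt (\<Sum>\<^sub>\<infinity>x\<in>S. (a x)\<^sup>2) * sqrt (\<Sum>\<^sub>\<infinity>x\<in>S. (b x)\<^sup>2)"
    if "finite F" "F \<subseteq> S" for F
  proof -
    have "(\<Sum>x\<in>F. \<bar>a x\<bar> * \<bar>b x\<bar>)\<^sup>2 \<le> (\<Sum>x\<in>F. \<bar>a x\<bar>\<^sup>2) * (\<Sum>x\<in>F. \<bar>b x\<bar>\<^sup>2)"
      by (rule Cauchy_Schwarz_ineq_sum)
    then have "(\<Sum>x\<in>F. \<bar>a x\<bar> * \<bar>b x\<bar>) \<le> sqrt ((\<Sum>x\<in>F. (a x)\<^sup>2) * (\<Sum>x\<in>F. (b x)\<^sup>2))"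
      by (intro real_le_rsqrt) simp
    also have "\<dots> \<le> sqrt (\<Sum>\<^sub>\<infinity>x\<in>S. (a x)\<^sup>2) * sqrt (\<Sum>\<^sub>\<infinity>x\<in>S. (b x)\<^sup>2)"
      unfolding real_sqrt_mult
      by (intro mult_mono real_sqrt_le_mono finite_sum_le_infsum a b that) (auto intro: sum_nonneg infsum_nonneg)
    finally show ?thesis by (simp add: abs_mult)
  qed
  then show s: "(\<lambda>x. \<bar>a x * b x\<bar>) summable_on S"
    by (intro nonneg_bdd_above_summable_on) (auto intro!: bdd_aboveI2)
  show "(\<Sum>\<^sub>\<infinity>x\<in>S. \<bar>a x * b x\<bar>) \<le> sqrt (\<Sum>\<^sub>\<infinity>x\<in>S. (a x)\<^sup>2) * sqrt (\<Sum>\<^sub>\<infinity>x\<in>S. (b x)\<^sup>2)"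
    by (rule infsum_le_finite_sums[OF s fin])
qed

lemma parseval_nat:
  assumes "lsummable r c" "r > 0" "\<And>z. cmod z = r \<Longrightarrow> cmod (leval c z) \<le> M"
  shows "(\<lambda>n::nat. (norm (c (int n)))\<^sup>2 * (r ^ n)\<^sup>2) summable_on UNIV"
    and "(\<Sum>\<^sub>\<infinity>n::nat. (norm (c (int n)))\<^sup>2 * (r ^ n)\<^sup>2) \<le> M\<^sup>2"
proof -
  let ?h = "\<lambda>j. (norm (c j))\<^sup>2 * (r powi j)\<^sup>2"
  note p = parseval_bound[OF assms]
  have i: "inj_on int UNIV" by simp
  have e: "(\<lambda>n::nat. (norm (c (int n)))\<^sup>2 * (r ^ n)\<^sup>2) = ?h \<circ> int" by (auto simp: o_def)
  show "(\<lambda>n::nat. (norm (c (int n)))\<^sup>2 * (r ^ n)\<^sup>2) summable_on UNIV"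
    unfolding e summable_on_reindex[OF i, symmetric] by (rule summable_on_subset_banach[OF p(1) subset_UNIV])
  have "(\<Sum>\<^sub>\<infinity>n::nat. (norm (c (int n)))\<^sup>2 * (r ^ n)\<^sup>2) = infsum ?h (range int)"
    unfolding e by (rule infsum_reindex[OF i, symmetric])
  also have "\<dots> \<le> infsum ?h UNIV"
    by (rule infsum_mono2[OF summable_on_subset_banach[OF p(1)] p(1)]) auto
  also note p(2)
  finally show "(\<Sum>\<^sub>\<infinity>n::nat. (norm (c (int n)))\<^sup>2 * (r ^ n)\<^sup>2) \<le> M\<^sup>2" .
qed

text \<open>Cauchy-Schwarz with Parseval on the circle of radius \<open>X\<close>. The constant
  \<open>K\<close> ensures that the weighted squares of \<open>h\<close> are summable; otherwise
  their \<open>infsum\<close> would be 0 and the estimate could fail.\<close>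

lemma pairing_bound:
  fixes h :: "nat \<Rightarrow> complex"
  assumes X: "X > 1" and c: "lsummable X c" "\<And>z. cmod z = X \<Longrightarrow> cmod (leval c z) \<le> M" and M: "M \<ge> 0"
    and K: "\<And>n. norm (h n) * (1 / sqrt X) ^ n \<le> K"
  shows "(\<Sum>\<^sub>\<infinity>n\<in>S. norm (h n * c (int n))) \<le> sqrt (\<Sum>\<^sub>\<infinity>n\<in>S. (norm (h n))\<^sup>2 * X powi (- 2 * int n)) * M"
proof -
  define a where "a n = norm (h n) * X powi (- int n)" for n
  define b where "b n = norm (c (int n)) * X ^ n" for n
  have b2: "(\<lambda>n. (b n)\<^sup>2) = (\<lambda>n. (norm (c (int n)))\<^sup>2 * (X ^ n)\<^sup>2)" by (auto simp: b_def power_mult_distrib)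
  have bU: "(\<lambda>n. (b n)\<^sup>2) summable_on UNIV" "(\<Sum>\<^sub>\<infinity>n. (b n)\<^sup>2) \<le> M\<^sup>2"
    unfolding b2 using parseval_nat[OF c(1) _ c(2)] X by auto
  have bs: "(\<lambda>n. (b n)\<^sup>2) summable_on S" by (rule summable_on_subset_banach[OF bU(1)]) simp
  have "(\<Sum>\<^sub>\<infinity>n\<in>S. (b n)\<^sup>2) \<le> M\<^sup>2"
    using infsum_mono2[OF bs bU(1)] bU(2) by force
  then have b1: "sqrt (\<Sum>\<^sub>\<infinity>n\<in>S. (b n)\<^sup>2) \<le> M" using M by (simp add: real_le_lsqrt infsum_nonneg)
  have as: "(\<lambda>n. (a n)\<^sup>2) summable_on S"
  proof (rule summable_on_comparison_test)
    show "(\<lambda>n. K\<^sup>2 * (1 / X) ^ n) summable_on S"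
      using X by (intro summable_on_cmult_right summable_on_geometric) auto
    fix n :: nat
    have s: "sqrt X ^ n * sqrt X ^ n = X ^ n" using X by (simp flip: power_mult_distrib)
    have "(norm (h n) * (1 / sqrt X) ^ n * (1 / sqrt X) ^ n)\<^sup>2 \<le> (K * (1 / sqrt X) ^ n)\<^sup>2"
      using X by (intro power_mono mult_right_mono K) auto
    moreover have "norm (h n) * (1 / sqrt X) ^ n * (1 / sqrt X) ^ n = a n"
      using s by (simp add: a_def power_int_minus mult.assoc power_divide inverse_eq_divide)
    moreover have "(K * (1 / sqrt X) ^ n)\<^sup>2 = K\<^sup>2 * (1 / X) ^ n"
      using s by (simp add: power_mult_distrib power_divide power2_eq_square)
    ultimately show "(a n)\<^sup>2 \<le> K\<^sup>2 * (1 / X) ^ n" by simp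
  qed auto
  have "norm (h n * c (int n)) = \<bar>a n * b n\<bar>" for n
    using X by (simp add: a_def b_def norm_mult power_int_minus abs_mult)
  then have "(\<Sum>\<^sub>\<infinity>n\<in>S. norm (h n * c (int n))) \<le> sqrt (\<Sum>\<^sub>\<infinity>n\<in>S. (a n)\<^sup>2) * sqrt (\<Sum>\<^sub>\<infinity>n\<in>S. (b n)\<^sup>2)"
    using infsum_cauchy_schwarz(2)[OF as bs] by simp
  also have "\<dots> \<le> sqrt (\<Sum>\<^sub>\<infinity>n\<in>S. (a n)\<^sup>2) * M"
    using b1 by (intro mult_left_mono) (auto intro: infsum_nonneg)
  also have "(\<lambda>n. (a n)\<^sup>2) = (\<lambda>n. (norm (h n))\<^sup>2 * X powi (- 2 * int n))"
    by (auto simp: a_def power_mult_distrib power_int_power' mult.commute)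
  finally show ?thesis .
qed

text \<open>Horner induction: for \<open>P = a + x * R(x)\<close> the difference is
  \<open>x * (R(x) - R(x-1)) + R(x-1)\<close>, so each degree adds one more copy of the leading
  coefficient.\<close>

lemma backward_difference_poly:
  fixes P :: "complex poly"
  assumes "degree P \<le> Suc n"
  shows "degree (P - pcompose P [:-1, 1:]) \<le> n \<and> coeff (P - pcompose P [:-1, 1:]) n = of_nat (Suc n) * coeff P (Suc n)"
  using assms
proof (induction n arbitrary: P)
  case 0
  obtain a R where P: "P = pCons a R" by (cases P)
  with 0 have "degree R = 0" by (cases "R = 0") auto
  then obtain b where "R = [:b:]" by (rule degree_eq_zeroE)
  with P have "P = [:a, b:]" by simp
  then show ?case by (simp add: pcompose_pCons)
next
  case (Suc m)
  obtain a R where P: "P = pCons a R" by (cases P)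
  have dR: "degree R \<le> Suc m" using Suc.prems unfolding P by (cases "R = 0") auto
  let ?D = "R - pcompose R [:-1, 1:]"
  note IH = Suc.IH[OF dR]
  have eq: "P - pcompose P [:-1, 1:] = pCons 0 ?D + pcompose R [:-1, 1:]"
    unfolding P by (simp add: pcompose_pCons)
  have dRt: "degree (pcompose R [:-1, 1:]) \<le> Suc m" using dR degree_pcompose[of R "[:-1, 1:]"] by simp
  have cR: "coeff (pcompose R [:-1, 1:]) (Suc m) = coeff R (Suc m)"
  proof -
    have "coeff ?D (Suc m) = 0" using IH by (intro coeff_eq_0) auto
    then show ?thesis by simp
  qed
  have "degree (pCons 0 ?D) \<le> Suc m" using IH by (cases "?D = 0") auto
  then have "degree (P - pcompose P [:-1, 1:]) \<le> Suc m" unfolding eq using dRt by (rule degree_add_le)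
  moreover have "coeff (P - pcompose P [:-1, 1:]) (Suc m) = of_nat (Suc (Suc m)) * coeff P (Suc (Suc m))"
    unfolding eq using IH cR by (simp add: P algebra_simps)
  ultimately show ?case by blast
qed

lemma ldiff_pow_poly:
  assumes "degree P \<le> N"
  shows "(ldiff ^^ N) (\<lambda>n. poly P (of_int n)) = (\<lambda>_. fact N * coeff P N)"
  using assms
proof (induction N arbitrary: P)
  case 0
  then have "degree P = 0" by simp
  then obtain b where "P = [:b:]" by (rule degree_eq_zeroE)
  then show ?case by simp
next
  case (Suc N)
  let ?Q = "P - pcompose P [:-1, 1:]"
  have Q: "degree ?Q \<le> N" "coeff ?Q N = of_nat (Suc N) * coeff P (Suc N)"
    using backward_difference_poly[OF Suc.prems] by auto
  have "ldiff (\<lambda>n. poly P (of_int n)) = (\<lambda>n. poly ?Q (of_int n))"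
    by (auto simp: ldiff_def poly_pcompose fun_eq_iff)
  then have "(ldiff ^^ Suc N) (\<lambda>n. poly P (of_int n)) = (\<lambda>_. fact N * coeff ?Q N)"
    using Suc.IH[OF Q(1)] by (simp add: funpow_swap1 del: coeff_diff)
  then show ?case unfolding Q(2) by (simp add: algebra_simps)
qed

lemma ldiff_pow_Ints: "(\<And>i. j - int k \<le> i \<Longrightarrow> i \<le> j \<Longrightarrow> f i \<in> \<int>) \<Longrightarrow> (ldiff ^^ k) f j \<in> \<int>"
proof (induction k arbitrary: j)
  case (Suc k)
  have "(ldiff ^^ k) f j \<in> \<int>" "(ldiff ^^ k) f (j - 1) \<in> \<int>" by (auto intro!: Suc)
  then show ?case by (simp add: ldiff_def[of "(ldiff ^^ k) f"])
qed simp

lemma poly_exp_bound: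
  fixes P :: "'a :: real_normed_field poly" and x :: real
  assumes "0 < x" "x < 1"
  obtains K where "K \<ge> 0" "\<And>n::int. norm (poly P (of_int n)) * x powi \<bar>n\<bar> \<le> K"
proof -
  \<comment> \<open>The base is generalized so that the induction can pass to \<open>sqrt x\<close>:
    one half of the decay absorbs the new factor \<open>n\<close>, the other half the remaining
    polynomial.\<close>
  have "\<exists>K\<ge>0. \<forall>n::nat. \<forall>y. norm y = real n \<longrightarrow> norm (poly P y) * x ^ n \<le> K" if "0 < x" "x < 1" for x :: real
    using that
  proof (induction P arbitrary: x)
    case 0 then show ?case by auto
  next
    case (pCons a P)
    have sx: "0 < sqrt x" "sqrt x < 1" using pCons.prems by auto
    obtain K where K: "K \<ge> 0" "\<And>n y. norm y = real n \<Longrightarrow> norm (poly P y) * sqrt x ^ n \<le> K"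
      using pCons.IH[OF sx] by blast
    have "(\<lambda>n. of_nat n * sqrt x ^ n) \<longlonglongrightarrow> 0" using sx by (intro powser_times_n_limit_0) auto
    then have "Bseq (\<lambda>n. real n * sqrt x ^ n)" by (intro convergent_imp_Bseq convergentI)
    then obtain L where L: "L > 0" "\<And>n. norm (real n * sqrt x ^ n) \<le> L" by (auto elim: BseqE)
    have "norm (poly (pCons a P) y) * x ^ n \<le> norm a + L * K" if y: "norm y = real n" for n y
    proof -
      have xx: "x ^ n = sqrt x ^ n * sqrt x ^ n" using pCons.prems by (simp add: power_mult_distrib[symmetric])
      have "norm (poly (pCons a P) y) * x ^ n \<le> (norm a + norm y * norm (poly P y)) * x ^ n"
        using pCons.prems by (intro mult_right_mono) (auto intro: order_trans[OF norm_triangle_ineq] simp: norm_mult)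
      also have "\<dots> = norm a * x ^ n + (real n * sqrt x ^ n) * (norm (poly P y) * sqrt x ^ n)"
        unfolding y xx by (simp add: algebra_simps)
      also have "\<dots> \<le> norm a * 1 + L * K"
        using K(2)[OF y] L pCons.prems K(1)
        by (intro add_mono mult_mono power_le_one) (auto simp: abs_le_iff)
      finally show ?thesis by simp
    qed
    then show ?case using K L by (intro exI[of _ "norm a + L * K"]) auto
  qed
  then obtain K where K: "K \<ge> 0" "\<And>n y. norm y = real n \<Longrightarrow> norm (poly P y) * x ^ n \<le> K"
    using assms by blast
  show ?thesis
  proof (rule that[OF K(1)])
    fix n :: int
    have "x powi \<bar>n\<bar> = x ^ nat \<bar>n\<bar>" by (simp add: power_int_def)
    then show "norm (poly P (of_int n)) * x powi \<bar>n\<bar> \<le> K"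
      using K(2)[of "of_int n" "nat \<bar>n\<bar>"] by simp
  qed
qed

lemma exp_minus_le_inverse: "exp (- x) \<le> 1 / x" if "x > 0" for x :: real
  proof -
  have "x \<le> exp x" using exp_ge_add_one_self[of x] by linarith
  then show ?thesis using le_imp_inverse_le[of x "exp x"] that by (simp add: exp_minus inverse_eq_divide)
qed

context annulus
begin

lemma circle_range: "1 / A\<^sup>2 < 1 / A" "1 / A < 1" "1 < B" "B < B\<^sup>2" "1 / A < B\<^sup>2" "1 / A\<^sup>2 < B"
proof -
  show "1 / A\<^sup>2 < 1 / A" "1 / A < 1" "1 < B" "B < B\<^sup>2"
    using A1 B1 by (auto simp: power2_eq_square field_simps)
  then show "1 / A < B\<^sup>2" "1 / A\<^sup>2 < B" by linarith+
qed

text \<open>\<open>g\<close> comes from a function with a zero of order \<open>N\<close> at 1.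
  Moving the \<open>N\<close> differences from \<open>\<psi>\<close> to \<open>f\<close> leaves a
  constant nonzero integer times \<open>leval \<psi> 1 = exp (N * robin A B)\<close>. The bound is
  independent of \<open>N\<close> because only the fractional part of \<open>N * rho0 A B\<close>
  survives on the circles.\<close>

lemma integer_valued_lower_bound:
  assumes c: "robin A B \<ge> 0" and P: "integer_valued P" "P \<noteq> 0"
  shows "1 \<le> sqrt (\<Sum>\<^sub>\<infinity>n::nat. (cmod (poly P (of_nat n)))\<^sup>2 * A powi (- 2 * int n))
       + B * sqrt (\<Sum>\<^sub>\<infinity>n\<in>{1::nat..}. (cmod (poly P (- of_nat n)))\<^sup>2 * B powi (- 2 * int n))"
proof -
  define N where "N = degree P"
  \<comment> \<open>With this rounding \<open>x\<close> lies in \<open>[0, 1]\<close>: the twist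
    costs nothing on the inner circle and at most a factor \<open>B\<close> on the outer
    one.\<close>
  define m where "m = - \<lfloor>real N * rho0 A B\<rfloor>"
  define x where "x = of_int m + real N * rho0 A B"
  have x: "0 \<le> x" "x \<le> 1" unfolding x_def m_def by linarith+
  obtain \<psi> where \<psi>: "\<And>r. 1 / A\<^sup>2 < r \<Longrightarrow> r < B\<^sup>2 \<Longrightarrow> lsummable r \<psi>"
    "\<And>z. 1 / A\<^sup>2 < cmod z \<Longrightarrow> cmod z < B\<^sup>2 \<Longrightarrow>
      leval \<psi> z = z powi m * exp (of_real (- real N) * (LL A B z + of_real (rho0 B A * ln B)))"
    using laurent_exists[where m=m and s="- real N"] by blast
  define g where "g = (ldiff ^^ N) \<psi>"
  have lg: "cmod (leval g z) = cmod z powr x * exp (- real N * green A B z)" "lsummable (cmod z) g"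
    if z: "1 / A\<^sup>2 < cmod z" "cmod z < B\<^sup>2" "z \<noteq> 1" for z
  proof -
    have z0: "cmod z > 0" using z(1) A1 by (smt (verit) zero_le_divide_1_iff zero_le_power2)
    have n1: "cmod (1 - z) > 0" using z(3) by simp
    show "lsummable (cmod z) g" unfolding g_def by (rule lsummable_ldiff_pow[OF \<psi>(1)[OF z(1,2)] z0])
    have "leval g z = (1 - z) ^ N * leval \<psi> z"
      unfolding g_def by (rule leval_ldiff_pow[OF \<psi>(1)[OF z(1,2)] z0 refl])
    then have "cmod (leval g z) = cmod (1 - z) ^ N * (cmod z powr (of_int m - (- real N) * rho0 A B) * exp (- real N * green A B z) * cmod (1 - z) powr (- real N))"
      using z0 by (simp only: norm_mult[of "(1 - z) ^ N"] norm_power \<psi>(2)[OF z(1,2)])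
        (subst norm_laurent_factor, use z in \<open>auto\<close>)
    also have "\<dots> = cmod z powr x * exp (- real N * green A B z)"
      using n1 by (simp add: x_def powr_minus powr_realpow)
    finally show "cmod (leval g z) = cmod z powr x * exp (- real N * green A B z)" .
  qed
  have gA: "lsummable (1 / A) g" "\<And>z. cmod z = 1 / A \<Longrightarrow> cmod (leval g z) \<le> 1"
  proof -
    have "lsummable (cmod (of_real (1 / A))) g" using circle_range A1 B1 by (intro lg(2)) (auto simp: norm_divide)
    then show "lsummable (1 / A) g" using A1 by (simp add: norm_divide)
    fix z assume z: "cmod z = 1 / A"
    moreover have "z \<noteq> 1" using z circle_range(2) by force
    ultimately have "cmod (leval g z) = (1 / A) powr x"
      using lg(1)[of z] green_inner_circle[OF z] circle_range by auto
    also have "\<dots> \<le> 1" using A1 x by (intro powr_le1) auto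
    finally show "cmod (leval g z) \<le> 1" .
  qed
  have gB: "lsummable B g" "\<And>z. cmod z = B \<Longrightarrow> cmod (leval g z) \<le> B"
  proof -
    have "lsummable (cmod (of_real B)) g" using circle_range A1 B1 by (intro lg(2)) auto
    then show "lsummable B g" using B1 by simp
    fix z assume z: "cmod z = B"
    moreover have "z \<noteq> 1" using z circle_range(3) by force
    ultimately have "cmod (leval g z) = B powr x"
      using lg(1)[of z] green_outer_circle[OF z] circle_range by auto
    also have "\<dots> \<le> B powr 1" using B1 x by (intro powr_mono) auto
    finally show "cmod (leval g z) \<le> B" using B1 by simp
  qed
  define f where "f n = poly P (of_int n)" for n :: int
  define \<kappa> where "\<kappa> = fact N * lead_coeff P"
  have f\<kappa>: "(ldiff ^^ N) f = (\<lambda>_. \<kappa>)"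
    unfolding f_def \<kappa>_def N_def by (rule ldiff_pow_poly) simp
  have \<kappa>1: "1 \<le> cmod \<kappa>"
  proof -
    \<comment> \<open>Evaluated at \<open>N\<close>, the difference involves only the arguments
      \<open>0..N\<close>, where \<open>integer_valued\<close> applies directly.\<close>
    have "(ldiff ^^ N) f (int N) \<in> \<int>"
    proof (rule ldiff_pow_Ints)
      fix i assume "int N - int N \<le> i"
      then have "f i = poly P (of_nat (nat i))" by (simp add: f_def)
      then show "f i \<in> \<int>" using P(1) by (simp add: integer_valued_def)
    qed
    then obtain k where k: "\<kappa> = of_int k" unfolding f\<kappa> by (auto elim: Ints_cases)
    have "\<kappa> \<noteq> 0" using P(2) by (simp add: \<kappa>_def)
    then show ?thesis unfolding k by simp
  qed
  obtain K1 where K1: "K1 \<ge> 0" "\<And>n::int. cmod (poly P (of_int n)) * (1 / A) powi \<bar>n\<bar> \<le> K1"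
    by (rule poly_exp_bound[of "1 / A"]) (use A1 in auto)
  obtain K2 where K2: "K2 \<ge> 0" "\<And>n::int. cmod (poly P (of_int n)) * (1 / B) powi \<bar>n\<bar> \<le> K2"
    by (rule poly_exp_bound[of "1 / B"]) (use B1 in auto)
  \<comment> \<open>\<open>f\<close> is dominated by a multiple of \<open>A powi i\<close> for
    \<open>i \<ge> 0\<close> and of \<open>B powi (- i)\<close> for \<open>i < 0\<close>. The sum of
    both majorants works everywhere, each being paid for by one circle.\<close>
  have fs: "(\<lambda>i. f i * h (j - i)) abs_summable_on UNIV" if h: "lsummable (1 / A) h" "lsummable B h" for h j
  proof -
    have "bij_betw (\<lambda>i. j - i) UNIV UNIV" by (rule bij_betwI[where g="\<lambda>i. j - i"]) auto
    then have s: "(\<lambda>i. norm (h (j - i)) * r powi (j - i)) summable_on UNIV" if "lsummable r h" for r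
      using that unfolding lsummable_def by (subst summable_on_reindex_bij_betw[where f="\<lambda>i. norm (h i) * r powi i"])
    have "(\<lambda>i. K1 * A powi j * (norm (h (j - i)) * (1 / A) powi (j - i)) + K2 * B powi (- j) * (norm (h (j - i)) * B powi (j - i))) summable_on UNIV"
      by (rule summable_on_add[OF summable_on_cmult_right[OF s[OF h(1)]] summable_on_cmult_right[OF s[OF h(2)]]])
    then show ?thesis
    proof (rule summable_on_comparison_test)
      fix i :: int
      have a: "norm (f i) \<le> K1 * A powi j * (1 / A) powi (j - i) + K2 * B powi (- j) * B powi (j - i)"
      proof (cases "i \<ge> 0")
        case True
        have "A powi j * (1 / A) powi (j - i) = A powi i"
          using A1 by (simp add: power_int_diff power_int_divide_distrib field_simps)
        moreover have "norm (f i) \<le> K1 * A powi i"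
          using K1(2)[of i] True A1 by (simp add: f_def power_int_divide_distrib field_simps)
        moreover have "0 \<le> K2 * B powi (- j) * B powi (j - i)" using K2 B1 by simp
        ultimately show ?thesis by (simp add: mult.assoc)
      next
        case False
        have "B powi (- j) * B powi (j - i) = B powi (- i)"
          using B1 by (simp add: power_int_add[symmetric])
        moreover have "norm (f i) \<le> K2 * B powi (- i)"
          using K2(2)[of i] False B1 by (simp add: f_def power_int_divide_distrib power_int_minus field_simps)
        moreover have "0 \<le> K1 * A powi j * (1 / A) powi (j - i)" using K1 A1 by simp
        ultimately show ?thesis by (simp add: mult.assoc)
      qed
      then show "norm (f i * h (j - i)) \<le> K1 * A powi j * (norm (h (j - i)) * (1 / A) powi (j - i)) + K2 * B powi (- j) * (norm (h (j - i)) * B powi (j - i))"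
        using mult_right_mono[OF a norm_ge_zero[of "h (j - i)"]] by (simp add: norm_mult algebra_simps)
    qed auto
  qed
  have \<psi>AB: "lsummable (1 / A) \<psi>" "lsummable B \<psi>" "lsummable 1 \<psi>"
    using circle_range A1 B1 by (auto intro!: \<psi>(1) simp: power2_eq_square less_1_mult divide_less_eq)
  have main: "lconv f g 0 = \<kappa> * exp (real N * robin A B)"
  proof -
    have "lconv f g 0 = lconv ((ldiff ^^ N) f) \<psi> 0"
      unfolding g_def by (subst lconv_ldiff_swap[OF fs[OF \<psi>AB(1,2)]]) simp
    also have "\<dots> = \<kappa> * (\<Sum>\<^sub>\<infinity>i. \<psi> (0 - i))" unfolding f\<kappa> lconv_def by (rule infsum_cmult_right')
    also have "(\<Sum>\<^sub>\<infinity>i. \<psi> (0 - i)) = leval \<psi> 1"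
      unfolding leval_def by (rule infsum_reindex_bij_witness[where i=uminus and j=uminus]) auto
    also have "\<dots> = exp (of_real (- real N) * (LL A B 1 + of_real (rho0 B A * ln B)))"
      using \<psi>(2)[of 1] A1 B1 by (simp add: divide_less_eq)
    also have "\<dots> = of_real (exp (- (- real N) * robin A B))" by (rule exp_LL_one)
    finally show ?thesis by (simp add: exp_of_real)
  qed
  have "1 \<le> cmod (lconv f g 0)"
  proof -
    have "1 * 1 \<le> cmod \<kappa> * exp (real N * robin A B)" using \<kappa>1 c by (intro mult_mono) auto
    then show ?thesis unfolding main by (simp add: norm_mult)
  qed
  also have "cmod (lconv f g 0) \<le> (\<Sum>\<^sub>\<infinity>i. norm (f i * g (0 - i)))"
    unfolding lconv_def by (rule norm_infsum_bound[OF fs[OF gA(1) gB(1)]])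
  also have "\<dots> = (\<Sum>\<^sub>\<infinity>n::nat. norm (f (int n) * g (0 - int n))) + (\<Sum>\<^sub>\<infinity>n\<in>{1::nat..}. norm (f (- int n) * g (0 - - int n)))"
    by (rule infsum_int_split[OF fs[OF gA(1) gB(1)]])
  also have "(\<Sum>\<^sub>\<infinity>n::nat. norm (f (int n) * g (0 - int n))) \<le>
      sqrt (\<Sum>\<^sub>\<infinity>n::nat. (cmod (poly P (of_nat n)))\<^sup>2 * A powi (- 2 * int n)) * 1"
  proof -
    obtain K where K: "K \<ge> 0" "\<And>n::int. cmod (poly P (of_int n)) * (1 / sqrt A) powi \<bar>n\<bar> \<le> K"
      by (rule poly_exp_bound[of "1 / sqrt A"]) (use A1 in auto)
    \<comment> \<open>The value of \<open>f\<close> at \<open>n\<close> meets \<open>g\<close> at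
      \<open>- n\<close>, so the inner circle is inverted into the circle of radius
      \<open>A\<close>.\<close>
    have "cmod (leval (\<lambda>j. g (- j)) z) \<le> 1" if "cmod z = A" for z
      unfolding leval_reflect by (rule gA(2)) (use that in \<open>simp add: norm_inverse inverse_eq_divide norm_divide\<close>)
    moreover have "lsummable A (\<lambda>j. g (- j))" using gA(1) A1 by (intro lsummable_reflect) (auto simp: inverse_eq_divide)
    ultimately show ?thesis
      using pairing_bound[OF A1, of "\<lambda>j. g (- j)" 1 "\<lambda>n. poly P (of_nat n)" K UNIV] K(2)[of "int _"] by (simp add: f_def)
  qed
  also have "(\<Sum>\<^sub>\<infinity>n\<in>{1::nat..}. norm (f (- int n) * g (0 - - int n))) \<le>
      sqrt (\<Sum>\<^sub>\<infinity>n\<in>{1::nat..}. (cmod (poly P (- of_nat n)))\<^sup>2 * B powi (- 2 * int n)) * B"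
  proof -
    obtain K where K: "K \<ge> 0" "\<And>n::int. cmod (poly P (of_int n)) * (1 / sqrt B) powi \<bar>n\<bar> \<le> K"
      by (rule poly_exp_bound[of "1 / sqrt B"]) (use B1 in auto)
    show ?thesis
      using pairing_bound[OF B1 gB, of "\<lambda>n. poly P (- of_nat n)" K "{1..}"] K(2)[of "- int _"] B1 by (simp add: f_def)
  qed
  finally show ?thesis by (simp add: mult.commute)
qed

section \<open>Faber-type sequences\<close>

text \<open>\<open>f\<close> and \<open>g\<close> are the Laurent coefficients, inside and outside the unit circle, of a function with a pole
  of order \<open>k\<close> at 1 and modulus about \<open>exp (k * green A B z)\<close>. Their difference comes from the
  principal part at 1, hence is a polynomial sequence of degree \<open>k - 1\<close> (an analogue of Faber polynomials).
  Rounding the exponent of \<open>z\<close> to an integer costs only a bounded factor.\<close>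

definition faber_seq :: "nat \<Rightarrow> (int \<Rightarrow> complex) \<Rightarrow> (int \<Rightarrow> complex) \<Rightarrow> bool" where
  "faber_seq k f g \<longleftrightarrow>
     (ldiff ^^ k) (\<lambda>j. f j - g j) = (\<lambda>_. 0) \<and>
     (ldiff ^^ (k - 1)) (\<lambda>j. f j - g j) = (\<lambda>_. of_real (exp (- real k * robin A B))) \<and>
     (\<forall>r. 1 / A\<^sup>2 < r \<and> r < 1 \<longrightarrow> lsummable r f) \<and>
     (\<forall>r. 1 < r \<and> r < B\<^sup>2 \<longrightarrow> lsummable r g) \<and>
     (\<forall>z. 1 / A\<^sup>2 < cmod z \<and> cmod z < 1 \<longrightarrow> cmod (leval f z) \<le> A\<^sup>2 * exp (real k * green A B z)) \<and>
     (\<forall>z. 1 < cmod z \<and> cmod z < B\<^sup>2 \<longrightarrow> cmod (leval g z) \<le> exp (real k * green A B z))"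

text \<open>Both sequences expand the same function, \<open>\<psi>\<close> divided by
  \<open>(1 - z) ^ k\<close>, so \<open>k\<close> differences bring both back to
  \<open>\<psi>\<close> and annihilate \<open>f - g\<close>.\<close>

lemma faber_exists:
  assumes k: "k > 0"
  shows "\<exists>f g. faber_seq k f g"
proof -
  \<comment> \<open>Here \<open>x\<close> lies in \<open>[-1, 0]\<close>: outside the unit circle
    the twist costs nothing, inside at most \<open>1 / cmod z\<close>, hence at most
    \<open>A\<^sup>2\<close>.\<close>
  define m where "m = \<lfloor>real k * rho0 A B\<rfloor>"
  define x where "x = of_int m - real k * rho0 A B"
  have x: "-1 \<le> x" "x \<le> 0" unfolding x_def m_def by linarith+
  obtain \<psi> where \<psi>: "\<And>r. 1 / A\<^sup>2 < r \<Longrightarrow> r < B\<^sup>2 \<Longrightarrow> lsummable r \<psi>"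
    "\<And>z. 1 / A\<^sup>2 < cmod z \<Longrightarrow> cmod z < B\<^sup>2 \<Longrightarrow>
      leval \<psi> z = z powi m * exp (of_real (real k) * (LL A B z + of_real (rho0 B A * ln B)))"
    using laurent_exists[where m=m and s="real k"] by blast
  define f where "f = (lsum_left ^^ k) \<psi>"
  define g where "g = (lsum_right ^^ k) \<psi>"
  have B2: "1 < B\<^sup>2" and A2: "1 / A\<^sup>2 < 1" "0 < 1 / A\<^sup>2" using A1 B1 by (auto simp: divide_less_eq)
  have \<psi>1: "lsummable 1 \<psi>" using \<psi>(1)[of 1] A2 B2 by simp
  have L: "lsummable r f" "0 < r" "lsummable r \<psi>" if "1 / A\<^sup>2 < r" "r < 1" for r
  proof -
    show r: "0 < r" using that A2 by linarith
    show ps: "lsummable r \<psi>" using \<psi>(1) that B2 by simp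
    show "lsummable r f" unfolding f_def by (rule lsummable_lsum_left_pow[OF r that(2) ps])
  qed
  have R: "lsummable r g" "lsummable r \<psi>" if "1 < r" "r < B\<^sup>2" for r
  proof -
    show ps: "lsummable r \<psi>" by (rule \<psi>(1)) (use that A2 in linarith)+
    show "lsummable r g" unfolding g_def by (rule lsummable_lsum_right_pow[OF that(1) ps])
  qed
  have nrm: "cmod (leval \<psi> z / (1 - z) ^ k) = cmod z powr x * exp (real k * green A B z)"
    if z: "1 / A\<^sup>2 < cmod z" "cmod z < B\<^sup>2" "z \<noteq> 1" for z
  proof -
    have "z \<noteq> 0" using z A2 by auto
    moreover have "cmod (1 - z) > 0" using z by simp
    ultimately show ?thesis using z
      unfolding \<psi>(2)[OF z(1,2)] norm_divide norm_power
      by (subst norm_laurent_factor) (auto simp: x_def powr_realpow)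
  qed
  obtain r1 where r1: "1 / A\<^sup>2 < r1" "r1 < 1" using A2 dense by blast
  obtain r2 where r2: "1 < r2" "r2 < B\<^sup>2" using B2 dense by blast
  have df: "(ldiff ^^ k) f = \<psi>" unfolding f_def by (rule ldiff_lsum_left_pow[OF L(2)[OF r1] r1(2) L(3)[OF r1]])
  have dg: "(ldiff ^^ k) g = \<psi>" unfolding g_def by (rule ldiff_lsum_right_pow[OF r2(1) R(2)[OF r2]])
  obtain k' where k': "k = Suc k'" using k by (cases k) auto
  \<comment> \<open>After \<open>k - 1\<close> differences one division is left, and its two
    versions differ by \<open>leval \<psi> 1\<close>, a constant.\<close>
  have df': "(ldiff ^^ k') f = lsum_left \<psi>"
    unfolding f_def k' funpow_Suc_right o_apply
    by (rule ldiff_lsum_left_pow[OF L(2)[OF r1] r1(2) lsummable_lsum_left_pow[OF L(2)[OF r1] r1(2) L(3)[OF r1], of 1, simplified]])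
  have dg': "(ldiff ^^ k') g = lsum_right \<psi>"
    unfolding g_def k' funpow_Suc_right o_apply
    by (rule ldiff_lsum_right_pow[OF r2(1) lsummable_lsum_right_pow[OF r2(1) R(2)[OF r2], of 1, simplified]])
  have one: "leval \<psi> 1 = of_real (exp (- real k * robin A B))"
    using \<psi>(2)[of 1] A2 B2 exp_LL_one[of "real k"] by simp
  have "faber_seq k f g"
    unfolding faber_seq_def
  proof (intro conjI allI impI)
    show "(ldiff ^^ k) (\<lambda>j. f j - g j) = (\<lambda>_. 0)" unfolding ldiff_pow_diff df dg by simp
    show "(ldiff ^^ (k - 1)) (\<lambda>j. f j - g j) = (\<lambda>_. of_real (exp (- real k * robin A B)))"
      using k' unfolding one[symmetric] by (simp add: ldiff_pow_diff df' dg' lsum_left_minus_lsum_right[OF \<psi>1])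
    show "lsummable r f" if "1 / A\<^sup>2 < r \<and> r < 1" for r using L(1) that by simp
    show "lsummable r g" if "1 < r \<and> r < B\<^sup>2" for r using R(1) that by simp
    show "cmod (leval f z) \<le> A\<^sup>2 * exp (real k * green A B z)" if z: "1 / A\<^sup>2 < cmod z \<and> cmod z < 1" for z
    proof -
      have z1: "1 / A\<^sup>2 < cmod z" "cmod z < 1" "cmod z < B\<^sup>2" "z \<noteq> 1" using z B2 by auto
      have "leval f z = leval \<psi> z / (1 - z) ^ k"
        unfolding f_def by (rule leval_lsum_left_pow[OF L(2)[OF z1(1,2)] z1(2) L(3)[OF z1(1,2)] refl])
      then have "cmod (leval f z) = cmod z powr x * exp (real k * green A B z)" using nrm[OF z1(1,3,4)] by simp
      also have "cmod z powr x \<le> A\<^sup>2"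
      proof -
        have cz: "0 < cmod z" using L(2)[OF z1(1,2)] .
        have "cmod z powr x \<le> cmod z powr (-1)" using z1 x cz by (intro powr_mono') auto
        also have "\<dots> = 1 / cmod z" using cz by (simp add: powr_minus inverse_eq_divide)
        also have "\<dots> \<le> A\<^sup>2" using z1 cz A1 by (simp add: field_simps)
        finally show ?thesis .
      qed
      finally show ?thesis by simp
    qed
    show "cmod (leval g z) \<le> exp (real k * green A B z)" if z: "1 < cmod z \<and> cmod z < B\<^sup>2" for z
    proof -
      have z1: "1 < cmod z" "cmod z < B\<^sup>2" "1 / A\<^sup>2 < cmod z" using z A2 by linarith+
      then have z1': "z \<noteq> 1" by auto
      have "leval g z = leval \<psi> z / (1 - z) ^ k"
        unfolding g_def by (rule leval_lsum_right_pow[OF z1(1) R(2)[OF z1(1,2)] refl])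
      then have "cmod (leval g z) = cmod z powr x * exp (real k * green A B z)" using nrm[OF z1(3,2) z1'] by simp
      also have "cmod z powr x \<le> cmod z powr 0" using z1 x by (intro powr_mono) auto
      finally show ?thesis using z1(1) by (auto split: if_splits)
    qed
  qed
  then show ?thesis by blast
qed

section \<open>Green's function near and beyond the boundary circles\<close>

lemma sqrt_range: "1 / A < 1 / sqrt A" "1 / sqrt A < 1" "1 / (A * sqrt A) < 1 / A" "1 / A\<^sup>2 < 1 / (A * sqrt A)" "1 / A\<^sup>2 < 1 / A"
proof -
  define s where "s = sqrt A"
  have s: "1 < s" "A = s * s" using A1 by (auto simp: s_def)
  have c: "1 < s" "s < s * s" "s * s < s * s * s" "s * s * s < (s * s)\<^sup>2"
    using s(1) by (auto simp: power2_eq_square mult.assoc)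
  have c': "s * s < (s * s)\<^sup>2" using c by linarith
  have lt: "1 / y < 1 / x" if "x < y" "0 < x" for x y :: real
    using that by (simp add: frac_less2)
  show "1 / A < 1 / sqrt A" "1 / sqrt A < 1" "1 / (A * sqrt A) < 1 / A" "1 / A\<^sup>2 < 1 / (A * sqrt A)" "1 / A\<^sup>2 < 1 / A"
    unfolding s_def[symmetric] s(2) using c c'
    by (intro lt, simp_all add: divide_less_eq)
qed

text \<open>The circle of radius \<open>1 / sqrt A\<close> lies in the annulus and is the mirror
  image of the one considered here. Positivity on it is uniform by compactness, and reflection
  changes the sign.\<close>

lemma green_negative_inner:
  "\<exists>\<delta>>0. \<forall>z. cmod z = 1 / (A * sqrt A) \<longrightarrow> green A B z \<le> - \<delta>"
proof -
  let ?C = "sphere (0::complex) (1 / sqrt A)"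
  have B2: "1 < B\<^sup>2" using B1 by simp
  have "?C \<subseteq> {z. 1 / A\<^sup>2 < cmod z \<and> cmod z < B\<^sup>2 \<and> z \<noteq> 1}"
    using sqrt_range B2 by auto
  then have "continuous_on ?C (green A B)" by (rule continuous_on_subset[OF green_continuous])
  moreover have "?C \<noteq> {}" using A1 by simp
  ultimately obtain z0 where z0: "z0 \<in> ?C" "\<And>z. z \<in> ?C \<Longrightarrow> green A B z0 \<le> green A B z"
    using continuous_attains_inf[of ?C "green A B"] by auto
  have "green A B z0 > 0"
    using z0(1) sqrt_range B1 by (intro green_pos) auto
  moreover have "green A B z \<le> - green A B z0" if z: "cmod z = 1 / (A * sqrt A)" for z
  proof -
    have "green A B (1 / (of_real (A\<^sup>2) * cnj z)) = - green A B z"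
      using z sqrt_range by (intro green_reflect) auto
    moreover have "1 / (of_real (A\<^sup>2) * cnj z) \<in> ?C"
      using z A1 by (simp add: norm_divide norm_mult norm_power power2_eq_square)
         (metis (no_types) divide_divide_eq_right mult.commute nonzero_mult_div_cancel_right order_less_irrefl real_div_sqrt real_sqrt_divide div_by_1 inverse_eq_divide less_imp_le less_trans zero_less_one)
    ultimately show ?thesis using z0(2) by fastforce
  qed
  ultimately show ?thesis by blast
qed

lemma green_small_inner:
  assumes \<eta>: "\<eta> > 0"
  shows "\<exists>q0>1. \<forall>q z. 1 < q \<and> q < q0 \<and> cmod z = q / A \<longrightarrow> green A B z \<le> \<eta>"
proof -
  let ?K = "cball (0::complex) (1 / sqrt A) - ball 0 (1 / A)"
  have B2: "1 < B\<^sup>2" using B1 by simp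
  have "?K \<subseteq> {z. 1 / A\<^sup>2 < cmod z \<and> cmod z < B\<^sup>2 \<and> z \<noteq> 1}"
    using sqrt_range B2 by auto
  then have "continuous_on ?K (green A B)" by (rule continuous_on_subset[OF green_continuous])
  moreover have "compact ?K" by (intro compact_diff) auto
  ultimately have "uniformly_continuous_on ?K (green A B)" by (rule compact_uniformly_continuous)
  then obtain d where d: "d > 0" "\<And>x y. x \<in> ?K \<Longrightarrow> y \<in> ?K \<Longrightarrow> dist y x < d \<Longrightarrow> dist (green A B y) (green A B x) < \<eta>"
    using \<eta> unfolding uniformly_continuous_on_def by metis
  define q0 where "q0 = min (sqrt A) (1 + d)"
  have "q0 > 1" using A1 d by (simp add: q0_def)
  moreover have "green A B z \<le> \<eta>" if q: "1 < q" "q < q0" "cmod z = q / A" for q z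
  proof -
    define y where "y = z / of_real q"
    have y: "cmod y = 1 / A" using q by (simp add: y_def norm_divide)
    have "q / A \<le> 1 / sqrt A"
      using q(2) A1 by (simp add: q0_def field_simps) (metis less_imp_le mult_left_mono real_sqrt_ge_zero less_trans zero_less_one real_sqrt_mult_self abs_of_pos mult.commute)
    moreover have "1 / A \<le> q / A" using q A1 by (intro divide_right_mono) auto
    ultimately have "z \<in> ?K" using q A1 by auto
    moreover have "y \<in> ?K" using y sqrt_range by auto
    moreover have "dist z y < d"
    proof -
      have "z - y = of_real (q - 1) * y" using q by (simp add: y_def field_simps)
      then have "dist z y = (q - 1) * (1 / A)" using q y by (simp add: dist_norm norm_mult del: of_real_diff)
      also have "\<dots> \<le> (q - 1) * 1" using q A1 by (intro mult_left_mono) auto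
      also have "\<dots> < d" using q by (simp add: q0_def)
      finally show ?thesis .
    qed
    ultimately have "dist (green A B z) (green A B y) < \<eta>" using d(2)[of y z] by blast
    then show ?thesis using green_inner_circle[OF y] by (simp add: dist_real_def)
  qed
  ultimately show ?thesis by blast
qed

lemma green_negative_outer: "\<exists>\<delta>>0. \<forall>z. cmod z = B * sqrt B \<longrightarrow> green A B z \<le> - \<delta>"
proof -
  obtain \<delta> where \<delta>: "\<delta> > 0" "\<And>z. cmod z = 1 / (B * sqrt B) \<Longrightarrow> green B A z \<le> - \<delta>"
    using annulus.green_negative_inner[OF sym] by blast
  have "green A B z \<le> - \<delta>" if "cmod z = B * sqrt B" for z
  proof -
    have "z \<noteq> 0" using that B1 by auto
    then show ?thesis using \<delta>(2)[of "1 / z"] annulus.green_inverse[OF sym, of z] that by (simp add: norm_divide)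
  qed
  then show ?thesis using \<delta>(1) by blast
qed

text \<open>Moving both circles slightly into the annulus costs a factor
  \<open>exp (k * \<eta>)\<close> but makes coefficient estimates converge geometrically on the
  original circles. The capacity sees only exponential rates, so this loss can be afforded
  there.\<close>

lemma green_small:
  assumes \<eta>: "\<eta> > 0"
  shows "\<exists>q. 1 < q \<and> q < sqrt A \<and> q < sqrt B \<and> (\<forall>z. cmod z = q / A \<longrightarrow> green A B z \<le> \<eta>) \<and> (\<forall>z. cmod z = B / q \<longrightarrow> green A B z \<le> \<eta>)"
proof -
  obtain q1 where q1: "q1 > 1" "\<And>q z. 1 < q \<Longrightarrow> q < q1 \<Longrightarrow> cmod z = q / A \<Longrightarrow> green A B z \<le> \<eta>"
    using green_small_inner[OF \<eta>] by blast
  obtain q2 where q2: "q2 > 1" "\<And>q z. 1 < q \<Longrightarrow> q < q2 \<Longrightarrow> cmod z = q / B \<Longrightarrow> green B A z \<le> \<eta>"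
    using annulus.green_small_inner[OF sym \<eta>] by blast
  have "1 < min (min q1 q2) (min (sqrt A) (sqrt B))" using q1(1) q2(1) A1 B1 by simp
  then obtain q where q: "1 < q" "q < min (min q1 q2) (min (sqrt A) (sqrt B))" using dense by blast
  have "green A B z \<le> \<eta>" if "cmod z = B / q" for z
  proof -
    have "z \<noteq> 0" using that B1 q by auto
    then show ?thesis using q2(2)[of q "1 / z"] annulus.green_inverse[OF sym, of z] that q by (simp add: norm_divide)
  qed
  then show ?thesis using q q1(2) by (intro exI[of _ q]) auto
qed

end

section \<open>The two disks as Apollonius disks\<close>

text \<open>For \<open>z = u / (1 + u)\<close> the condition says \<open>cmod z \<le> 1 / A\<close>.
  The product form is also right at \<open>u = -1\<close>, where the quotient is junk.\<close>

lemma mem_disk1_iff: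
  assumes "A > 1"
  shows "u \<in> disk1 A \<longleftrightarrow> A * cmod u \<le> cmod (1 + u)"
proof -
  define d where "d = A\<^sup>2 - 1"
  have d: "d > 0" using assms by (simp add: d_def)
  have A0: "A > 0" using assms by simp
  have "u \<in> disk1 A \<longleftrightarrow> (cmod (of_real (1 / d) - u))\<^sup>2 \<le> (A / d)\<^sup>2"
    unfolding disk1_def d_def[symmetric] mem_cball dist_norm using abs_le_square_iff[of "cmod (of_real (1 / d) - u)" "A / d"] d A0 by simp
  also have "\<dots> \<longleftrightarrow> (1 - d * Re u)\<^sup>2 + (d * Im u)\<^sup>2 \<le> A\<^sup>2"
  proof -
    have "(cmod (of_real (1 / d) - u))\<^sup>2 = ((1 - d * Re u)\<^sup>2 + (d * Im u)\<^sup>2) / d\<^sup>2"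
      unfolding cmod_power2 using d by (simp add: power2_eq_square field_simps)
    then show ?thesis using d by (simp add: power_divide divide_le_cancel)
  qed
  also have "\<dots> \<longleftrightarrow> d * (d * (Re u)\<^sup>2 + d * (Im u)\<^sup>2 - 2 * Re u - 1) \<le> 0"
  proof -
    have "A\<^sup>2 = d + 1" by (simp add: d_def)
    then show ?thesis by (simp add: power2_eq_square algebra_simps)
  qed
  also have "\<dots> \<longleftrightarrow> d * (Re u)\<^sup>2 + d * (Im u)\<^sup>2 - 2 * Re u - 1 \<le> 0"
    using d by (simp add: mult_le_0_iff)
  also have "\<dots> \<longleftrightarrow> (A * cmod u)\<^sup>2 \<le> (cmod (1 + u))\<^sup>2"
    unfolding power_mult_distrib cmod_power2 d_def by (simp add: power2_eq_square algebra_simps)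
  also have "\<dots> \<longleftrightarrow> A * cmod u \<le> cmod (1 + u)"
    using A0 by (intro power_mono_iff) auto
  finally show ?thesis .
qed

text \<open>The map \<open>u \<mapsto> - 1 - u\<close> corresponds to
  \<open>z \<mapsto> 1 / z\<close> and exchanges the two kinds of disks.\<close>

lemma mem_disk2_iff:
  assumes "B > 1"
  shows "u \<in> disk2 B \<longleftrightarrow> B * cmod (1 + u) \<le> cmod u"
proof -
  have "B\<^sup>2 - 1 > 0" using assms by simp
  then have E: "of_real (B\<^sup>2 / (1 - B\<^sup>2)) - u = - (of_real (1 / (B\<^sup>2 - 1)) - (- 1 - u))"
  proof -
    have "B\<^sup>2 / (1 - B\<^sup>2) = - 1 - 1 / (B\<^sup>2 - 1)" using \<open>B\<^sup>2 - 1 > 0\<close> by (simp add: field_simps)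
    then have "complex_of_real (B\<^sup>2 / (1 - B\<^sup>2)) = of_real (- 1 - 1 / (B\<^sup>2 - 1))" by (rule arg_cong)
    then show ?thesis by simp
  qed
  then have "u \<in> disk2 B \<longleftrightarrow> - 1 - u \<in> disk1 B"
    unfolding disk1_def disk2_def mem_cball dist_norm E norm_minus_cancel by simp
  also have "\<dots> \<longleftrightarrow> B * cmod (- 1 - u) \<le> cmod (1 + (- 1 - u))" by (rule mem_disk1_iff[OF assms])
  also have "cmod (- 1 - u) = cmod (1 + u)" using norm_minus_cancel[of "1 + u"] by simp
  finally show ?thesis by simp
qed

section \<open>Weighted norms of Faber-type sequences\<close>

lemma infsum_geometric: "0 \<le> r \<Longrightarrow> r < 1 \<Longrightarrow> (\<Sum>\<^sub>\<infinity>n::nat. r ^ n) = 1 / (1 - r)" for r :: real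
  by (intro infsumI norm_summable_imp_has_sum) (auto intro!: geometric_sums summable_geometric)

lemma infsum_geometric_le: "0 \<le> r \<Longrightarrow> r < 1 \<Longrightarrow> (\<Sum>\<^sub>\<infinity>n\<in>S. r ^ n) \<le> 1 / (1 - r)" for r :: real and S :: "nat set"
  using infsum_mono2[OF summable_on_geometric summable_on_geometric, of r S UNIV] infsum_geometric[of r] by simp

lemma leval_geometric_bound:
  assumes "\<And>n::nat. norm (c (int n)) * r ^ n \<le> K * t ^ n" "\<And>n::nat. n \<ge> 1 \<Longrightarrow> norm (c (- int n)) * (1 / r) ^ n \<le> K * t ^ n"
    "0 \<le> t" "t < 1" "r > 0" "K \<ge> 0"
  shows "lsummable r c" "cmod z = r \<Longrightarrow> cmod (leval c z) \<le> 2 * K / (1 - t)"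
proof -
  have g: "(\<lambda>n. K * t ^ n) summable_on S" for S
    using assms by (intro summable_on_cmult_right summable_on_geometric)
  have s1: "(\<lambda>n. norm (c (int n)) * r powi int n) summable_on UNIV"
    by (rule summable_on_comparison_test[OF g]) (use assms in auto)
  have e: "r powi (- int n) = (1 / r) ^ n" for n by (simp add: power_int_minus power_divide inverse_eq_divide)
  have s2: "(\<lambda>n. norm (c (- int n)) * r powi (- int n)) summable_on {1..}"
    unfolding e by (rule summable_on_comparison_test[OF g]) (use assms in auto)
  show ls: "lsummable r c" unfolding lsummable_def summable_on_int_iff using s1 s2 by blast
  have G: "(\<Sum>\<^sub>\<infinity>n\<in>S. K * t ^ n) \<le> K / (1 - t)" for S
    using mult_left_mono[OF infsum_geometric_le[OF assms(3,4), of S] assms(6)] by (simp add: infsum_cmult_right')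
  show "cmod (leval c z) \<le> 2 * K / (1 - t)" if z: "cmod z = r"
  proof -
    have "cmod (leval c z) \<le> (\<Sum>\<^sub>\<infinity>j. norm (c j * z powi j))"
      unfolding leval_def by (rule norm_infsum_bound[OF lsummableD[OF ls z]])
    also have "\<dots> = (\<Sum>\<^sub>\<infinity>j. norm (c j) * r powi j)" by (simp add: norm_powi_term z)
    also have "\<dots> = (\<Sum>\<^sub>\<infinity>n::nat. norm (c (int n)) * r powi int n) + (\<Sum>\<^sub>\<infinity>n\<in>{1::nat..}. norm (c (- int n)) * r powi (- int n))"
      by (rule infsum_int_split) (use ls in \<open>simp add: lsummable_def\<close>)
    also have "\<dots> \<le> (\<Sum>\<^sub>\<infinity>n::nat. K * t ^ n) + (\<Sum>\<^sub>\<infinity>n\<in>{1::nat..}. K * t ^ n)"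
      by (intro add_mono infsum_mono s1 s2 g) (use assms in \<open>auto simp: e\<close>)
    also have "\<dots> \<le> K / (1 - t) + K / (1 - t)" by (intro add_mono G)
    finally show ?thesis by (simp add: add_divide_distrib[symmetric])
  qed
qed

text \<open>The weight gains a factor \<open>1 / k\<close>: it is at most \<open>1 / (\<epsilon> * k)\<close> for \<open>n \<ge> \<epsilon> * k\<close>, and the terms with
  \<open>n < \<epsilon> * k\<close> are exponentially small by the bound on the smaller circle.\<close>

lemma weighted_bound:
  assumes "A > 1" "\<delta> > 0" "k > 0"
    and c: "lsummable (1 / A) c" "\<And>z. cmod z = 1 / A \<Longrightarrow> cmod (leval c z) \<le> M"
    and c': "lsummable (1 / (A * sqrt A)) c" "\<And>z. cmod z = 1 / (A * sqrt A) \<Longrightarrow> cmod (leval c z) \<le> M * exp (- real k * \<delta>)"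
    and d: "\<And>n::nat. norm (d n) \<le> M * exp (- real k * \<delta>)"
    and p: "\<And>n::nat. norm (p n) \<le> norm (c (int n)) + norm (d n)"
  shows "(\<lambda>n::nat. (norm (p n))\<^sup>2 / (real n + 1) * (1 / A) ^ (2 * n)) summable_on UNIV"
    and "(\<Sum>\<^sub>\<infinity>n::nat. (norm (p n))\<^sup>2 / (real n + 1) * (1 / A) ^ (2 * n)) \<le>
       (2 * M\<^sup>2 * (ln A / \<delta> + 1 / \<delta>) + 2 * M\<^sup>2 / (\<delta> * (1 - 1 / A))) / real k"
proof -
  define u where "u n = (norm (c (int n)))\<^sup>2 * ((1 / A) ^ n)\<^sup>2" for n
  define v where "v n = (norm (c (int n)))\<^sup>2 * ((1 / (A * sqrt A)) ^ n)\<^sup>2" for n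
  define E where "E = exp (- real k * \<delta>)"
  have E: "0 < E" "E \<le> 1 / (real k * \<delta>)" "E \<le> 1"
    using exp_minus_le_inverse[of "real k * \<delta>"] assms(2,3) by (auto simp: E_def)
  have rpos: "1 / A > 0" "1 / (A * sqrt A) > 0" using assms(1) by auto
  have u: "u summable_on UNIV" "infsum u UNIV \<le> M\<^sup>2"
    unfolding u_def using parseval_nat[OF c(1) rpos(1) c(2)] by auto
  have v: "v summable_on UNIV" "infsum v UNIV \<le> M\<^sup>2 * E\<^sup>2"
    unfolding v_def using parseval_nat[OF c'(1) rpos(2) c'(2)] by (auto simp: power_mult_distrib E_def)
  have lnA: "ln A > 0" using assms(1) by simp
  define w where "w n = 2 * (ln A / (\<delta> * real k)) * u n + 2 * (1 / E) * v n + 2 * M\<^sup>2 * E * (1 / A) ^ n" for n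
  have le: "(norm (p n))\<^sup>2 / (real n + 1) * (1 / A) ^ (2 * n) \<le> w n" for n
  proof -
    have A2: "(1 / A) ^ (2 * n) = ((1 / A) ^ n)\<^sup>2" by (simp add: power_mult mult.commute power_even_eq)
    have "(norm (p n))\<^sup>2 \<le> (norm (c (int n)) + norm (d n))\<^sup>2" using p by (intro power_mono) auto
    also have "\<dots> \<le> 2 * (norm (c (int n)))\<^sup>2 + 2 * (norm (d n))\<^sup>2"
      using sum_squares_bound[of "norm (c (int n))" "norm (d n)"] by (simp add: power2_sum)
    finally have "(norm (p n))\<^sup>2 / (real n + 1) * (1 / A) ^ (2 * n) \<le>
        (2 * (norm (c (int n)))\<^sup>2 + 2 * (norm (d n))\<^sup>2) / (real n + 1) * (1 / A) ^ (2 * n)"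
      using assms(1) by (intro mult_right_mono divide_right_mono) auto
    also have "\<dots> = 2 * (u n / (real n + 1)) + 2 * ((norm (d n))\<^sup>2 / (real n + 1) * (1 / A) ^ (2 * n))"
      unfolding u_def A2 by (simp add: add_divide_distrib ring_distribs)
    also have "u n / (real n + 1) \<le> ln A / (\<delta> * real k) * u n + (1 / E) * v n"
    \<comment> \<open>The threshold is where \<open>A ^ n\<close> is about
      \<open>exp (\<delta> * k) = 1 / E\<close>. Above it the weight itself is small; below it the
      passage to the smaller circle costs \<open>A ^ n\<close>, which uses up only one of the two
      factors \<open>E\<close> in the bound for \<open>v\<close>.\<close>
    proof (cases "\<delta> * real k / ln A \<le> real n + 1")
      case True
      have "1 / (real n + 1) \<le> 1 / (\<delta> * real k / ln A)"
        using True assms(2,3) lnA by (intro divide_left_mono) auto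
      then have "1 / (real n + 1) * u n \<le> ln A / (\<delta> * real k) * u n"
        by (intro mult_right_mono) (auto simp: u_def)
      moreover have "0 \<le> (1 / E) * v n" using E by (simp add: v_def)
      ultimately show ?thesis by simp
    next
      case False
      then have "real n * ln A \<le> \<delta> * real k" using lnA by (simp add: field_simps)
      then have "exp (real n * ln A) \<le> exp (\<delta> * real k)" by simp
      then have An: "A ^ n \<le> 1 / E"
        using assms(1) by (simp add: E_def exp_of_nat_mult exp_minus inverse_eq_divide mult.commute)
      have "((1 / A) ^ n)\<^sup>2 = A ^ n * ((1 / (A * sqrt A)) ^ n)\<^sup>2"
      proof -
        have "(sqrt A ^ n)\<^sup>2 = A ^ n" using assms(1) by (simp add: power_mult[symmetric] mult.commute[of n]) (simp add: power_mult)
        then show ?thesis using assms(1) by (simp add: power_divide power_mult_distrib)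
      qed
      then have "u n = A ^ n * v n" by (simp add: u_def v_def)
      also have "\<dots> \<le> (1 / E) * v n" using An by (intro mult_right_mono) (auto simp: v_def)
      finally have "u n \<le> (1 / E) * v n" .
      moreover have "u n / (real n + 1) \<le> u n / 1" by (intro divide_left_mono) (auto simp: u_def)
      moreover have "0 \<le> ln A / (\<delta> * real k) * u n" using lnA assms(2) by (simp add: u_def)
      ultimately show ?thesis by linarith
    qed
    also have "(norm (d n))\<^sup>2 / (real n + 1) * (1 / A) ^ (2 * n) \<le> (M * E)\<^sup>2 / 1 * (1 / A) ^ n"
      using assms(1) d[of n] unfolding E_def[symmetric]
      by (intro mult_mono frac_le power_mono power_decreasing) auto
    also have "(M * E)\<^sup>2 / 1 * (1 / A) ^ n \<le> M\<^sup>2 * E * (1 / A) ^ n"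
    proof (rule mult_right_mono)
      have "M\<^sup>2 * (E * E) \<le> M\<^sup>2 * (E * 1)" using E by (intro mult_left_mono) auto
      then show "(M * E)\<^sup>2 / 1 \<le> M\<^sup>2 * E" by (simp add: power_mult_distrib power2_eq_square mult_ac)
    qed (use assms(1) in auto)
    finally show ?thesis by (simp add: w_def algebra_simps)
  qed
  have g: "(\<lambda>n. (1 / A) ^ n) summable_on (UNIV :: nat set)" using assms(1) by (intro summable_on_geometric) auto
  have w: "w summable_on UNIV" unfolding w_def
    by (intro summable_on_add summable_on_cmult_right u v g)
  show s: "(\<lambda>n::nat. (norm (p n))\<^sup>2 / (real n + 1) * (1 / A) ^ (2 * n)) summable_on UNIV"
    by (rule summable_on_comparison_test[OF w le]) (use assms(1) in auto)
  have "(\<Sum>\<^sub>\<infinity>n::nat. (norm (p n))\<^sup>2 / (real n + 1) * (1 / A) ^ (2 * n)) \<le> infsum w UNIV"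
    by (rule infsum_mono[OF s w le])
  also have "infsum w UNIV = 2 * (ln A / (\<delta> * real k)) * infsum u UNIV + 2 * (1 / E) * infsum v UNIV + 2 * M\<^sup>2 * E * (\<Sum>\<^sub>\<infinity>n::nat. (1 / A) ^ n)"
    unfolding w_def by (simp only: infsum_add summable_on_add summable_on_cmult_right u v g infsum_cmult_right')
  also have "\<dots> \<le> 2 * (ln A / (\<delta> * real k)) * M\<^sup>2 + 2 * (1 / E) * (M\<^sup>2 * E\<^sup>2) + 2 * M\<^sup>2 * E * (1 / (1 - 1 / A))"
    using infsum_geometric[of "1 / A"] assms lnA E
    by (intro add_mono mult_left_mono u v) auto
  also have "2 * (1 / E) * (M\<^sup>2 * E\<^sup>2) = 2 * M\<^sup>2 * E" using E by (simp add: power2_eq_square)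
  also have "2 * (ln A / (\<delta> * real k)) * M\<^sup>2 + 2 * M\<^sup>2 * E + 2 * M\<^sup>2 * E * (1 / (1 - 1 / A)) \<le>
      2 * (ln A / (\<delta> * real k)) * M\<^sup>2 + 2 * M\<^sup>2 * (1 / (real k * \<delta>)) + 2 * M\<^sup>2 * (1 / (real k * \<delta>)) * (1 / (1 - 1 / A))"
    using E assms(1) by (intro add_mono mult_left_mono mult_right_mono order_refl) auto
  also have "\<dots> = (2 * M\<^sup>2 * (ln A / \<delta> + 1 / \<delta>) + 2 * M\<^sup>2 / (\<delta> * (1 - 1 / A))) / real k"
    by (simp add: add_divide_distrib ring_distribs mult_ac)
  finally show "(\<Sum>\<^sub>\<infinity>n::nat. (norm (p n))\<^sup>2 / (real n + 1) * (1 / A) ^ (2 * n)) \<le>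
       (2 * M\<^sup>2 * (ln A / \<delta> + 1 / \<delta>) + 2 * M\<^sup>2 / (\<delta> * (1 - 1 / A))) / real k" .
qed

context annulus
begin

text \<open>Both sums start at \<open>n = 0\<close>, so that the negative half is the positive half
  of the reversed sequence with \<open>A\<close> and \<open>B\<close> exchanged.\<close>

definition short_faber_seq :: "real \<Rightarrow> nat \<Rightarrow> (int \<Rightarrow> complex) \<Rightarrow> bool" where
  "short_faber_seq C k p \<longleftrightarrow> (ldiff ^^ k) p = (\<lambda>_. 0) \<and> (ldiff ^^ (k - 1)) p = (\<lambda>_. of_real (exp (- real k * robin A B))) \<and>
     (\<lambda>n::nat. (norm (p (int n)))\<^sup>2 / (real n + 1) * (1 / A) ^ (2 * n)) summable_on UNIV \<and>
     (\<Sum>\<^sub>\<infinity>n::nat. (norm (p (int n)))\<^sup>2 / (real n + 1) * (1 / A) ^ (2 * n)) \<le> C / real k \<and>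
     (\<lambda>n::nat. (norm (p (- int n)))\<^sup>2 / (real n + 1) * (1 / B) ^ (2 * n)) summable_on UNIV \<and>
     (\<Sum>\<^sub>\<infinity>n::nat. (norm (p (- int n)))\<^sup>2 / (real n + 1) * (1 / B) ^ (2 * n)) \<le> C / real k"

text \<open>At \<open>n \<ge> 0\<close> the main term of \<open>p\<close> is \<open>f\<close>, while
  \<open>g\<close> is exponentially small there: Cauchy's estimate may be taken on the circle of
  radius \<open>B * sqrt B\<close>, where Green's function is negative. At \<open>n \<le> 0\<close>
  the roles are exchanged by reversing \<open>g\<close>.\<close>

lemma faber_norms:
  "\<exists>C>0. \<forall>k>0. \<exists>p. short_faber_seq C k p"
proof -
  obtain \<delta>1 where \<delta>1: "\<delta>1 > 0" "\<And>z. cmod z = 1 / (A * sqrt A) \<Longrightarrow> green A B z \<le> - \<delta>1"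
    using green_negative_inner by blast
  obtain \<delta>2 where \<delta>2: "\<delta>2 > 0" "\<And>z. cmod z = B * sqrt B \<Longrightarrow> green A B z \<le> - \<delta>2"
    using green_negative_outer by blast
  define \<delta> where "\<delta> = min \<delta>1 \<delta>2"
  have \<delta>: "\<delta> > 0" "\<And>z. cmod z = 1 / (A * sqrt A) \<Longrightarrow> green A B z \<le> - \<delta>" "\<And>z. cmod z = B * sqrt B \<Longrightarrow> green A B z \<le> - \<delta>"
  proof -
    have "- \<delta>1 \<le> - \<delta>" "- \<delta>2 \<le> - \<delta>" by (auto simp: \<delta>_def)
    then show "\<delta> > 0" "\<And>z. cmod z = 1 / (A * sqrt A) \<Longrightarrow> green A B z \<le> - \<delta>" "\<And>z. cmod z = B * sqrt B \<Longrightarrow> green A B z \<le> - \<delta>"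
      using \<delta>1 \<delta>2 by (fastforce simp: \<delta>_def)+
  qed
  define M where "M = A\<^sup>2"
  have M1: "M \<ge> 1" using A1 by (simp add: M_def)
  define CA where "CA X = (2 * M\<^sup>2 * (ln X / \<delta> + 1 / \<delta>) + 2 * M\<^sup>2 / (\<delta> * (1 - 1 / X)))" for X
  define C where "C = max 1 (max (CA A) (CA B))"
  note sA = sqrt_range and sB = annulus.sqrt_range[OF sym]
  have Bs: "1 < B * sqrt B" "B * sqrt B < B\<^sup>2" "1 < B" "B < B\<^sup>2"
  proof -
    have "1 < sqrt B" "sqrt B * sqrt B = B" using B1 by auto
    then have "sqrt B < B" by (metis mult_less_cancel_left2 not_less order_less_trans zero_less_one less_imp_le mult.right_neutral mult_strict_left_mono)
    then show "B * sqrt B < B\<^sup>2" using B1 by (simp add: power2_eq_square)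
    show "1 < B * sqrt B" "1 < B" "B < B\<^sup>2" using B1 \<open>1 < sqrt B\<close> by (auto simp: less_1_mult power2_eq_square)
  qed
  show ?thesis
  proof (intro exI[of _ C] conjI allI impI)
    show "C > 0" by (simp add: C_def)
    fix k :: nat assume k: "k > 0"
    obtain f g where fg: "faber_seq k f g" using faber_exists[OF k] by blast
    note F = fg[unfolded faber_seq_def]
    have fL: "lsummable r f" if "1 / A\<^sup>2 < r" "r < 1" for r using F that by blast
    have gL: "lsummable r g" if "1 < r" "r < B\<^sup>2" for r using F that by blast
    have fb: "cmod (leval f z) \<le> M * exp (real k * green A B z)" if "1 / A\<^sup>2 < cmod z" "cmod z < 1" for z
      using F that unfolding M_def by blast
    have gb: "cmod (leval g z) \<le> M * exp (real k * green A B z)" if "1 < cmod z" "cmod z < B\<^sup>2" for z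
    proof -
      have "cmod (leval g z) \<le> 1 * exp (real k * green A B z)" using F that by simp
      also have "\<dots> \<le> M * exp (real k * green A B z)" using M1 by (intro mult_right_mono) auto
      finally show ?thesis .
    qed
    have expd: "exp (real k * G) \<le> exp (- real k * \<delta>)" if "G \<le> - \<delta>" for G
      using mult_left_mono[OF that, of "real k"] by simp
    have f0: "cmod (leval f z) \<le> M" if "cmod z = 1 / A" for z
      using fb[of z] that sA green_inner_circle[OF that] A1 by auto
    have f1: "cmod (leval f z) \<le> M * exp (- real k * \<delta>)" if "cmod z = 1 / (A * sqrt A)" for z
    proof -
      have "cmod (leval f z) \<le> M * exp (real k * green A B z)" by (rule fb) (use that sA in linarith)+
      also have "\<dots> \<le> M * exp (- real k * \<delta>)" using M1 expd[OF \<delta>(2)[OF that]] by (intro mult_left_mono) auto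
      finally show ?thesis .
    qed
    have g0: "cmod (leval g z) \<le> M" if "cmod z = B" for z
      using gb[of z] that Bs green_outer_circle[OF that] by auto
    have g1: "cmod (leval g z) \<le> M * exp (- real k * \<delta>)" if "cmod z = B * sqrt B" for z
    proof -
      have "cmod (leval g z) \<le> M * exp (real k * green A B z)" by (rule gb) (use that Bs in linarith)+
      also have "\<dots> \<le> M * exp (- real k * \<delta>)" using M1 expd[OF \<delta>(3)[OF that]] by (intro mult_left_mono) auto
      finally show ?thesis .
    qed
    have fs: "lsummable (1 / A) f" "lsummable (1 / (A * sqrt A)) f" by (rule fL; use sA in linarith)+
    have gs: "lsummable B g" "lsummable (B * sqrt B) g" by (rule gL; use Bs in linarith)+
    define g' where "g' j = g (- j)" for j
    have g's: "lsummable (1 / B) g'" "lsummable (1 / (B * sqrt B)) g'"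
      unfolding g'_def by (rule lsummable_reflect; use gs B1 in \<open>simp add: inverse_eq_divide\<close>)+
    have g'0: "cmod (leval g' z) \<le> M" if "cmod z = 1 / B" for z
      unfolding g'_def leval_reflect by (rule g0) (use that in \<open>simp add: norm_inverse\<close>)
    have g'1: "cmod (leval g' z) \<le> M * exp (- real k * \<delta>)" if "cmod z = 1 / (B * sqrt B)" for z
      unfolding g'_def leval_reflect by (rule g1) (use that in \<open>simp add: norm_inverse\<close>)
    have gn: "norm (g (int n)) \<le> M * exp (- real k * \<delta>)" for n
    proof -
      have "norm (g (int n)) * 1 \<le> norm (g (int n)) * (B * sqrt B) powi int n"
        using Bs(1) by (intro mult_left_mono) (auto intro: one_le_power)
      also have "\<dots> \<le> M * exp (- real k * \<delta>)" by (rule coeff_bound[OF gs(2) _ g1]) (use B1 in auto)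
      finally show ?thesis by simp
    qed
    have fn: "norm (f (- int n)) \<le> M * exp (- real k * \<delta>)" for n
    proof -
      have "norm (f (- int n)) * 1 \<le> norm (f (- int n)) * (1 / (A * sqrt A)) powi (- int n)"
      proof (intro mult_left_mono)
        have "1 \<le> A * sqrt A" using A1 by (simp add: mult_ge1_I)
        then show "1 \<le> (1 / (A * sqrt A)) powi (- int n)" by (simp add: power_int_minus power_divide one_le_power)
      qed auto
      also have "\<dots> \<le> M * exp (- real k * \<delta>)" by (rule coeff_bound[OF fs(2) _ f1]) (use A1 in auto)
      finally show ?thesis by simp
    qed
    define p where "p j = f j - g j" for j
    have pA: "norm (p (int n)) \<le> norm (f (int n)) + norm (g (int n))" for n unfolding p_def by (rule norm_triangle_ineq4)
    have pB: "norm (p (- int n)) \<le> norm (g' (int n)) + norm (f (- int n))" for n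
      unfolding p_def g'_def by (subst add.commute) (rule norm_triangle_ineq4)
    note WA = weighted_bound[OF A1 \<delta>(1) k fs(1) f0 fs(2) f1 gn pA, folded CA_def]
    note WB = weighted_bound[OF B1 \<delta>(1) k g's(1) g'0 g's(2) g'1 fn pB, folded CA_def]
    have C: "CA A / real k \<le> C / real k" "CA B / real k \<le> C / real k"
      unfolding C_def by (intro divide_right_mono; simp)+
    show "\<exists>p. short_faber_seq C k p"
      unfolding short_faber_seq_def
    proof (intro exI[of _ p] conjI)
      show "(ldiff ^^ k) p = (\<lambda>_. 0)" "(ldiff ^^ (k - 1)) p = (\<lambda>_. of_real (exp (- real k * robin A B)))"
        using F unfolding p_def by blast+
      show "(\<Sum>\<^sub>\<infinity>n::nat. (norm (p (int n)))\<^sup>2 / (real n + 1) * (1 / A) ^ (2 * n)) \<le> C / real k"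
        using WA(2) C(1) by (rule order_trans)
      show "(\<Sum>\<^sub>\<infinity>n::nat. (norm (p (- int n)))\<^sup>2 / (real n + 1) * (1 / B) ^ (2 * n)) \<le> C / real k"
        using WB(2) C(2) by (rule order_trans)
      show "(\<lambda>n::nat. (norm (p (int n)))\<^sup>2 / (real n + 1) * (1 / A) ^ (2 * n)) summable_on UNIV" by (rule WA(1))
      show "(\<lambda>n::nat. (norm (p (- int n)))\<^sup>2 / (real n + 1) * (1 / B) ^ (2 * n)) summable_on UNIV" by (rule WB(1))
    qed
  qed
qed

section \<open>Monic polynomials of nearly minimal growth on the two disks\<close>

text \<open>The polynomial is the principal part of the Faber function at 1, written in
  \<open>w = 1 / (1 - z) = 1 + u\<close>. Its coefficients are the Newton coefficients of
  \<open>p\<close>, the last being \<open>exp (- k * robin A B)\<close>; making it monic produces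
  the growth rate.\<close>

lemma monic_poly_bound:
  assumes \<eta>: "\<eta> > 0"
  shows "\<exists>C>0. \<forall>k. \<exists>q::complex poly. degree q = k \<and> lead_coeff q = 1 \<and>
    (\<forall>u\<in>disk1 A \<union> disk2 B. cmod (poly q u) \<le> C * exp (real k * (robin A B + \<eta>)))"
proof -
  obtain Q where Q: "1 < Q" "Q < sqrt A" "Q < sqrt B"
    "\<And>z. cmod z = Q / A \<Longrightarrow> green A B z \<le> \<eta>" "\<And>z. cmod z = B / Q \<Longrightarrow> green A B z \<le> \<eta>"
    using green_small[OF \<eta>] by blast
  \<comment> \<open>The 1 covers the constant polynomial for \<open>k = 0\<close>, where
    \<open>faber_exists\<close> says nothing.\<close>
  define C where "C = max 1 (4 * A\<^sup>2 / (1 - 1 / Q))"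
  have QA: "Q < A" "Q * Q < A" and QB: "Q < B" "Q * Q < B"
  proof -
    have "Q * Q < sqrt A * sqrt A" "Q * Q < sqrt B * sqrt B" using Q A1 B1 by (intro mult_strict_mono; simp)+
    then show 1: "Q * Q < A" "Q * Q < B" using A1 B1 by auto
    have "Q < Q * Q" using Q(1) by simp
    then show "Q < A" "Q < B" using 1 by linarith+
  qed
  show ?thesis
  proof (intro exI[of _ C] conjI allI)
    show "C > 0" by (simp add: C_def)
    fix k :: nat
    show "\<exists>q::complex poly. degree q = k \<and> lead_coeff q = 1 \<and>
      (\<forall>u\<in>disk1 A \<union> disk2 B. cmod (poly q u) \<le> C * exp (real k * (robin A B + \<eta>)))"
    proof (cases "k = 0")
      case True
      then show ?thesis by (intro exI[of _ 1]) (auto simp: C_def)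
    next
      case False
      then have k: "k > 0" by simp
      obtain f g where fg: "faber_seq k f g" using faber_exists[OF k] by blast
      note F = fg[unfolded faber_seq_def]
      define M where "M = A\<^sup>2 * exp (real k * \<eta>)"
      have M0: "M > 0" using A1 by (simp add: M_def)
      have r1: "1 / A\<^sup>2 < Q / A" "Q / A < 1" "0 < Q / A" and r2: "1 < B / Q" "B / Q < B\<^sup>2" "0 < B / Q"
      proof -
        have "1 < A * Q" "1 < B * Q" using Q(1) A1 B1 by (auto intro: less_1_mult)
        then show "1 / A\<^sup>2 < Q / A" "B / Q < B\<^sup>2" using Q(1) A1 B1 by (auto simp: field_simps power2_eq_square)
        show "Q / A < 1" "0 < Q / A" "1 < B / Q" "0 < B / Q" using Q(1) A1 B1 QA QB by auto
      qed
      have fb: "cmod (leval f z) \<le> M" if z: "cmod z = Q / A" for z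
      proof -
        have "cmod (leval f z) \<le> A\<^sup>2 * exp (real k * green A B z)" using F z r1 by simp
        also have "\<dots> \<le> M" unfolding M_def using Q(4)[OF z] by (intro mult_left_mono) (auto intro: mult_left_mono)
        finally show ?thesis .
      qed
      have gb: "cmod (leval g z) \<le> M" if z: "cmod z = B / Q" for z
      proof -
        have "cmod (leval g z) \<le> 1 * exp (real k * green A B z)" using F z r2 by simp
        also have "\<dots> \<le> M" unfolding M_def using Q(5)[OF z] A1 by (intro mult_mono) (auto intro: mult_left_mono)
        finally show ?thesis .
      qed
      have fj: "norm (f j) \<le> M * (A / Q) powi j" for j
      proof -
        have "norm (f j) * (Q / A) powi j \<le> M" by (rule coeff_bound[OF _ r1(3) fb]) (use F r1 in blast)
        moreover have "(Q / A) powi j > 0" using r1 by simp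
        ultimately have "norm (f j) \<le> M / (Q / A) powi j" by (simp add: le_divide_eq)
        then show ?thesis by (simp add: power_int_divide_distrib)
      qed
      have gj: "norm (g j) \<le> M * (Q / B) powi j" for j
      proof -
        have "norm (g j) * (B / Q) powi j \<le> M" by (rule coeff_bound[OF _ r2(3) gb]) (use F r2 in blast)
        moreover have "(B / Q) powi j > 0" using r2 by simp
        ultimately have "norm (g j) \<le> M / (B / Q) powi j" by (simp add: le_divide_eq)
        then show ?thesis by (simp add: power_int_divide_distrib)
      qed
      define p where "p j = f j - g j" for j
      have pn: "norm (p (int n)) \<le> 2 * M * (A / Q) ^ n" for n
      proof -
        have "(Q / B) ^ n \<le> (A / Q) ^ n"
        proof (rule power_mono)
          have "Q / B \<le> 1" "1 \<le> A / Q" using QA QB Q(1) by auto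
          then show "Q / B \<le> A / Q" by linarith
        qed (use Q(1) B1 in auto)
        then have "M * (Q / B) ^ n \<le> M * (A / Q) ^ n" using M0 by simp
        then show ?thesis
          using norm_triangle_ineq4[of "f (int n)" "g (int n)"] fj[of "int n"] gj[of "int n"] unfolding p_def by simp
      qed
      have pm: "norm (p (- int n)) \<le> 2 * M * (B / Q) ^ n" for n
      proof -
        have inv: "inverse ((A / Q) ^ n) = (Q / A) ^ n" "inverse ((Q / B) ^ n) = (B / Q) ^ n"
          by (simp_all add: power_inverse[symmetric])
        have "(Q / A) ^ n \<le> (B / Q) ^ n"
        proof (rule power_mono)
          have "Q / A \<le> 1" "1 \<le> B / Q" using QA QB Q(1) by auto
          then show "Q / A \<le> B / Q" by linarith
        qed (use Q(1) A1 in auto)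
        then have "M * (Q / A) ^ n \<le> M * (B / Q) ^ n" using M0 by simp
        then show ?thesis
          using norm_triangle_ineq4[of "f (- int n)" "g (- int n)"] fj[of "- int n"] gj[of "- int n"]
          unfolding p_def power_int_minus power_int_of_nat inv by simp
      qed
      define a where "a i = (ldiff ^^ i) p (-1)" for i
      define S where "S w = (\<Sum>i<k. a i * w ^ Suc i)" for w
      have pk: "(ldiff ^^ k) p = (\<lambda>_. 0)" "(ldiff ^^ (k - 1)) p = (\<lambda>_. of_real (exp (- real k * robin A B)))"
        using F unfolding p_def by blast+
      define t where "t = 1 / Q"
      have t: "0 \<le> t" "t < 1" using Q(1) by (auto simp: t_def)
      define D where "D = 4 * M / (1 - t)"
      have D: "2 * (2 * M) / (1 - t) = D" by (simp add: D_def)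
      \<comment> \<open>By \<open>leval_cut\<close> the same value of \<open>S\<close> is reached
        from either side: \<open>s = 1\<close> uses the values of \<open>p\<close> at nonnegative
        integers, \<open>s = 0\<close> those at negative ones.\<close>
      have SD: "cmod (S (1 / (1 - z))) \<le> D" if z: "0 < cmod z" "z \<noteq> 1"
        and b1: "\<And>n::nat. norm (s * p (int n)) * cmod z ^ n \<le> (2 * M) * t ^ n"
        and b2: "\<And>n::nat. norm ((s - 1) * p (- int n)) * (1 / cmod z) ^ n \<le> (2 * M) * t ^ n" for z s
      proof -
        define T where "T = (\<lambda>j. if j \<ge> (0::int) then s * p j else (s - 1) * p j)"
        have lg: "lsummable (cmod z) T" "cmod (leval T z) \<le> D"
          unfolding D[symmetric] using b1 b2 t z(1) M0
          by (intro leval_geometric_bound[of T "cmod z" "2 * M" t]; simp add: T_def)+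
        then have "leval T z = S (1 / (1 - z))"
          unfolding T_def S_def a_def by (intro leval_cut[OF pk(1) lg(1)[unfolded T_def] z(1) refl z(2)])
        then show ?thesis using lg(2) by simp
      qed
      have inner: "cmod (S (1 / (1 - z))) \<le> D" if z: "0 < cmod z" "cmod z \<le> 1 / A" for z
      proof (rule SD[where s=1])
        show "norm (1 * p (int n)) * cmod z ^ n \<le> (2 * M) * t ^ n" for n
        proof -
          have "norm (p (int n)) * cmod z ^ n \<le> (2 * M * (A / Q) ^ n) * (1 / A) ^ n"
            using pn[of n] z M0 A1 Q(1) by (intro mult_mono power_mono) auto
          then show ?thesis using A1 by (simp add: t_def power_divide)
        qed
      qed (use z A1 M0 t in auto)
      have outer: "cmod (S (1 / (1 - z))) \<le> D" if z: "B \<le> cmod z" for z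
      proof (rule SD[where s=0])
        show "norm ((0 - 1) * p (- int n)) * (1 / cmod z) ^ n \<le> (2 * M) * t ^ n" for n
        proof -
          have "0 < cmod z" using z B1 by linarith
          then have "1 / cmod z \<le> 1 / B" using z B1 by (intro divide_left_mono) auto
          then have "norm (p (- int n)) * (1 / cmod z) ^ n \<le> (2 * M * (B / Q) ^ n) * (1 / B) ^ n"
            using pm[of n] M0 B1 Q(1) by (intro mult_mono power_mono) auto
          then show ?thesis using B1 by (simp add: t_def power_divide)
        qed
      qed (use z B1 M0 t in auto)
      have Sb: "cmod (S (1 + u)) \<le> D" if u: "u \<in> disk1 A \<union> disk2 B" for u
      proof -
        have D0: "0 \<le> D" using M0 t by (simp add: D_def)
        \<comment> \<open>The points \<open>u = -1\<close> and \<open>u = 0\<close> correspond to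
          \<open>z = \<infinity>\<close> and \<open>z = 0\<close>, where no Laurent series is
          evaluated; the values of \<open>S\<close> there are 0 and \<open>p 0\<close>.\<close>
        consider "1 + u = 0" | "u = 0" | "1 + u \<noteq> 0" "u \<noteq> 0" by blast
        then show ?thesis
        proof cases
          case 1
          then show ?thesis using D0 by (simp add: S_def)
        next
          case 2
          have "S 1 = p 0" unfolding newton_expansion[OF pk(1), of 0] S_def a_def
            by (simp add: binomial_gbinomial[symmetric])
          then have "cmod (S 1) \<le> 2 * M" using pn[of 0] by simp
          also have "\<dots> \<le> D" using M0 t by (simp add: D_def field_simps)
          finally show ?thesis using 2 by simp
        next
          case 3
          define z where "z = u / (1 + u)"
          have w: "1 + u = 1 / (1 - z)" using 3 by (simp add: z_def field_simps)
          have cz: "cmod z = cmod u / cmod (1 + u)" "0 < cmod z" using 3 by (auto simp: z_def norm_divide)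
          from u show ?thesis
          proof
            assume "u \<in> disk1 A"
            then have "A * cmod u \<le> cmod (1 + u)" by (simp add: mem_disk1_iff[OF A1])
            then have "cmod z \<le> 1 / A" unfolding cz(1) using 3 A1 by (simp add: field_simps)
            then show ?thesis unfolding w by (rule inner[OF cz(2)])
          next
            assume "u \<in> disk2 B"
            then have "B * cmod (1 + u) \<le> cmod u" by (simp add: mem_disk2_iff[OF B1])
            then have "B \<le> cmod z" unfolding cz(1) using 3 by (simp add: le_divide_eq)
            then show ?thesis unfolding w by (rule outer)
          qed
        qed
      qed
      define F0 where "F0 = (\<Sum>i<k. monom (a i) (Suc i))"
      have F0c: "coeff F0 n = (if n \<in> Suc ` {..<k} then a (n - 1) else 0)" for n
      proof -
        have "coeff F0 n = (\<Sum>i<k. if i = n - 1 \<and> n > 0 then a (n - 1) else 0)"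
          unfolding F0_def coeff_sum by (rule sum.cong) (auto)
        also have "\<dots> = (if n \<in> Suc ` {..<k} then a (n - 1) else 0)"
          by (cases n) (auto simp: sum.delta)
        finally show ?thesis .
      qed
      have ak: "a (k - 1) = of_real (exp (- real k * robin A B))" unfolding a_def pk(2) ..
      have ck: "coeff F0 k = of_real (exp (- real k * robin A B))"
        unfolding F0c using k ak by (auto simp: image_iff intro: bexI[of _ "k - 1"])
      have dF: "degree F0 = k"
      proof (rule antisym)
        show "degree F0 \<le> k" by (rule degree_le) (auto simp: F0c)
        show "k \<le> degree F0" by (rule le_degree) (simp add: ck)
      qed
      define q where "q = smult (of_real (exp (real k * robin A B))) (pcompose F0 [:1, 1:])"
      have "degree q = k" by (simp add: q_def dF degree_pcompose)
      moreover have "lead_coeff q = 1"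
      proof -
        have "lead_coeff (pcompose F0 [:1, 1:]) = lead_coeff F0 * lead_coeff [:1, 1:] ^ degree F0"
          by (rule lead_coeff_comp) simp
        also have "\<dots> = of_real (exp (- real k * robin A B))" by (simp add: dF ck)
        finally show ?thesis unfolding q_def lead_coeff_smult by (simp add: exp_minus flip: of_real_mult of_real_inverse)
      qed
      moreover have "cmod (poly q u) \<le> C * exp (real k * (robin A B + \<eta>))" if u: "u \<in> disk1 A \<union> disk2 B" for u
      proof -
        have "poly (pcompose F0 [:1, 1:]) u = S (1 + u)"
          unfolding poly_pcompose F0_def S_def by (simp add: poly_sum poly_monom)
        then have "cmod (poly q u) = exp (real k * robin A B) * cmod (S (1 + u))"
          by (simp add: q_def norm_mult)
        also have "\<dots> \<le> exp (real k * robin A B) * D" by (intro mult_left_mono Sb u) auto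
        also have "\<dots> = (4 * A\<^sup>2 / (1 - 1 / Q)) * exp (real k * (robin A B + \<eta>))"
          by (simp add: D_def M_def t_def exp_add ring_distribs)
        also have "\<dots> \<le> C * exp (real k * (robin A B + \<eta>))"
          by (intro mult_right_mono) (auto simp: C_def)
        finally show ?thesis .
      qed
      ultimately show ?thesis by blast
    qed
  qed
qed

end

section \<open>Fekete estimate and the lower bound for the energy\<close>

text \<open>Interpolation at \<open>k + 1\<close> nodes reproduces a polynomial of degree
  \<open>k\<close>; the identity compares coefficients at \<open>k\<close>.\<close>

lemma lagrange_leading_coeff:
  fixes q :: "complex poly"
  assumes X: "finite X" "card X = Suc k" and q: "degree q = k" "lead_coeff q = 1"
  shows "(\<Sum>x\<in>X. poly q x / (\<Prod>y\<in>X - {x}. x - y)) = 1"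
proof -
  define l where "l x = (\<Prod>y\<in>X - {x}. [:- y, 1:])" for x
  have dl: "degree (l x) = k" "lead_coeff (l x) = 1" if "x \<in> X" for x
  proof -
    have "degree (l x) = (\<Sum>y\<in>X - {x}. degree [:- y, 1:])"
      unfolding l_def by (rule degree_prod_eq_sum_degree) auto
    then show "degree (l x) = k" using X that by simp
    show "lead_coeff (l x) = 1" unfolding l_def by (simp add: lead_coeff_prod)
  qed
  define c where "c x = poly q x / (\<Prod>y\<in>X - {x}. x - y)" for x
  define r where "r = (\<Sum>x\<in>X. smult (c x) (l x)) - q"
  have pl: "poly (l x) z = (\<Prod>y\<in>X - {x}. z - y)" for x z
    unfolding l_def by (simp add: poly_prod)
  have "poly r z = 0" if z: "z \<in> X" for z
  proof -
    have "(\<Sum>x\<in>X. c x * poly (l x) z) = (\<Sum>x\<in>X. if x = z then poly q z else 0)"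
    proof (rule sum.cong)
      fix x assume x: "x \<in> X"
      show "c x * poly (l x) z = (if x = z then poly q z else 0)"
      proof (cases "x = z")
        case True
        have "(\<Prod>y\<in>X - {z}. z - y) \<noteq> 0" using X by auto
        then show ?thesis using True by (simp add: c_def pl)
      next
        case False
        then have "poly (l x) z = 0" unfolding pl using z X by auto
        then show ?thesis using False by simp
      qed
    qed simp
    then show ?thesis using X z by (simp add: r_def poly_sum)
  qed
  then have sub: "X \<subseteq> {z. poly r z = 0}" by auto
  have deg: "degree r \<le> k"
    unfolding r_def by (intro degree_diff_le degree_sum_le) (use dl q X in \<open>auto intro: order_trans[OF degree_smult_le]\<close>)
  have "r = 0"
  proof (rule ccontr)
    assume r: "r \<noteq> 0"
    have "card X \<le> card {z. poly r z = 0}" by (rule card_mono[OF poly_roots_finite[OF r] sub])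
    also have "\<dots> \<le> degree r" by (rule card_poly_roots_bound[OF r])
    finally show False using deg X by simp
  qed
  then have "coeff (\<Sum>x\<in>X. smult (c x) (l x)) k = coeff q k" by (simp add: r_def)
  moreover have "coeff (\<Sum>x\<in>X. smult (c x) (l x)) k = (\<Sum>x\<in>X. c x)"
    unfolding coeff_sum by (rule sum.cong) (use dl in \<open>auto\<close>)
  ultimately show ?thesis using q by (simp add: c_def)
qed

text \<open>The square root compensates for counting each pair of points twice, so that no ordering
  of the set has to be chosen.\<close>

definition vandermonde :: "complex set \<Rightarrow> real" where
  "vandermonde X = sqrt (\<Prod>x\<in>X. \<Prod>y\<in>X - {x}. cmod (x - y))"

lemma vandermonde_remove:
  assumes "finite X" "x \<in> X"
  shows "vandermonde X = vandermonde (X - {x}) * (\<Prod>y\<in>X - {x}. cmod (x - y))"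
proof -
  let ?Y = "X - {x}" and ?a = "\<Prod>y\<in>X - {x}. cmod (x - y)"
  have "(\<Prod>u\<in>X. \<Prod>y\<in>X - {u}. cmod (u - y)) = ?a * (\<Prod>u\<in>?Y. \<Prod>y\<in>X - {u}. cmod (u - y))"
    using assms by (rule prod.remove)
  also have "(\<Prod>u\<in>?Y. \<Prod>y\<in>X - {u}. cmod (u - y)) = (\<Prod>u\<in>?Y. cmod (x - u) * (\<Prod>y\<in>?Y - {u}. cmod (u - y)))"
  proof (rule prod.cong)
    fix u assume u: "u \<in> ?Y"
    have "(\<Prod>y\<in>X - {u}. cmod (u - y)) = cmod (u - x) * (\<Prod>y\<in>X - {u} - {x}. cmod (u - y))"
      by (rule prod.remove) (use assms u in auto)
    moreover have "X - {u} - {x} = ?Y - {u}" by auto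
    ultimately show "(\<Prod>y\<in>X - {u}. cmod (u - y)) = cmod (x - u) * (\<Prod>y\<in>?Y - {u}. cmod (u - y))"
      by (simp add: norm_minus_commute)
  qed simp
  also have "\<dots> = ?a * (\<Prod>u\<in>?Y. \<Prod>y\<in>?Y - {u}. cmod (u - y))" by (simp add: prod.distrib)
  finally have "(\<Prod>u\<in>X. \<Prod>y\<in>X - {u}. cmod (u - y)) = ?a\<^sup>2 * (\<Prod>u\<in>?Y. \<Prod>y\<in>?Y - {u}. cmod (u - y))"
    by (simp add: power2_eq_square mult.assoc)
  moreover have "?a \<ge> 0" by (intro prod_nonneg) auto
  ultimately show ?thesis unfolding vandermonde_def by (simp add: real_sqrt_mult)
qed

text \<open>Multiplying the Lagrange identity for the leading coefficient by the Vandermonde product bounds the latter in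
  terms of products with one point fewer.\<close>

lemma fekete_bound:
  fixes M :: "nat \<Rightarrow> real"
  assumes q: "\<And>k. degree (q k) = k" "\<And>k. lead_coeff (q k) = 1" "\<And>k u. u \<in> E \<Longrightarrow> cmod (poly (q k) u) \<le> M k"
    and M: "\<And>k. M k \<ge> 0" and X: "finite X" "X \<subseteq> E" "card X = n"
  shows "vandermonde X \<le> (\<Prod>k<n. (real k + 1) * M k)"
  using X
proof (induction n arbitrary: X)
  case 0
  then show ?case by (simp add: vandermonde_def)
next
  case (Suc n)
  have v0: "vandermonde Y \<ge> 0" for Y unfolding vandermonde_def by (intro real_sqrt_ge_zero prod_nonneg) (auto intro: prod_nonneg)
  have "1 = (\<Sum>x\<in>X. poly (q n) x / (\<Prod>y\<in>X - {x}. x - y))"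
    using lagrange_leading_coeff[OF Suc.prems(1,3) q(1,2)] by simp
  then have "1 = cmod (\<Sum>x\<in>X. poly (q n) x / (\<Prod>y\<in>X - {x}. x - y))" by simp
  also have "\<dots> \<le> (\<Sum>x\<in>X. cmod (poly (q n) x / (\<Prod>y\<in>X - {x}. x - y)))" by (rule norm_sum)
  also have "\<dots> \<le> (\<Sum>x\<in>X. M n / (\<Prod>y\<in>X - {x}. cmod (x - y)))"
    unfolding norm_divide by (intro sum_mono) (use q(3) Suc.prems in \<open>auto simp: prod_norm intro!: divide_right_mono\<close>)
  finally have "vandermonde X * 1 \<le> vandermonde X * (\<Sum>x\<in>X. M n / (\<Prod>y\<in>X - {x}. cmod (x - y)))"
    using v0 by (intro mult_left_mono) auto
  also have "\<dots> = (\<Sum>x\<in>X. vandermonde (X - {x}) * M n)"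
    unfolding sum_distrib_left
  proof (rule sum.cong)
    fix x assume x: "x \<in> X"
    have "(\<Prod>y\<in>X - {x}. cmod (x - y)) \<noteq> 0" using Suc.prems(1) by auto
    then show "vandermonde X * (M n / (\<Prod>y\<in>X - {x}. cmod (x - y))) = vandermonde (X - {x}) * M n"
      using vandermonde_remove[OF Suc.prems(1) x] by simp
  qed simp
  also have "\<dots> \<le> (\<Sum>x\<in>X. (\<Prod>k<n. (real k + 1) * M k) * M n)"
    by (intro sum_mono mult_right_mono Suc.IH M) (use Suc.prems in auto)
  also have "\<dots> = (\<Prod>k<Suc n. (real k + 1) * M k)" using Suc.prems(3) by simp
  finally show ?case by simp
qed

text \<open>The kernel is shifted to be nonnegative on sets of diameter at most \<open>R\<close>.\<close>

definition log_kernel_pos :: "real \<Rightarrow> complex \<Rightarrow> complex \<Rightarrow> ennreal" where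
  "log_kernel_pos R z w = (if z = w then \<infinity> else ennreal (ln R - ln (cmod (z - w))))"

lemma borel_measurable_diagonal_if:
  assumes "f \<in> borel_measurable M" "g \<in> borel_measurable M" "h \<in> M \<rightarrow>\<^sub>M N" "k \<in> M \<rightarrow>\<^sub>M N"
  shows "(\<lambda>x. if f x = (g x :: complex) then h x else k x) \<in> M \<rightarrow>\<^sub>M N"
proof -
  have d: "(\<lambda>x. f x - g x) \<in> borel_measurable M" by (rule borel_measurable_diff[OF assms(1,2)])
  have "(\<lambda>x. f x - g x) -` {0} \<inter> space M \<in> sets M" by (rule measurable_sets[OF d]) simp
  also have "(\<lambda>x. f x - g x) -` {0} \<inter> space M = {x \<in> space M. f x = g x}" by auto
  finally show ?thesis by (rule measurable_If[OF assms(3,4)])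
qed

lemma log_kernel_pos_measurable [measurable]:
  assumes [measurable]: "f \<in> borel_measurable M" "g \<in> borel_measurable M"
  shows "(\<lambda>x. log_kernel_pos R (f x) (g x)) \<in> borel_measurable M"
  unfolding log_kernel_pos_def by (intro borel_measurable_diagonal_if; measurable)

lemma log_kernel_measurable [measurable]:
  assumes [measurable]: "f \<in> borel_measurable M" "g \<in> borel_measurable M"
  shows "(\<lambda>x. log_kernel (f x) (g x)) \<in> borel_measurable M"
  unfolding log_kernel_def by (intro borel_measurable_diagonal_if; measurable)

text \<open>The shift by \<open>ln R\<close> makes the energy a single nonnegative integral. The
  proof goes through the subtraction-free identity \<open>J + N = P + ln R\<close>, in which
  \<open>J\<close> and \<open>P\<close> may be infinite together while \<open>N\<close> is at most
  \<open>ln R\<close>.\<close>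

lemma log_energy_eq:
  assumes \<mu>: "\<mu> \<in> prob_measures_on E" and E: "E \<in> sets borel"
    and R: "R \<ge> 1" "\<And>z w. z \<in> E \<Longrightarrow> w \<in> E \<Longrightarrow> cmod (z - w) \<le> R"
  shows "log_energy \<mu> = enn2ereal (\<integral>\<^sup>+ (z, w). log_kernel_pos R z w \<partial>(\<mu> \<Otimes>\<^sub>M \<mu>)) - ereal (ln R)"
proof -
  from \<mu> have ps: "prob_space \<mu>" and st[measurable_cong]: "sets \<mu> = sets borel" and mE: "emeasure \<mu> E = 1"
    by (auto simp: prob_measures_on_def)
  interpret prob_space \<mu> by (rule ps)
  interpret P: pair_prob_space \<mu> \<mu> by unfold_locales
  have ps2: "prob_space (\<mu> \<Otimes>\<^sub>M \<mu>)" by unfold_locales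
  have AEE: "AE z in \<mu>. z \<in> E"
    using mE E by (subst AE_in_set_eq_1) (auto simp: measure_def st)
  have AE2: "AE p in \<mu> \<Otimes>\<^sub>M \<mu>. fst p \<in> E \<and> snd p \<in> E"
  proof -
    have "emeasure (\<mu> \<Otimes>\<^sub>M \<mu>) (E \<times> E) = 1"
      using mE E by (subst emeasure_pair_measure_Times) (auto simp: st)
    then have "AE p in \<mu> \<Otimes>\<^sub>M \<mu>. p \<in> E \<times> E"
      using E by (subst prob_space.AE_in_set_eq_1[OF ps2]) (auto simp: measure_def st)
    then show ?thesis by eventually_elim auto
  qed
  define J where "J = (\<integral>\<^sup>+ (z, w). log_kernel_pos R z w \<partial>(\<mu> \<Otimes>\<^sub>M \<mu>))"
  define P where "P = (\<integral>\<^sup>+ (z, w). e2ennreal (log_kernel z w) \<partial>(\<mu> \<Otimes>\<^sub>M \<mu>))"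
  define N where "N = (\<integral>\<^sup>+ (z, w). e2ennreal (- log_kernel z w) \<partial>(\<mu> \<Otimes>\<^sub>M \<mu>))"
  have lnR: "ln R \<ge> 0" using R(1) by simp
  have pt: "log_kernel_pos R z w + e2ennreal (- log_kernel z w) = e2ennreal (log_kernel z w) + ennreal (ln R)"
    and ptN: "e2ennreal (- log_kernel z w) \<le> ennreal (ln R)" if zw: "z \<in> E" "w \<in> E" for z w
  proof -
    have *: "log_kernel_pos R z w + e2ennreal (- log_kernel z w) = e2ennreal (log_kernel z w) + ennreal (ln R) \<and> e2ennreal (- log_kernel z w) \<le> ennreal (ln R)"
    proof (cases "z = w")
      case True
      then show ?thesis by (simp add: log_kernel_pos_def log_kernel_def e2ennreal_infty e2ennreal_neg)
    next
      case False
      define x where "x = ln (cmod (z - w))"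
      have k: "log_kernel z w = ereal (- x)" using False by (simp add: log_kernel_def x_def ln_div)
      have xR: "x \<le> ln R" unfolding x_def using False R(2)[OF zw] by (intro ln_mono) auto
      have kp: "log_kernel_pos R z w = ennreal (ln R - x)" using False by (simp add: log_kernel_pos_def x_def)
      show ?thesis
      proof (cases "x \<ge> 0")
        case True
        then have "e2ennreal (ereal (- x)) = 0" "e2ennreal (- ereal (- x)) = ennreal x"
          by (auto simp: e2ennreal_ereal ennreal_neg)
        then show ?thesis unfolding k kp using True xR by (simp add: ennreal_plus[symmetric] del: ennreal_plus)
      next
        case False
        then have "e2ennreal (ereal (- x)) = ennreal (- x)" "e2ennreal (- ereal (- x)) = 0"
          by (auto simp: e2ennreal_ereal ennreal_neg)
        then show ?thesis unfolding k kp using False lnR by (simp add: ennreal_plus[symmetric] del: ennreal_plus)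
      qed
    qed
    then show "log_kernel_pos R z w + e2ennreal (- log_kernel z w) = e2ennreal (log_kernel z w) + ennreal (ln R)"
      and "e2ennreal (- log_kernel z w) \<le> ennreal (ln R)" by auto
  qed
  have c1: "(\<integral>\<^sup>+ p. ennreal (ln R) \<partial>(\<mu> \<Otimes>\<^sub>M \<mu>)) = ennreal (ln R)"
    using prob_space.emeasure_space_1[OF ps2] by simp
  have "J + N = (\<integral>\<^sup>+ p. log_kernel_pos R (fst p) (snd p) + e2ennreal (- log_kernel (fst p) (snd p)) \<partial>(\<mu> \<Otimes>\<^sub>M \<mu>))"
    unfolding J_def N_def case_prod_beta by (rule nn_integral_add[symmetric]; measurable)
  also have "\<dots> = (\<integral>\<^sup>+ p. e2ennreal (log_kernel (fst p) (snd p)) + ennreal (ln R) \<partial>(\<mu> \<Otimes>\<^sub>M \<mu>))"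
    by (rule nn_integral_cong_AE, use AE2 in eventually_elim) (use pt in simp)
  also have "\<dots> = P + (\<integral>\<^sup>+ p. ennreal (ln R) \<partial>(\<mu> \<Otimes>\<^sub>M \<mu>))"
    unfolding P_def case_prod_beta by (rule nn_integral_add; measurable)
  also note c1
  finally have JN: "J + N = P + ennreal (ln R)" .
  have "N \<le> (\<integral>\<^sup>+ p. ennreal (ln R) \<partial>(\<mu> \<Otimes>\<^sub>M \<mu>))"
    unfolding N_def case_prod_beta by (rule nn_integral_mono_AE, use AE2 in eventually_elim) (use ptN in simp)
  then have Nle: "N \<le> ennreal (ln R)" by (simp only: c1)
  then obtain n where n: "N = ennreal n" "0 \<le> n" by (metis ennreal_cases ennreal_top_neq_one infinity_ennreal_def neq_top_trans ennreal_neq_top)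
  have le: "log_energy \<mu> = enn2ereal P - enn2ereal N" unfolding log_energy_def P_def N_def ..
  show ?thesis
  proof (cases P)
    case (real p)
    then have "J + N = ennreal (p + ln R)" using JN lnR by (simp add: ennreal_plus)
    then obtain j where j: "J = ennreal j" "0 \<le> j" by (metis ennreal_cases ennreal_add_eq_top ennreal_neq_top)
    have "j + n = p + ln R" using JN unfolding j n real using j n real lnR
      by (simp add: ennreal_plus[symmetric] del: ennreal_plus)
    then show ?thesis unfolding le J_def[symmetric] using j n real by (simp add: enn2ereal_ennreal)
  next
    case top
    then have "J = top" using JN n by (metis ennreal_add_eq_top ennreal_neq_top top_add)
    then show ?thesis unfolding le J_def[symmetric] n top using n by (simp add: enn2ereal_ennreal)
  qed
qed

lemma distr_PiM_pair:
  assumes "prob_space \<mu>" "i \<in> I" "j \<in> I" "i \<noteq> j"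
  shows "distr (PiM I (\<lambda>_. \<mu>)) (\<mu> \<Otimes>\<^sub>M \<mu>) (\<lambda>\<omega>. (\<omega> i, \<omega> j)) = \<mu> \<Otimes>\<^sub>M \<mu>"
proof -
  interpret \<mu>: prob_space \<mu> by fact
  interpret product_prob_space "\<lambda>_. \<mu>" I by unfold_locales
  have m: "(\<lambda>\<omega>. (\<omega> i, \<omega> j)) \<in> PiM I (\<lambda>_. \<mu>) \<rightarrow>\<^sub>M \<mu> \<Otimes>\<^sub>M \<mu>" using assms by measurable
  show ?thesis
  proof (rule pair_measure_eqI[symmetric])
    fix A B assume AB: "A \<in> sets \<mu>" "B \<in> sets \<mu>"
    have "emeasure (distr (PiM I (\<lambda>_. \<mu>)) (\<mu> \<Otimes>\<^sub>M \<mu>) (\<lambda>\<omega>. (\<omega> i, \<omega> j))) (A \<times> B) =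
        emeasure (PiM I (\<lambda>_. \<mu>)) {\<omega> \<in> space (PiM I (\<lambda>_. \<mu>)). \<forall>l\<in>{i, j}. \<omega> l \<in> (if l = i then A else B)}"
      using AB assms by (subst emeasure_distr[OF m]) (auto intro!: arg_cong[where f="emeasure _"])
    also have "\<dots> = (\<Prod>l\<in>{i, j}. emeasure \<mu> (if l = i then A else B))"
      by (rule emeasure_PiM_Collect) (use assms AB in auto)
    also have "\<dots> = emeasure \<mu> A * emeasure \<mu> B" using assms(4) by auto
    finally show "emeasure \<mu> A * emeasure \<mu> B = emeasure (distr (PiM I (\<lambda>_. \<mu>)) (\<mu> \<Otimes>\<^sub>M \<mu>) (\<lambda>\<omega>. (\<omega> i, \<omega> j))) (A \<times> B)" ..
  qed (auto intro: \<mu>.sigma_finite_measure_axioms)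
qed

text \<open>The Vandermonde estimate is averaged over \<open>n\<close> independent points with
  distribution \<open>\<mu>\<close>. Each ordered pair contributes the same double integral, so
  after division by \<open>n * (n - 1)\<close> only the rate \<open>L\<close> survives. No extremal
  point sets have to exist.\<close>

lemma energy_lower_bound:
  assumes \<mu>: "\<mu> \<in> prob_measures_on E" and E: "E \<in> sets borel"
    and R: "R \<ge> 1" "\<And>z w. z \<in> E \<Longrightarrow> w \<in> E \<Longrightarrow> cmod (z - w) \<le> R"
    and q: "\<And>k. degree (q k) = k" "\<And>k. lead_coeff (q k) = 1"
      "\<And>k u. u \<in> E \<Longrightarrow> cmod (poly (q k) u) \<le> C * exp (real k * L)" and C: "C > 0"
  shows "log_energy \<mu> \<ge> ereal (- L)"
proof -
  from \<mu> have ps: "prob_space \<mu>" and st[measurable_cong]: "sets \<mu> = sets borel" and mE: "emeasure \<mu> E = 1"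
    by (auto simp: prob_measures_on_def)
  interpret prob_space \<mu> by (rule ps)
  have AEE: "AE z in \<mu>. z \<in> E"
    using mE E by (subst AE_in_set_eq_1) (auto simp: measure_def st)
  define J where "J = (\<integral>\<^sup>+ (z, w). log_kernel_pos R z w \<partial>(\<mu> \<Otimes>\<^sub>M \<mu>))"
  \<comment> \<open>This is the pair sum that results when the Vandermonde product attains the bound
    of \<open>fekete_bound\<close>. The quadratic term carries the energy; the last sum is
    \<open>O(n * ln n)\<close>.\<close>
  define b where "b n = real n * (real n - 1) * (ln R - L) - 2 * (\<Sum>k<n. ln (real k + 1) + ln C)" for n :: nat
  define pairs where "pairs n = {(i, j). i < n \<and> j < n \<and> i \<noteq> (j::nat)}" for n
  have fp: "finite (pairs n)" for n
    by (rule finite_subset[of _ "{..<n} \<times> {..<n}"]) (auto simp: pairs_def)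
  have sigma: "pairs n = (SIGMA i:{..<n}. {..<n} - {i})" for n by (auto simp: pairs_def)
  have cp: "card (pairs n) = n * (n - 1)" for n
    unfolding sigma by (subst card_SigmaI) (auto simp: card_Diff_singleton)
  have pointwise: "ennreal (b n) \<le> (\<Sum>(i, j)\<in>pairs n. log_kernel_pos R (\<omega> i) (\<omega> j))"
    if \<omega>: "\<And>i. i < n \<Longrightarrow> \<omega> i \<in> E" for n \<omega>
  \<comment> \<open>Atoms of \<open>\<mu>\<close> make coinciding points possible; the kernel is
    infinite there and the bound is trivial.\<close>
  proof (cases "inj_on \<omega> {..<n}")
    case False
    then obtain i j where ij: "i < n" "j < n" "i \<noteq> j" "\<omega> i = \<omega> j" by (auto simp: inj_on_def)
    have "log_kernel_pos R (\<omega> i) (\<omega> j) \<le> (\<Sum>(i, j)\<in>pairs n. log_kernel_pos R (\<omega> i) (\<omega> j))"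
      using member_le_sum[of "(i, j)" "pairs n" "\<lambda>(i, j). log_kernel_pos R (\<omega> i) (\<omega> j)"] fp ij by (auto simp: pairs_def)
    then show ?thesis using ij by (simp add: log_kernel_pos_def top_unique)
  next
    case True
    define X where "X = \<omega> ` {..<n}"
    have X: "finite X" "X \<subseteq> E" "card X = n" using \<omega> card_image[OF True] by (auto simp: X_def)
    have ne: "\<omega> i \<noteq> \<omega> j" if "(i, j) \<in> pairs n" for i j
      using True that by (auto simp: pairs_def inj_on_def)
    have "(\<Prod>x\<in>X. \<Prod>y\<in>X - {x}. cmod (x - y)) = (\<Prod>i<n. \<Prod>y\<in>X - {\<omega> i}. cmod (\<omega> i - y))"
      unfolding X_def by (rule prod.reindex[OF True, simplified o_def])
    also have "\<dots> = (\<Prod>i<n. \<Prod>j\<in>{..<n} - {i}. cmod (\<omega> i - \<omega> j))"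
    proof (rule prod.cong)
      fix i assume i: "i \<in> {..<n}"
      have "X - {\<omega> i} = \<omega> ` ({..<n} - {i})" unfolding X_def using True i by (auto simp: inj_on_def)
      then show "(\<Prod>y\<in>X - {\<omega> i}. cmod (\<omega> i - y)) = (\<Prod>j\<in>{..<n} - {i}. cmod (\<omega> i - \<omega> j))"
        by (simp add: prod.reindex[OF inj_on_subset[OF True]])
    qed simp
    also have "\<dots> = (\<Prod>(i, j)\<in>pairs n. cmod (\<omega> i - \<omega> j))"
      unfolding sigma by (rule prod.Sigma) auto
    finally have V: "vandermonde X = sqrt (\<Prod>(i, j)\<in>pairs n. cmod (\<omega> i - \<omega> j))" by (simp add: vandermonde_def)
    have Ppos: "(\<Prod>(i, j)\<in>pairs n. cmod (\<omega> i - \<omega> j)) > 0"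
      by (rule prod_pos) (use ne in auto)
    have "vandermonde X \<le> (\<Prod>k<n. (real k + 1) * (C * exp (real k * L)))"
      by (rule fekete_bound[OF q _ X]) (use C in auto)
    moreover have "0 < vandermonde X" unfolding V using Ppos by simp
    ultimately have "ln (vandermonde X) \<le> ln (\<Prod>k<n. (real k + 1) * (C * exp (real k * L)))" by (intro ln_mono) auto
    also have "\<dots> = (\<Sum>k<n. ln ((real k + 1) * (C * exp (real k * L))))"
      by (rule ln_prod) (use C in auto)
    also have "\<dots> = (\<Sum>k<n. ln (real k + 1) + ln C) + (\<Sum>k<n. real k * L)"
      using C by (simp add: ln_mult sum.distrib add.assoc)
    also have "(\<Sum>k<n. real k * L) = real n * (real n - 1) / 2 * L"
    proof -
      have "(\<Sum>k<n. real k) = real n * (real n - 1) / 2" by (induction n) (auto simp: field_simps)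
      then show ?thesis by (simp add: sum_distrib_right[symmetric])
    qed
    finally have lnV: "2 * ln (vandermonde X) \<le> 2 * (\<Sum>k<n. ln (real k + 1) + ln C) + real n * (real n - 1) * L" by simp
    have "2 * ln (vandermonde X) = ln (\<Prod>(i, j)\<in>pairs n. cmod (\<omega> i - \<omega> j))"
      unfolding V using Ppos by (simp add: ln_sqrt)
    also have "\<dots> = (\<Sum>(i, j)\<in>pairs n. ln (cmod (\<omega> i - \<omega> j)))"
      unfolding case_prod_beta by (rule ln_prod) (use ne fp in auto)
    finally have S: "2 * ln (vandermonde X) = (\<Sum>(i, j)\<in>pairs n. ln (cmod (\<omega> i - \<omega> j)))" .
    have "(\<Sum>(i, j)\<in>pairs n. log_kernel_pos R (\<omega> i) (\<omega> j)) = (\<Sum>(i, j)\<in>pairs n. ennreal (ln R - ln (cmod (\<omega> i - \<omega> j))))"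
      by (rule sum.cong) (use ne in \<open>auto simp: log_kernel_pos_def\<close>)
    also have "\<dots> = ennreal (\<Sum>(i, j)\<in>pairs n. ln R - ln (cmod (\<omega> i - \<omega> j)))"
      unfolding case_prod_beta
    proof (rule sum_ennreal)
      fix p assume p: "p \<in> pairs n"
      then have "cmod (\<omega> (fst p) - \<omega> (snd p)) \<le> R" "\<omega> (fst p) \<noteq> \<omega> (snd p)"
        using R(2) \<omega> ne[of "fst p" "snd p"] by (auto simp: pairs_def)
      then show "0 \<le> ln R - ln (cmod (\<omega> (fst p) - \<omega> (snd p)))" by (simp add: ln_mono)
    qed
    also have "(\<Sum>(i, j)\<in>pairs n. ln R - ln (cmod (\<omega> i - \<omega> j))) = real (n * (n - 1)) * ln R - 2 * ln (vandermonde X)"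
      unfolding S case_prod_beta by (simp add: sum_subtractf cp)
    also have "real (n * (n - 1)) = real n * (real n - 1)" by (cases n) (auto simp: algebra_simps)
    finally have eq: "(\<Sum>(i, j)\<in>pairs n. log_kernel_pos R (\<omega> i) (\<omega> j)) = ennreal (real n * (real n - 1) * ln R - 2 * ln (vandermonde X))" .
    show ?thesis unfolding eq by (rule ennreal_leI) (use lnV in \<open>simp add: b_def algebra_simps\<close>)
  qed
  have int: "ennreal (b n) \<le> of_nat (n * (n - 1)) * J" for n
  proof -
    define PM where "PM = PiM {..<n} (\<lambda>_. \<mu>)"
    have psP: "prob_space PM" unfolding PM_def by (intro prob_space_PiM ps)
    have AEn: "AE \<omega> in PM. \<forall>i<n. \<omega> i \<in> E"
    proof -
      have "AE \<omega> in PM. \<forall>i\<in>{..<n}. \<omega> i \<in> E"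
        unfolding PM_def
      proof (rule AE_finite_allI)
        fix i assume "i \<in> {..<n}"
        then show "AE \<omega> in PiM {..<n} (\<lambda>_. \<mu>). \<omega> i \<in> E"
          using AE_PiM_component[of "{..<n}" "\<lambda>_. \<mu>" i "\<lambda>z. z \<in> E"] ps AEE by simp
      qed simp
      then show ?thesis by (auto simp: Ball_def)
    qed
    have meas: "(\<lambda>\<omega>. log_kernel_pos R (\<omega> (fst p)) (\<omega> (snd p))) \<in> borel_measurable PM" if "p \<in> pairs n" for p
    proof -
      have [measurable]: "fst p \<in> {..<n}" "snd p \<in> {..<n}" using that by (auto simp: pairs_def)
      show ?thesis unfolding PM_def by measurable
    qed
    have "ennreal (b n) = (\<integral>\<^sup>+ \<omega>. ennreal (b n) \<partial>PM)" using prob_space.emeasure_space_1[OF psP] by simp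
    also have "\<dots> \<le> (\<integral>\<^sup>+ \<omega>. (\<Sum>p\<in>pairs n. log_kernel_pos R (\<omega> (fst p)) (\<omega> (snd p))) \<partial>PM)"
    proof (rule nn_integral_mono_AE)
      show "AE \<omega> in PM. ennreal (b n) \<le> (\<Sum>p\<in>pairs n. log_kernel_pos R (\<omega> (fst p)) (\<omega> (snd p)))"
        using AEn
      proof eventually_elim
        case (elim \<omega>)
        then show ?case using pointwise[of n \<omega>] by (simp add: case_prod_beta)
      qed
    qed
    also have "\<dots> = (\<Sum>p\<in>pairs n. \<integral>\<^sup>+ \<omega>. log_kernel_pos R (\<omega> (fst p)) (\<omega> (snd p)) \<partial>PM)"
      by (rule nn_integral_sum) (rule meas)
    also have "\<dots> = (\<Sum>p\<in>pairs n. J)"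
    proof (rule sum.cong)
      fix p assume p: "p \<in> pairs n"
      obtain i j where ij: "p = (i, j)" "i \<in> {..<n}" "j \<in> {..<n}" "i \<noteq> j" using p by (auto simp: pairs_def)
      have m: "(\<lambda>\<omega>. (\<omega> i, \<omega> j)) \<in> PM \<rightarrow>\<^sub>M \<mu> \<Otimes>\<^sub>M \<mu>" unfolding PM_def using ij by measurable
      have "J = (\<integral>\<^sup>+ (z, w). log_kernel_pos R z w \<partial>(distr PM (\<mu> \<Otimes>\<^sub>M \<mu>) (\<lambda>\<omega>. (\<omega> i, \<omega> j))))"
        unfolding J_def PM_def distr_PiM_pair[OF ps ij(2-4)] ..
      also have "\<dots> = (\<integral>\<^sup>+ \<omega>. log_kernel_pos R (\<omega> i) (\<omega> j) \<partial>PM)"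
        by (subst nn_integral_distr[OF m]) (auto simp: case_prod_beta)
      finally show "(\<integral>\<^sup>+ \<omega>. log_kernel_pos R (\<omega> (fst p)) (\<omega> (snd p)) \<partial>PM) = J" using ij by simp
    qed simp
    also have "\<dots> = of_nat (n * (n - 1)) * J" by (simp add: cp)
    finally show ?thesis .
  qed
  have "ennreal (ln R - L) \<le> J"
  proof (cases J)
    case (real j)
    \<comment> \<open>Division by \<open>n * (n - 1)\<close> leaves an error of order
      \<open>ln n / n\<close>.\<close>
    have "ln R - L \<le> j + 2 * (ln (real n) + \<bar>ln C\<bar>) / (real n - 1)" if n: "n \<ge> 2" for n :: nat
    proof -
      have "ennreal (b n) \<le> ennreal (real (n * (n - 1)) * j)"
        using int[of n] real by (simp add: ennreal_mult ennreal_of_nat_eq_real_of_nat[symmetric])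
      moreover have "0 \<le> real (n * (n - 1)) * j" using real by simp
      ultimately have "b n \<le> real (n * (n - 1)) * j" by (subst (asm) ennreal_le_iff)
      moreover have e: "real (n * (n - 1)) = real n * (real n - 1)" using n by (simp add: of_nat_diff)
      ultimately have b: "b n \<le> real n * (real n - 1) * j" by (simp only: e)
      have "(\<Sum>k<n. ln (real k + 1) + ln C) \<le> (\<Sum>k<n. ln (real n) + \<bar>ln C\<bar>)"
        by (intro sum_mono add_mono ln_mono) auto
      then have "(\<Sum>k<n. ln (real k + 1) + ln C) \<le> real n * (ln (real n) + \<bar>ln C\<bar>)" by simp
      then have "real n * (real n - 1) * (ln R - L) \<le> real n * (real n - 1) * j + 2 * (real n * (ln (real n) + \<bar>ln C\<bar>))"
        using b unfolding b_def by linarith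
      also have "\<dots> = real n * (real n - 1) * (j + 2 * (ln (real n) + \<bar>ln C\<bar>) / (real n - 1))"
        using n by (simp add: field_simps)
      finally show ?thesis using n by (simp add: mult_le_cancel_left)
    qed
    moreover have "(\<lambda>n. j + 2 * (ln (real n) + \<bar>ln C\<bar>) / (real n - 1)) \<longlonglongrightarrow> j + 0"
      by (intro tendsto_add tendsto_const) real_asymp
    ultimately have "ln R - L \<le> j + 0"
      by (intro LIMSEQ_le_const) (auto intro!: exI[of _ 2])
    then show ?thesis using real by (simp add: ennreal_leI)
  qed simp
  then have "ereal (ln R - L) \<le> enn2ereal J"
    by (metis enn2ereal_ennreal enn2ereal_nonneg ennreal_neg less_eq_ennreal.rep_eq linorder_linear order_trans ereal_less_eq(3) zero_ereal_def linorder_not_le)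
  then have "ereal (ln R - L) - ereal (ln R) \<le> enn2ereal J - ereal (ln R)" by (rule ereal_minus_mono) simp
  moreover have "ereal (ln R - L) - ereal (ln R) = ereal (- L)" by simp
  ultimately show ?thesis using log_energy_eq[OF \<mu> E R] by (simp add: J_def)
qed

section \<open>Densities of the equilibrium measure on the two circles\<close>

text \<open>Hermitian symmetry makes the series real. It serves both for a circle density and for
  the logarithm of a distance, so that their product can be integrated by convolution.\<close>

lemma leval_hermitian:
  fixes a :: "nat \<Rightarrow> complex" and x :: real
  assumes a: "summable (\<lambda>n. norm (a n))" and a0: "a 0 = 0"
  defines "c \<equiv> (\<lambda>j::int. if j = 0 then of_real x else if j > 0 then a (nat j) else cnj (a (nat (- j))))"
  shows "lsummable 1 c" "leval c (cis \<theta>) = of_real (x + 2 * Re (\<Sum>n. a n * cis \<theta> ^ n))"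
proof -
  have an: "(\<lambda>n. norm (a n)) summable_on S" for S
    by (rule summable_on_subset_banach[OF norm_summable_imp_summable_on]) (use a in auto)
  have cn: "c (int n) = (if n = 0 then of_real x else a n)" "n \<ge> 1 \<Longrightarrow> c (- int n) = cnj (a n)" for n
    by (auto simp: c_def)
  show l: "lsummable 1 c"
    unfolding lsummable_def summable_on_int_iff
  proof
    have "(\<lambda>n. norm (a n)) summable_on {1..}" by (rule an)
    then show "(\<lambda>n. norm (c (- int n)) * 1 powi (- int n)) summable_on {1..}"
      by (rule summable_on_cong[THEN iffD1, rotated]) (simp add: cn(2))
    have "(\<lambda>n. norm (c (int n)) * 1 powi (int n)) summable_on {1..}"
      using an[of "{1..}"] by (rule summable_on_cong[THEN iffD1, rotated]) (simp add: cn(1))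
    then have "(\<lambda>n. norm (c (int n)) * 1 powi (int n)) summable_on insert 0 {1..}"
      by (simp add: summable_on_insert_iff)
    moreover have "insert 0 {1..} = (UNIV :: nat set)" by auto
    ultimately show "(\<lambda>n. norm (c (int n)) * 1 powi (int n)) summable_on UNIV" by simp
  qed
  define w where "w = cis \<theta>"
  have w: "cmod w = 1" by (simp add: w_def)
  have s0: "summable (\<lambda>n. norm (a n * w ^ n))" using a w by (simp add: norm_mult norm_power)
  define S where "S = (\<Sum>n. a n * w ^ n)"
  have hs: "((\<lambda>n. a n * w ^ n) has_sum S) UNIV"
    unfolding S_def by (rule norm_summable_imp_has_sum[OF s0 summable_sums[OF summable_norm_cancel[OF s0]]])
  have hs1: "((\<lambda>n. a n * w ^ n) has_sum S) {1..}"
    using hs by (rule has_sum_cong_neutral[THEN iffD1, rotated -1]) (use a0 in \<open>auto simp: not_le\<close>)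
  have i1: "(\<Sum>\<^sub>\<infinity>n\<in>{1::nat..}. c (- int n) * w powi (- int n)) = cnj S"
  proof -
    have zc: "inverse w = cnj w" unfolding w_def by (simp add: cis_cnj)
    have "((\<lambda>n. cnj (a n * w ^ n)) has_sum cnj S) {1..}" using hs1 by (simp only: has_sum_cnj_iff)
    then have "((\<lambda>n. c (- int n) * w powi (- int n)) has_sum cnj S) {1..}"
      by (rule has_sum_cong[THEN iffD1, rotated]) (simp add: cn(2) power_int_minus zc flip: power_inverse)
    then show ?thesis by (rule infsumI)
  qed
  have i2: "(\<Sum>\<^sub>\<infinity>n::nat. c (int n) * w powi (int n)) = of_real x + S"
  proof -
    have "((\<lambda>n. c (int n) * w powi (int n)) has_sum S) {1..}"
      using hs1 by (rule has_sum_cong[THEN iffD1, rotated]) (simp add: cn(1))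
    then have "((\<lambda>n. c (int n) * w powi (int n)) has_sum (c (int 0) * w powi (int 0) + S)) (insert 0 {1..})"
      by (intro has_sum_insert) auto
    moreover have "insert 0 {1..} = (UNIV :: nat set)" by auto
    ultimately have "((\<lambda>n. c (int n) * w powi (int n)) has_sum (c (int 0) * w powi (int 0) + S)) UNIV" by simp
    then have "(\<Sum>\<^sub>\<infinity>n::nat. c (int n) * w powi (int n)) = c (int 0) * w powi (int 0) + S" by (rule infsumI)
    then show ?thesis using cn(1)[of 0] by simp
  qed
  have "leval c w = (of_real x + S) + cnj S"
    unfolding leval_def using i1 i2
    by (subst infsum_int_split[OF abs_summable_summable[OF lsummableD[OF l w]]]) simp
  then show "leval c (cis \<theta>) = of_real (x + 2 * Re (\<Sum>n. a n * cis \<theta> ^ n))"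
    unfolding w_def[symmetric] S_def[symmetric] by (simp add: complex_eq_iff)
qed

definition HQ :: "real \<Rightarrow> real \<Rightarrow> complex \<Rightarrow> complex" where
  "HQ A B w = (\<Sum>n. of_real (rho A B n) * w ^ n)"

text \<open>Relative to \<open>d\<theta> / (2 * pi)\<close>, this is the equilibrium density on the
  circle of radius \<open>1 / A\<close>, and with \<open>A\<close> and \<open>B\<close> exchanged
  the one on the circle of radius \<open>B\<close>.\<close>

definition circle_density :: "real \<Rightarrow> real \<Rightarrow> real \<Rightarrow> real" where
  "circle_density A B \<theta> = rho0 A B + 2 * Re (HQ A B (cis \<theta>))"

context annulus
begin

lemma HQ_summable: "cmod w < A \<Longrightarrow> summable (\<lambda>n. norm (of_real (rho A B n) * w ^ n))"
proof (rule summable_comparison_test'[where N=0])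
  assume w: "cmod w < A"
  show "summable (\<lambda>n. (cmod w / A) ^ n)" using w A1 by (intro summable_geometric) auto
  fix n :: nat
  have "rho A B n * cmod w ^ n \<le> inverse A ^ n * cmod w ^ n" using rho_le[of n] by (rule mult_right_mono) simp
  also have "\<dots> = (cmod w / A) ^ n" by (simp add: power_divide power_inverse divide_inverse power_mult_distrib mult.commute)
  finally show "norm (norm (of_real (rho A B n) * w ^ n)) \<le> (cmod w / A) ^ n"
    using rho_nonneg[of n] by (simp add: norm_mult norm_power)
qed

lemma HQ_sums: "cmod w < A \<Longrightarrow> (\<lambda>n. of_real (rho A B n) * w ^ n) sums HQ A B w"
  unfolding HQ_def by (rule summable_sums[OF summable_norm_cancel[OF HQ_summable]])

lemma HQ_holomorphic: "HQ A B holomorphic_on ball 0 A"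
  by (rule power_series_holomorphic[where a="\<lambda>n. of_real (rho A B n)"]) (use HQ_sums in auto)

lemma HP_deriv:
  assumes "cmod w < A" "w \<noteq> 0"
  shows "(HP A B has_field_derivative HQ A B w / w) (at w)"
proof -
  obtain K where K: "cmod w < K" "K < A" using assms(1) dense by blast
  have "0 \<le> K" using K(1) norm_ge_zero[of w] by linarith
  then have K': "cmod (of_real K) < A" "cmod w < cmod (of_real K :: complex)" using K by simp_all
  let ?c = "\<lambda>n. complex_of_real (rho A B n / n)"
  have "DERIV (\<lambda>x. \<Sum>n. ?c n * x ^ n) w :> (\<Sum>n. diffs ?c n * w ^ n)"
    by (rule termdiffs_strong[OF sums_summable[OF HP_sums[OF K'(1)]] K'(2)])
  moreover have "(\<Sum>n. diffs ?c n * w ^ n) = HQ A B w / w"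
  proof -
    have d: "diffs ?c = (\<lambda>n. of_real (rho A B (Suc n)))" by (rule ext) (simp add: diffs_def del: of_nat_Suc)
    have "(\<lambda>n. of_real (rho A B (Suc n)) * w ^ Suc n) sums (HQ A B w - of_real (rho A B 0) * w ^ 0)"
      using HQ_sums[OF assms(1)] by (subst sums_Suc_iff) simp
    then have "(\<lambda>n. of_real (rho A B (Suc n)) * w ^ Suc n / w) sums (HQ A B w / w)"
      by (intro sums_divide) (simp add: rho_def)
    then show ?thesis unfolding d using assms(2) by (simp add: sums_iff)
  qed
  ultimately show ?thesis unfolding HP_def[abs_def] by simp
qed

lemma HQ_cnj: "HQ A B (cnj w) = cnj (HQ A B w)" if "cmod w < A"
proof -
  have "(\<lambda>n. cnj (of_real (rho A B n) * w ^ n)) sums cnj (HQ A B w)"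
    using HQ_sums[OF that] by (simp only: sums_cnj)
  then have "(\<lambda>n. of_real (rho A B n) * cnj w ^ n) sums cnj (HQ A B w)" by simp
  then show ?thesis unfolding HQ_def by (simp add: sums_iff)
qed

text \<open>The density is the normal derivative of the Green function, which is positive on the annulus
  and vanishes on its boundary.\<close>

lemma circle_density_nonneg: "circle_density A B \<theta> \<ge> 0"
proof -
  define w where "w = cis \<theta>"
  have w: "cmod w = 1" "w \<noteq> 0" by (auto simp: w_def)
  have wi: "1 / w = cnj w" by (simp add: w_def divide_inverse cis_cnj)
  \<comment> \<open>Green's function along a ray leaving the inner circle, in the logarithm of the
    radius and in the form of \<open>green_inner\<close>; its derivative at 0 is the
    density.\<close>
  define \<phi> where "\<phi> t = rho0 A B * t + Re (HP A B (exp (of_real t) * w) - HP A B (exp (- of_real t) * cnj w))" for t :: real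
  have c1: "cmod w < A" "cmod (cnj w) < A" using w A1 by auto
  have d1: "((\<lambda>t. HP A B (exp (of_real t) * w)) has_vector_derivative HQ A B w) (at 0)"
  proof -
    have "((\<lambda>s. HP A B (exp s * w)) has_field_derivative (HQ A B w / w * (exp 0 * w))) (at 0)"
      by (rule DERIV_chain2[where f="HP A B" and g="\<lambda>s. exp s * w"])
         (use HP_deriv[OF c1(1) w(2)] in \<open>auto intro!: derivative_eq_intros\<close>)
    then have "((\<lambda>s. HP A B (exp s * w)) has_field_derivative HQ A B w) (at (of_real 0))" using w(2) by simp
    from has_vector_derivative_real_field[OF this] show ?thesis by simp
  qed
  have d2: "((\<lambda>t. HP A B (exp (- of_real t) * cnj w)) has_vector_derivative (- HQ A B (cnj w))) (at 0)"
  proof -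
    have "((\<lambda>s. HP A B (exp (- s) * cnj w)) has_field_derivative (HQ A B (cnj w) / cnj w * (- cnj w))) (at 0)"
      by (rule DERIV_chain2[where f="HP A B" and g="\<lambda>s. exp (- s) * cnj w"])
         (use HP_deriv[OF c1(2)] w(2) in \<open>auto intro!: derivative_eq_intros\<close>)
    then have "((\<lambda>s. HP A B (exp (- s) * cnj w)) has_field_derivative (- HQ A B (cnj w))) (at (of_real 0))" using w(2) by simp
    from has_vector_derivative_real_field[OF this] show ?thesis by simp
  qed
  have "((\<lambda>t. Re (HP A B (exp (of_real t) * w) - HP A B (exp (- of_real t) * cnj w))) has_vector_derivative Re (HQ A B w - - HQ A B (cnj w))) (at 0)"
    by (rule bounded_linear.has_vector_derivative[OF bounded_linear_Re has_vector_derivative_diff[OF d1 d2]])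
  then have "((\<lambda>t. Re (HP A B (exp (of_real t) * w) - HP A B (exp (- of_real t) * cnj w))) has_real_derivative 2 * Re (HQ A B w)) (at 0)"
    unfolding has_real_derivative_iff_has_vector_derivative HQ_cnj[OF c1(1)] by simp
  from DERIV_add[OF DERIV_cmult_Id[of "rho0 A B"] this]
  have D: "(\<phi> has_real_derivative circle_density A B \<theta>) (at 0)"
    unfolding \<phi>_def circle_density_def w_def[symmetric] .
  have \<phi>0: "\<phi> 0 = 0" unfolding \<phi>_def using HP_cnj[OF c1(1)] by simp
  have pos: "\<phi> t \<ge> 0" if t: "0 < t" "t < ln A" for t
  proof -
    define z where "z = of_real (exp t / A) * w"
    have cz: "cmod z = exp t / A" using w A1 by (simp add: z_def norm_mult norm_divide)
    have "exp t < A" "1 < exp t" using t A1 by (auto simp: exp_less_cancel_iff[of t "ln A", symmetric])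
    then have r: "1 / A < cmod z" "cmod z < 1" unfolding cz using A1 by (auto simp: divide_strict_right_mono)
    then have "0 < green A B z" using B1 by (intro green_pos) auto
    also have "green A B z = rho0 A B * ln (A * cmod z) + Re (HP A B (of_real A * z) - HP A B (1 / (of_real A * z)))"
      by (rule green_inner) (use r sqrt_range in linarith)+
    also have "of_real A * z = exp (of_real t) * w" using A1 by (simp add: z_def exp_of_real)
    also have "1 / (exp (of_real t) * w) = exp (- of_real t) * cnj w" using wi by (simp add: exp_minus divide_inverse)
    also have "ln (A * cmod z) = t" unfolding cz using A1 by simp
    finally show ?thesis unfolding \<phi>_def by simp
  qed
  show ?thesis
  proof (rule ccontr)
    assume "\<not> ?thesis"
    then obtain d where d: "d > 0" "\<And>h. 0 < h \<Longrightarrow> h < d \<Longrightarrow> \<phi> (0 + h) < \<phi> 0"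
      using DERIV_neg_dec_right[OF D] by fastforce
    define h where "h = min (d / 2) (ln A / 2)"
    have "0 < h" "h < d" "h < ln A" using d(1) ln_pos unfolding h_def by auto
    then show False using d(2)[of h] pos[of h] \<phi>0 by simp
  qed
qed

definition density_coeffs :: "int \<Rightarrow> complex" where
  "density_coeffs = (\<lambda>j. if j = 0 then of_real (rho0 A B) else if j > 0 then of_real (rho A B (nat j)) else cnj (of_real (rho A B (nat (- j)))))"

lemma density_coeffs:
  "lsummable 1 density_coeffs" "leval density_coeffs (cis \<theta>) = of_real (circle_density A B \<theta>)"
proof -
  have "summable (\<lambda>n. norm (complex_of_real (rho A B n)))" using HQ_summable[of 1] A1 by simp
  then show "lsummable 1 density_coeffs" "leval density_coeffs (cis \<theta>) = of_real (circle_density A B \<theta>)"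
    unfolding density_coeffs_def circle_density_def HQ_def by (rule leval_hermitian; simp add: rho_def)+
qed

text \<open>Only the coefficient at 0 of the product survives integration. The logarithm has mean 0
  since \<open>cmod \<zeta> < 1\<close>, so the mass \<open>rho0 A B\<close> contributes nothing and
  the other frequencies pair up to \<open>HP A B \<zeta>\<close> and its conjugate.\<close>

lemma density_log_integral:
  assumes \<zeta>: "cmod \<zeta> < 1"
  shows "((\<lambda>\<theta>. circle_density A B \<theta> * ln (cmod (1 - \<zeta> * cis \<theta>))) has_integral (- (2 * pi * Re (HP A B \<zeta>)))) {t..t + 2 * pi}"
proof -
  \<comment> \<open>The 2 anticipates the doubling of the real part in
    \<open>leval_hermitian\<close>; division by zero gives the required
    \<open>a 0 = 0\<close>.\<close>
  define a where "a n = - (\<zeta> ^ n / (2 * of_nat n))" for n :: nat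
  define c where "c \<equiv> (\<lambda>j::int. if j = 0 then of_real 0 else if j > 0 then a (nat j) else cnj (a (nat (- j))))"
  let ?d = density_coeffs
  have as: "summable (\<lambda>n. norm (a n))"
  proof (rule summable_comparison_test'[where N=0 and g="\<lambda>n. cmod \<zeta> ^ n"])
    show "summable (\<lambda>n. cmod \<zeta> ^ n)" using \<zeta> by (intro summable_geometric) auto
    show "norm (norm (a n)) \<le> cmod \<zeta> ^ n" for n
      by (cases "n = 0") (auto simp: a_def norm_divide norm_power norm_mult divide_le_eq mult_le_cancel_left1)
  qed
  have C: "lsummable 1 c" "leval c (cis \<theta>) = of_real (0 + 2 * Re (\<Sum>n. a n * cis \<theta> ^ n))" for \<theta>
    unfolding c_def by (rule leval_hermitian[OF as], simp add: a_def)+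
  have lc: "leval c (cis \<theta>) = of_real (ln (cmod (1 - \<zeta> * cis \<theta>)))" for \<theta>
  proof -
    have n1: "cmod (- (\<zeta> * cis \<theta>)) < 1" using \<zeta> by (simp add: norm_mult)
    have "(\<lambda>n. - ((- (- (\<zeta> * cis \<theta>))) ^ n) / of_nat n) sums ln (1 + - (\<zeta> * cis \<theta>))" by (rule Ln_series'[OF n1])
    then have "(\<lambda>n. (1 / 2) * (- ((- (- (\<zeta> * cis \<theta>))) ^ n) / of_nat n)) sums ((1 / 2) * ln (1 + - (\<zeta> * cis \<theta>)))" by (rule sums_mult)
    moreover have "(1 / 2) * (- ((- (- (\<zeta> * cis \<theta>))) ^ n) / of_nat n) = a n * cis \<theta> ^ n" for n
      by (simp add: a_def power_mult_distrib)
    ultimately have "(\<Sum>n. a n * cis \<theta> ^ n) = (1 / 2) * ln (1 + - (\<zeta> * cis \<theta>))" by (simp add: sums_iff)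
    then have "Re (\<Sum>n. a n * cis \<theta> ^ n) = Re ((1 / 2) * ln (1 + - (\<zeta> * cis \<theta>)))" by (rule arg_cong)
    also have "\<dots> = ln (cmod (1 - \<zeta> * cis \<theta>)) / 2"
    proof -
      have "1 - \<zeta> * cis \<theta> \<noteq> 0" using n1 by auto
      then show ?thesis by simp
    qed
    finally have "0 + 2 * Re (\<Sum>n. a n * cis \<theta> ^ n) = ln (cmod (1 - \<zeta> * cis \<theta>))" by simp
    then show ?thesis unfolding C(2) by (simp only:)
  qed
  have L: "leval (lconv c ?d) (cis \<theta>) = of_real (circle_density A B \<theta> * ln (cmod (1 - \<zeta> * cis \<theta>)))" for \<theta>
    using leval_lconv[OF C(1) density_coeffs(1), of "cis \<theta>"] by (simp add: lc density_coeffs(2) mult.commute)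
  have l0: "lconv c ?d 0 = of_real (- Re (HP A B \<zeta>))"
  proof -
    have s: "(\<lambda>i. c i * ?d (0 - i)) summable_on UNIV" by (rule abs_summable_summable[OF lconv_summable[OF C(1) density_coeffs(1) zero_less_one]])
    have zA: "cmod \<zeta> < A" using \<zeta> A1 by linarith
    define v where "v n = complex_of_real (rho A B n / n) * \<zeta> ^ n" for n :: nat
    have vs: "(v has_sum HP A B \<zeta>) UNIV"
      unfolding v_def by (rule norm_summable_imp_has_sum[OF HP_summable[OF zA] HP_sums[OF zA]])
    have v1: "(v has_sum HP A B \<zeta>) {1..}"
      using vs by (rule has_sum_cong_neutral[THEN iffD1, rotated -1]) (auto simp: not_le v_def)
    have e1: "c (int n) * ?d (0 - int n) = - (1 / 2) * v n" for n
      by (cases "n = 0") (auto simp: c_def density_coeffs_def a_def v_def)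
    have e2: "c (- int n) * ?d (0 - - int n) = - (1 / 2) * cnj (v n)" if "n \<ge> 1" for n
      using that by (auto simp: c_def density_coeffs_def a_def v_def)
    have "lconv c ?d 0 = (\<Sum>\<^sub>\<infinity>n::nat. c (int n) * ?d (0 - int n)) + (\<Sum>\<^sub>\<infinity>n\<in>{1::nat..}. c (- int n) * ?d (0 - - int n))"
      unfolding lconv_def by (rule infsum_int_split[OF s])
    also have "(\<Sum>\<^sub>\<infinity>n::nat. c (int n) * ?d (0 - int n)) = - (1 / 2) * HP A B \<zeta>"
      unfolding e1 by (rule infsumI[OF has_sum_cmult_right[OF vs]])
    also have "(\<Sum>\<^sub>\<infinity>n\<in>{1::nat..}. c (- int n) * ?d (0 - - int n)) = (\<Sum>\<^sub>\<infinity>n\<in>{1::nat..}. - (1 / 2) * cnj (v n))"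
      by (rule infsum_cong) (use e2 in simp)
    also have "\<dots> = - (1 / 2) * cnj (HP A B \<zeta>)"
      by (rule infsumI[OF has_sum_cmult_right]) (use v1 in \<open>simp only: has_sum_cnj_iff\<close>)
    finally show ?thesis by (simp add: complex_eq_iff)
  qed
  have "((\<lambda>\<theta>. leval (lconv c ?d) (cis \<theta>)) has_integral (2 * pi * lconv c ?d 0)) {t..t + 2 * pi}"
    by (rule has_integral_leval[OF lsummable_lconv[OF C(1) density_coeffs(1) zero_less_one]])
  then have "((\<lambda>\<theta>. Re (leval (lconv c ?d) (cis \<theta>))) has_integral Re (2 * pi * lconv c ?d 0)) {t..t + 2 * pi}"
    by (rule has_integral_Re)
  then show ?thesis unfolding L l0 by simp
qed

lemma density_integral:
  "(circle_density A B has_integral (2 * pi * rho0 A B)) {t..t + 2 * pi}"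
  using has_integral_Re[OF has_integral_leval[OF density_coeffs(1)], of t]
  by (simp add: density_coeffs(2)) (simp add: density_coeffs_def)

lemma density_continuous: "continuous_on UNIV (circle_density A B)"
proof -
  have "continuous_on UNIV (HQ A B \<circ> cis)"
    by (rule continuous_on_compose[OF _ continuous_on_subset[OF holomorphic_on_imp_continuous_on[OF HQ_holomorphic]]])
       (use A1 in \<open>auto intro!: continuous_intros\<close>)
  then show ?thesis unfolding circle_density_def[abs_def] o_def by (intro continuous_intros)
qed

end

section \<open>Potential and energy of the equilibrium measure\<close>

text \<open>The parameter that brings the distance from \<open>z\<close> to a point of the circle
  into the form \<open>max r (cmod z) * cmod (1 - \<zeta> * cis \<theta>)\<close> on either side of
  the circle. Inside, a conjugate appears because the natural factor contains
  \<open>cis (- \<theta>)\<close>.\<close>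

definition circle_param :: "real \<Rightarrow> complex \<Rightarrow> complex" where
  "circle_param r z = (if cmod z < r then cnj z / of_real r else of_real r / z)"

lemma circle_param_norm: "r > 0 \<Longrightarrow> cmod z \<noteq> r \<Longrightarrow> cmod (circle_param r z) < 1"
  by (auto simp: circle_param_def norm_divide divide_less_eq)

lemma ln_cmod_diff_circle:
  assumes r: "r > 0" "cmod z \<noteq> r"
  shows "ln (cmod (z - of_real r * cis \<theta>)) = ln (max r (cmod z)) + ln (cmod (1 - circle_param r z * cis \<theta>))"
proof -
  have "cmod (circle_param r z * cis \<theta>) < 1" using circle_param_norm[OF r] by (simp add: norm_mult)
  then have nz: "1 - circle_param r z * cis \<theta> \<noteq> 0" by auto
  have "cmod (z - of_real r * cis \<theta>) = max r (cmod z) * cmod (1 - circle_param r z * cis \<theta>)"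
  proof (cases "cmod z < r")
    case True
    have "z - of_real r * cis \<theta> = - (of_real r * cis \<theta>) * (1 - z / of_real r * cis (- \<theta>))"
      using r by (simp add: algebra_simps cis_mult)
    then have "cmod (z - of_real r * cis \<theta>) = cmod (- (of_real r * cis \<theta>)) * cmod (1 - z / of_real r * cis (- \<theta>))"
      by (metis norm_mult)
    also have "cmod (- (of_real r * cis \<theta>)) = r" using r by (simp add: norm_mult)
    also have "1 - z / of_real r * cis (- \<theta>) = cnj (1 - circle_param r z * cis \<theta>)"
      using True by (simp add: circle_param_def cis_cnj)
    finally show ?thesis using True by (simp only: complex_mod_cnj max_absorb1 less_imp_le)
  next
    case False
    then have z0: "z \<noteq> 0" using r by auto
    then have "z - of_real r * cis \<theta> = z * (1 - circle_param r z * cis \<theta>)"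
      using False by (simp add: circle_param_def field_simps)
    then show ?thesis using False by (simp add: norm_mult max_def)
  qed
  moreover have "max r (cmod z) > 0" using r by (simp add: less_max_iff_disj)
  ultimately show ?thesis using nz by (simp add: ln_mult)
qed

definition mobius :: "complex \<Rightarrow> complex" where "mobius z = z / (1 - z)"

text \<open>Distances factor under the change of coordinates, so logarithmic potentials in
  \<open>u\<close> are those in \<open>z\<close> corrected by logarithms of
  \<open>1 - z\<close>.\<close>

lemma mobius_diff: "z \<noteq> 1 \<Longrightarrow> y \<noteq> 1 \<Longrightarrow> mobius z - mobius y = (z - y) / ((1 - z) * (1 - y))"
  unfolding mobius_def by (simp add: field_simps)

lemma ln_mobius_diff:
  assumes "z \<noteq> 1" "y \<noteq> 1" "z \<noteq> y"
  shows "ln (cmod (mobius z - mobius y)) = ln (cmod (z - y)) - ln (cmod (1 - z)) - ln (cmod (1 - y))"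
  using assms by (simp add: mobius_diff norm_divide norm_mult ln_div ln_mult)

context annulus
begin

lemma mobius_disk1: assumes "cmod z \<le> 1 / A" shows "mobius z \<in> disk1 A"
proof -
  have z: "1 - z \<noteq> 0" using assms A1 by (auto simp: divide_less_eq)
  then have "1 + mobius z = 1 / (1 - z)" by (simp add: mobius_def field_simps)
  moreover have "A * cmod z \<le> 1" using assms A1 by (simp add: field_simps)
  then have "A * cmod (mobius z) \<le> 1 / cmod (1 - z)"
    unfolding mobius_def norm_divide using z by (simp add: field_simps)
  ultimately show ?thesis unfolding mem_disk1_iff[OF A1] by (simp add: norm_divide)
qed

lemma mobius_disk2: assumes "B \<le> cmod z" shows "mobius z \<in> disk2 B"
proof -
  have z: "1 - z \<noteq> 0" using assms B1 by auto
  then have "1 + mobius z = 1 / (1 - z)" by (simp add: mobius_def field_simps)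
  moreover have "B * (1 / cmod (1 - z)) \<le> cmod (mobius z)"
    unfolding mobius_def norm_divide using z assms by (simp add: field_simps)
  ultimately show ?thesis unfolding mem_disk2_iff[OF B1] by (simp add: norm_divide)
qed

text \<open>Both circles are run through by one real parameter, so the equilibrium measure is the
  image of a single density on the line. Outside \<open>{0..4 * pi}\<close> the curve still stays in
  the disks, although the density is 0.\<close>

definition curve :: "real \<Rightarrow> complex" where
  "curve \<theta> = mobius (of_real (if \<theta> \<le> 2 * pi then 1 / A else B) * cis \<theta>)"

definition curve_density :: "real \<Rightarrow> real" where
  "curve_density \<theta> = (if \<theta> \<in> {0..2 * pi} then circle_density A B \<theta> / (2 * pi)
     else if \<theta> \<in> {2 * pi..4 * pi} then circle_density B A \<theta> / (2 * pi) else 0)"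

lemma curve_density_nonneg: "curve_density \<theta> \<ge> 0"
  unfolding curve_density_def using circle_density_nonneg annulus.circle_density_nonneg[OF sym] by auto

lemma curve_density_integral:
  assumes "((\<lambda>\<theta>. circle_density A B \<theta> * f \<theta>) has_integral (2 * pi * I)) {0..2 * pi}"
    and "((\<lambda>\<theta>. circle_density B A \<theta> * g \<theta>) has_integral (2 * pi * J)) {2 * pi..4 * pi}"
    and h: "\<And>\<theta>. h \<theta> = (if \<theta> \<le> 2 * pi then f \<theta> else g \<theta>)"
  shows "((\<lambda>\<theta>. curve_density \<theta> * h \<theta>) has_integral (I + J)) UNIV"
proof -
  have 1: "((\<lambda>\<theta>. curve_density \<theta> * h \<theta>) has_integral I) {0..2 * pi}"
    by (rule has_integral_eq[OF _ has_integral_divide[OF assms(1), of "2 * pi", simplified]])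
       (auto simp: curve_density_def h)
  have 2: "((\<lambda>\<theta>. curve_density \<theta> * h \<theta>) has_integral J) {2 * pi..4 * pi}"
    \<comment> \<open>The two intervals share the point \<open>2 * pi\<close>, where
      \<open>curve_density\<close> takes the value belonging to the first circle.\<close>
    by (rule has_integral_spike_finite[of "{2 * pi}", OF _ _ has_integral_divide[OF assms(2), of "2 * pi", simplified]])
       (auto simp: curve_density_def h)
  have 3: "((\<lambda>\<theta>. curve_density \<theta> * h \<theta>) has_integral (I + J)) {0..4 * pi}"
    by (rule has_integral_combine[OF _ _ 1 2]) auto
  have "((\<lambda>\<theta>. if \<theta> \<in> {0..4 * pi} then curve_density \<theta> * h \<theta> else 0) has_integral (I + J)) UNIV"
    using 3 by (simp only: has_integral_restrict_UNIV)
  then show ?thesis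
    by (rule has_integral_eq[rotated]) (auto simp: curve_density_def)
qed

lemma circle_split: "{2 * pi..2 * pi + 2 * pi} = {2 * pi..4 * pi}" "{0..0 + 2 * pi} = {0..2 * pi}"
  by auto

text \<open>The correction \<open>ln (cmod (1 - y))\<close> at a point \<open>y\<close> of the
  circle is itself a distance to the circle, namely from 1. Hence
  \<open>density_log_integral\<close> is applied at both \<open>z\<close> and 1.\<close>

lemma circle_potential:
  assumes r: "r > 0" "r \<noteq> 1" and z: "cmod z \<noteq> r" "z \<noteq> 1"
  shows "((\<lambda>\<theta>. circle_density A B \<theta> * ln (cmod (mobius z - mobius (of_real r * cis \<theta>)))) has_integral
    (2 * pi * (rho0 A B * (ln (max r (cmod z)) - ln (cmod (1 - z)) - ln (max r 1))
      - Re (HP A B (circle_param r z)) + Re (HP A B (circle_param r 1))))) {t..t + 2 * pi}"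
proof -
  let ?k = "ln (max r (cmod z)) - ln (cmod (1 - z)) - ln (max r 1)"
  let ?l = "\<lambda>z \<theta>. ln (cmod (1 - circle_param r z * cis \<theta>))"
  have eq: "ln (cmod (mobius z - mobius (of_real r * cis \<theta>))) = ?k + ?l z \<theta> - ?l 1 \<theta>" for \<theta>
  proof -
    have "of_real r * cis \<theta> \<noteq> 1" "z \<noteq> of_real r * cis \<theta>"
      using r z(1) by (metis norm_cis norm_mult norm_of_real norm_one mult.right_neutral abs_of_pos)+
    then show ?thesis
      using ln_mobius_diff[OF z(2), of "of_real r * cis \<theta>"] ln_cmod_diff_circle[OF r(1) z(1)]
        ln_cmod_diff_circle[of r 1 \<theta>] r by simp
  qed
  have "((\<lambda>\<theta>. circle_density A B \<theta> * ?k + circle_density A B \<theta> * ?l z \<theta> - circle_density A B \<theta> * ?l 1 \<theta>) has_integral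
      (2 * pi * rho0 A B * ?k + - (2 * pi * Re (HP A B (circle_param r z))) - - (2 * pi * Re (HP A B (circle_param r 1))))) {t..t + 2 * pi}"
    using r z by (intro has_integral_diff has_integral_add has_integral_mult_left density_integral density_log_integral circle_param_norm) auto
  then show ?thesis unfolding eq by (simp add: algebra_simps)
qed

text \<open>In the coordinate \<open>z\<close> the two circle potentials add up to
  \<open>ln (cmod (1 - z))\<close> by \<open>HP_identity\<close>; since the total mass is 1, the
  change of coordinates subtracts exactly this. The contributions from the point 1 remain and form
  \<open>robin A B\<close>.\<close>

lemma potential_integral:
  assumes z: "cmod z < 1 / A \<or> B < cmod z"
  shows "((\<lambda>\<theta>. curve_density \<theta> * ln (cmod (mobius z - curve \<theta>))) has_integral robin A B) UNIV"
proof -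
  have z1: "z \<noteq> 1" "cmod z \<noteq> 1 / A" "cmod z \<noteq> B" using z circle_range by auto
  define m where "m = ln (cmod (1 - z))"
  define k1 k2 where "k1 = ln (max (1 / A) (cmod z))" and "k2 = ln (max B (cmod z))"
  define \<zeta>1 \<zeta>2 where "\<zeta>1 = circle_param (1 / A) z" and "\<zeta>2 = circle_param B z"
  have one: "circle_param (1 / A) 1 = 1 / of_real A" "circle_param B 1 = 1 / of_real B" "ln (max (1 / A) 1) = 0" "max B 1 = B"
    using circle_range by (auto simp: circle_param_def max_def)
  have r: "0 < 1 / A" "1 / A \<noteq> 1" "0 < B" "B \<noteq> 1" using circle_range A1 by auto
  note i1 = circle_potential[OF r(1,2) z1(2,1), of 0, folded m_def k1_def \<zeta>1_def, unfolded one circle_split]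
  note i2 = annulus.circle_potential[OF sym r(3,4) z1(3,1), of "2 * pi", folded m_def k2_def \<zeta>2_def, unfolded one circle_split]
  have "ln (cmod (mobius z - curve \<theta>)) = (if \<theta> \<le> 2 * pi then ln (cmod (mobius z - mobius (of_real (1 / A) * cis \<theta>)))
      else ln (cmod (mobius z - mobius (of_real B * cis \<theta>))))" for \<theta>
    by (simp add: curve_def)
  note I = curve_density_integral[OF i1 i2 this]
  have "rho0 A B * k1 - Re (HP A B \<zeta>1) + (rho0 B A * k2 - Re (HP B A \<zeta>2)) = m"
  proof (cases "cmod z < 1 / A")
    case True
    then have zs: "cmod z < 1" "cmod z < B" using circle_range by linarith+
    then have zA: "cmod (of_real A * z) < A" using A1 by (simp add: norm_mult)
    have "cmod z / B < 1" using zs B1 by (simp add: divide_less_eq)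
    then have zB: "cmod (z / of_real B) < B" using B1 by (simp add: norm_divide del: divide_less_eq_1_pos)
    have "\<zeta>1 = cnj (of_real A * z)" "\<zeta>2 = cnj (z / of_real B)" "k1 = - ln A" "k2 = ln B"
      using True zs A1 by (auto simp: \<zeta>1_def \<zeta>2_def k1_def k2_def circle_param_def max_def ln_div)
    moreover have "Re (HP A B (of_real A * z)) + Re (HP B A (z / of_real B)) = - m"
      using arg_cong[OF HP_identity[OF zs(1)], of Re] z1(1) by (simp add: m_def)
    ultimately show ?thesis using HP_cnj[OF zA] annulus.HP_cnj[OF sym zB] rho0_eq by simp
  next
    case False
    then have zs: "B < cmod z" "\<not> cmod z < B" "z \<noteq> 0" using z B1 by auto
    then have i1: "cmod (1 / z) < 1" using B1 by (simp add: norm_divide)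
    have e: "\<zeta>1 = 1 / z / of_real A" "\<zeta>2 = of_real B * (1 / z)" "k1 = ln (cmod z)" "k2 = ln (cmod z)"
      using False zs by (auto simp: \<zeta>1_def \<zeta>2_def k1_def k2_def circle_param_def max_def mult.commute)
    have "Re (HP B A \<zeta>2) + Re (HP A B \<zeta>1) = - Re (ln (1 - 1 / z))"
      using arg_cong[OF annulus.HP_identity[OF sym i1], of Re] unfolding e by (simp only: plus_complex.sel uminus_complex.sel)
    also have "Re (ln (1 - 1 / z)) = ln (cmod (1 - 1 / z))" using z1 zs by simp
    also have "cmod (1 - 1 / z) = cmod (1 - z) / cmod z"
      using zs by (simp add: norm_divide[symmetric] diff_divide_distrib norm_minus_commute)
    also have "ln (cmod (1 - z) / cmod z) = m - ln (cmod z)" using zs z1 by (simp add: m_def ln_div)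
    finally have "Re (HP B A \<zeta>2) + Re (HP A B \<zeta>1) = ln (cmod z) - m" by simp
    moreover have "rho0 A B * ln (cmod z) + rho0 B A * ln (cmod z) = ln (cmod z)"
      using rho0_sum by (simp flip: distrib_right)
    ultimately show ?thesis by (simp add: e)
  qed
  then have "(rho0 A B * (k1 - m - 0) - Re (HP A B \<zeta>1) + Re (HP A B (1 / of_real A))) +
       (rho0 B A * (k2 - m - ln B) - Re (HP B A \<zeta>2) + Re (HP B A (1 / of_real B))) =
       m - (rho0 A B + rho0 B A) * m + robin A B"
    unfolding robin_def LL_def by (simp add: algebra_simps)
  with I show ?thesis by (simp add: rho0_sum)
qed

lemma curve_density_total: "(curve_density has_integral 1) UNIV"
proof -
  have "((\<lambda>\<theta>. curve_density \<theta> * 1) has_integral (rho0 A B + rho0 B A)) UNIV"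
    by (rule curve_density_integral[where f="\<lambda>_. 1" and g="\<lambda>_. 1"])
       (use density_integral[of 0] annulus.density_integral[OF sym, of "2 * pi"] in auto)
  then show ?thesis by (simp add: rho0_sum)
qed

lemma curve_density_measurable [measurable]: "curve_density \<in> borel_measurable borel"
proof -
  have [measurable]: "circle_density A B \<in> borel_measurable borel" "circle_density B A \<in> borel_measurable borel"
    using density_continuous annulus.density_continuous[OF sym] by (auto intro: borel_measurable_continuous_onI)
  show ?thesis unfolding curve_density_def[abs_def] by measurable
qed

lemma curve_measurable [measurable]: "curve \<in> borel_measurable borel"
proof -
  have [measurable]: "cis \<in> borel_measurable borel" by (intro borel_measurable_continuous_onI continuous_intros)
  show ?thesis unfolding curve_def[abs_def] mobius_def[abs_def] by measurable
qed

lemma curve_in: "curve \<theta> \<in> disk1 A \<union> disk2 B"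
  unfolding curve_def using mobius_disk1[of "of_real (1 / A) * cis \<theta>"] mobius_disk2[of "of_real B * cis \<theta>"] A1 B1
  by (auto simp: norm_divide norm_mult)

definition eq_measure :: "complex measure" where
  "eq_measure = distr (density lborel (\<lambda>\<theta>. ennreal (curve_density \<theta>))) borel curve"

lemma nn_integral_eq_measure:
  assumes [measurable]: "f \<in> borel_measurable borel"
  shows "(\<integral>\<^sup>+ z. f z \<partial>eq_measure) = (\<integral>\<^sup>+ \<theta>. ennreal (curve_density \<theta>) * f (curve \<theta>) \<partial>lborel)"
  unfolding eq_measure_def by (simp add: nn_integral_distr nn_integral_density)

lemma eq_measure_prob: "eq_measure \<in> prob_measures_on (disk1 A \<union> disk2 B)"
proof -
  have t: "(\<integral>\<^sup>+ \<theta>. ennreal (curve_density \<theta>) \<partial>lborel) = ennreal 1"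
    by (rule nn_integral_has_integral_lborel) (use curve_density_nonneg curve_density_total in auto)
  have E: "disk1 A \<union> disk2 B \<in> sets borel" unfolding disk1_def disk2_def by auto
  have "emeasure eq_measure X = 1" if "X \<in> sets borel" "disk1 A \<union> disk2 B \<subseteq> X" for X
  proof -
    have "curve -` X = UNIV" using curve_in that by auto
    then show ?thesis unfolding eq_measure_def using that t by (simp add: emeasure_distr emeasure_density)
  qed
  from this[OF E] this[of UNIV] show ?thesis
    unfolding prob_measures_on_def by (auto simp: eq_measure_def intro!: prob_spaceI)
qed

text \<open>Lower semicontinuity is the part of continuity needed for Fatou's lemma, and it persists
  on the diagonal, where the kernel is infinite.\<close>

lemma log_kernel_pos_lsc:
  assumes "zs \<longlonglongrightarrow> z"
  shows "log_kernel_pos R z w \<le> liminf (\<lambda>n. log_kernel_pos R (zs n) w)"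
proof (cases "z = w")
  case False
  have d: "(\<lambda>n. cmod (zs n - w)) \<longlonglongrightarrow> cmod (z - w)" by (intro tendsto_intros assms)
  have "eventually (\<lambda>n. zs n \<noteq> w) sequentially" using assms False by (intro tendsto_imp_eventually_ne)
  then have "eventually (\<lambda>n. ennreal (ln R - ln (cmod (zs n - w))) = log_kernel_pos R (zs n) w) sequentially"
    by eventually_elim (simp add: log_kernel_pos_def)
  moreover have "(\<lambda>n. ennreal (ln R - ln (cmod (zs n - w)))) \<longlonglongrightarrow> ennreal (ln R - ln (cmod (z - w)))"
    using False by (intro tendsto_ennrealI tendsto_intros d) auto
  ultimately have "(\<lambda>n. log_kernel_pos R (zs n) w) \<longlonglongrightarrow> log_kernel_pos R z w"
    using False by (subst (asm) tendsto_cong) (auto simp: log_kernel_pos_def)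
  then show ?thesis by (simp add: lim_imp_Liminf)
next
  case True
  show ?thesis unfolding le_Liminf_iff
  proof (intro allI impI)
    fix y assume "y < log_kernel_pos R z w"
    then obtain K where K: "y = ennreal K" "K \<ge> 0" by (cases y) (auto simp: top_unique)
    \<comment> \<open>Within this distance of \<open>w\<close> the kernel exceeds
      \<open>K + 1\<close>.\<close>
    define \<epsilon> where "\<epsilon> = exp (ln R - K - 1)"
    have "eventually (\<lambda>n. dist (zs n) w < \<epsilon>) sequentially" using assms True by (auto simp: tendsto_iff \<epsilon>_def)
    then show "eventually (\<lambda>n. y < log_kernel_pos R (zs n) w) sequentially"
    proof eventually_elim
      case (elim n)
      show ?case
      proof (cases "zs n = w")
        case False
        then have "ln (cmod (zs n - w)) < ln \<epsilon>" using elim by (intro ln_less_cancel_iff[THEN iffD2]) (auto simp: dist_norm \<epsilon>_def)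
        then have "K < ln R - ln (cmod (zs n - w))" by (simp add: \<epsilon>_def)
        then show ?thesis using False K by (simp add: log_kernel_pos_def ennreal_lessI)
      qed (simp add: log_kernel_pos_def K)
    qed
  qed
qed

lemma disks_diameter:
  "\<exists>R\<ge>1. \<forall>z\<in>disk1 A \<union> disk2 B. \<forall>w\<in>disk1 A \<union> disk2 B. cmod (z - w) \<le> R"
proof -
  let ?E = "disk1 A \<union> disk2 B"
  have "bounded ?E" unfolding disk1_def disk2_def by auto
  then obtain R0 where R0: "\<And>z. z \<in> ?E \<Longrightarrow> cmod z \<le> R0" by (auto simp: bounded_iff)
  have "cmod (z - w) \<le> max 1 (2 * R0)" if "z \<in> ?E" "w \<in> ?E" for z w
    using R0[OF that(1)] R0[OF that(2)] norm_triangle_ineq4[of z w] by linarith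
  then show ?thesis by (intro exI[of _ "max 1 (2 * R0)"]) auto
qed

text \<open>The potential is computed at interior points only, where no logarithmic singularity occurs; Fatou's lemma
  gives the inequality on the boundary that is needed.\<close>

lemma eq_measure_energy: "log_energy eq_measure \<le> ereal (- robin A B)"
proof -
  let ?E = "disk1 A \<union> disk2 B"
  obtain R where R: "R \<ge> 1" "\<And>z w. z \<in> ?E \<Longrightarrow> w \<in> ?E \<Longrightarrow> cmod (z - w) \<le> R"
    using disks_diameter by blast
  have E: "?E \<in> sets borel" unfolding disk1_def disk2_def by auto
  define h where "h z = (\<integral>\<^sup>+ w. log_kernel_pos R z w \<partial>eq_measure)" for z
  have h_eq: "h z = (\<integral>\<^sup>+ \<theta>. ennreal (curve_density \<theta>) * log_kernel_pos R z (curve \<theta>) \<partial>lborel)" for z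
    unfolding h_def by (rule nn_integral_eq_measure) measurable
  have inside: "h (mobius z) = ennreal (ln R - robin A B)" if z: "cmod z < 1 / A \<or> B < cmod z" for z
  proof -
    have zE: "mobius z \<in> ?E" using z mobius_disk1[of z] mobius_disk2[of z] by auto
    have z1: "z \<noteq> 1" using z circle_range by auto
    have ne: "mobius z \<noteq> curve \<theta>" for \<theta>
    proof
      assume eq: "mobius z = curve \<theta>"
      define y where "y = of_real (if \<theta> \<le> 2 * pi then 1 / A else B) * cis \<theta>"
      have y: "cmod y = 1 / A \<or> cmod y = B" using A1 B1 by (auto simp: y_def norm_divide norm_mult)
      then have y1: "y \<noteq> 1" using circle_range by auto
      have "mobius z = mobius y" using eq by (simp add: curve_def y_def)
      then have "z = y" using mobius_diff[OF z1 y1] z1 y1 by simp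
      then show False using y z circle_range by auto
    qed
    have nonneg: "0 \<le> ln R - ln (cmod (mobius z - curve \<theta>))" for \<theta>
      using ne[of \<theta>] R(2)[OF zE curve_in[of \<theta>]] by (simp add: ln_mono)
    have "((\<lambda>\<theta>. curve_density \<theta> * ln R - curve_density \<theta> * ln (cmod (mobius z - curve \<theta>))) has_integral (1 * ln R - robin A B)) UNIV"
      by (intro has_integral_diff has_integral_mult_left curve_density_total potential_integral z)
    then have hi: "((\<lambda>\<theta>. curve_density \<theta> * (ln R - ln (cmod (mobius z - curve \<theta>)))) has_integral (ln R - robin A B)) UNIV"
      by (simp add: right_diff_distrib)
    have "h (mobius z) = (\<integral>\<^sup>+ \<theta>. ennreal (curve_density \<theta> * (ln R - ln (cmod (mobius z - curve \<theta>)))) \<partial>lborel)"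
      unfolding h_eq by (rule nn_integral_cong) (use ne nonneg curve_density_nonneg in \<open>simp add: log_kernel_pos_def ennreal_mult\<close>)
    also have "\<dots> = ennreal (ln R - robin A B)"
      by (rule nn_integral_has_integral_lborel[OF _ _ hi]) (use nonneg curve_density_nonneg in auto)
    finally show ?thesis .
  qed
  have boundary: "h (curve \<theta>) \<le> ennreal (ln R - robin A B)" for \<theta>
  proof -
    \<comment> \<open>A boundary point is approached radially from inside its disk; the 2 keeps
      \<open>r 0\<close> positive.\<close>
    define r where "r n = 1 - 1 / (real n + 2)" for n :: nat
    have r: "0 < r n" "r n < 1" for n by (auto simp: r_def divide_less_eq)
    have rl: "r \<longlonglongrightarrow> 1" unfolding r_def by real_asymp
    define \<rho> where "\<rho> n = (if \<theta> \<le> 2 * pi then r n / A else B / r n)" for n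
    define y where "y n = of_real (\<rho> n) * cis \<theta>" for n
    have yin: "cmod (y n) < 1 / A \<or> B < cmod (y n)" for n
      using r[of n] A1 B1 by (auto simp: y_def \<rho>_def norm_divide norm_mult divide_strict_right_mono less_divide_eq)
    have lim: "(\<lambda>n. mobius (y n)) \<longlonglongrightarrow> curve \<theta>"
    proof -
      define \<rho>' where "\<rho>' = (if \<theta> \<le> 2 * pi then 1 / A else B)"
      have "\<rho> \<longlonglongrightarrow> \<rho>'"
        using tendsto_divide[OF rl tendsto_const[of A]] tendsto_divide[OF tendsto_const[of B] rl] A1 by (simp add: \<rho>_def[abs_def] \<rho>'_def)
      moreover have "1 - of_real \<rho>' * cis \<theta> \<noteq> 0"
      proof
        assume "1 - of_real \<rho>' * cis \<theta> = 0"
        then have "cmod (of_real \<rho>' * cis \<theta>) = 1" by simp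
        then show False using circle_range A1 by (auto simp: norm_mult \<rho>'_def split: if_splits)
      qed
      ultimately have "(\<lambda>n. mobius (y n)) \<longlonglongrightarrow> mobius (of_real \<rho>' * cis \<theta>)"
        unfolding mobius_def y_def by (intro tendsto_intros)
      then show ?thesis by (simp add: curve_def \<rho>'_def)
    qed
    have "h (curve \<theta>) \<le> (\<integral>\<^sup>+ w. liminf (\<lambda>n. log_kernel_pos R (mobius (y n)) w) \<partial>eq_measure)"
      unfolding h_def by (intro nn_integral_mono log_kernel_pos_lsc lim)
    also have "\<dots> \<le> liminf (\<lambda>n. h (mobius (y n)))"
      unfolding h_def by (rule nn_integral_liminf) (simp add: eq_measure_def)
    also have "\<dots> = ennreal (ln R - robin A B)" using inside[OF yin] by (simp add: Liminf_const)
    finally show ?thesis .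
  qed
  \<comment> \<open>\<open>ennreal\<close> truncates negative reals to 0, so nonnegativity is
    required before the bound can be read back as an extended real.\<close>
  have pos: "0 \<le> ln R - robin A B"
  proof -
    have z: "cmod 0 < 1 / A \<or> B < cmod 0" using A1 by simp
    have zE: "mobius 0 \<in> ?E" using mobius_disk1[of 0] A1 by simp
    have "((\<lambda>\<theta>. curve_density \<theta> * ln R - curve_density \<theta> * ln (cmod (mobius 0 - curve \<theta>))) has_integral (1 * ln R - robin A B)) UNIV"
      by (intro has_integral_diff has_integral_mult_left curve_density_total potential_integral z)
    moreover have "0 \<le> curve_density \<theta> * ln R - curve_density \<theta> * ln (cmod (mobius 0 - curve \<theta>))" for \<theta>
    proof -
      have "ln (cmod (mobius 0 - curve \<theta>)) \<le> ln R"
        using R(1) R(2)[OF zE curve_in[of \<theta>]] by (cases "mobius 0 = curve \<theta>") (auto intro: ln_mono)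
      then show ?thesis using curve_density_nonneg[of \<theta>] by (simp add: mult_left_mono)
    qed
    ultimately have "0 \<le> 1 * ln R - robin A B" by (rule has_integral_nonneg) 
    then show ?thesis by simp
  qed
  interpret prob_space eq_measure using eq_measure_prob by (simp add: prob_measures_on_def)
  have st[measurable_cong]: "sets eq_measure = sets borel" by (simp add: eq_measure_def)
  have "(\<integral>\<^sup>+ (z, w). log_kernel_pos R z w \<partial>(eq_measure \<Otimes>\<^sub>M eq_measure)) = (\<integral>\<^sup>+ z. h z \<partial>eq_measure)"
    unfolding h_def case_prod_beta by (subst nn_integral_fst[symmetric]) (simp_all, measurable)
  also have "\<dots> \<le> (\<integral>\<^sup>+ z. ennreal (ln R - robin A B) \<partial>eq_measure)"
  proof (rule nn_integral_mono_AE)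
    show "AE z in eq_measure. h z \<le> ennreal (ln R - robin A B)"
    proof -
      have "h \<in> borel_measurable borel"
      proof -
        have "(\<lambda>z. \<integral>\<^sup>+ w. log_kernel_pos R z w \<partial>eq_measure) \<in> borel_measurable borel" by measurable
        then show ?thesis unfolding h_def[abs_def] .
      qed
      then have [measurable]: "h \<in> borel_measurable borel" .
      show ?thesis unfolding eq_measure_def
        by (subst AE_distr_iff) (use boundary in auto)
    qed
  qed
  also have "\<dots> = ennreal (ln R - robin A B)" using emeasure_space_1 by simp
  finally have J: "enn2ereal (\<integral>\<^sup>+ (z, w). log_kernel_pos R z w \<partial>(eq_measure \<Otimes>\<^sub>M eq_measure)) \<le> ereal (ln R - robin A B)"
    using pos by (simp add: less_eq_ennreal.rep_eq enn2ereal_ennreal)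
  have "log_energy eq_measure = enn2ereal (\<integral>\<^sup>+ (z, w). log_kernel_pos R z w \<partial>(eq_measure \<Otimes>\<^sub>M eq_measure)) - ereal (ln R)"
    by (rule log_energy_eq[OF eq_measure_prob E R])
  also have "\<dots> \<le> ereal (ln R - robin A B) - ereal (ln R)" by (rule ereal_minus_mono[OF J]) simp
  finally show ?thesis by simp
qed

section \<open>The value of the capacity\<close>

text \<open>The constant \<open>C\<close> depends on \<open>\<eta>\<close>, but
  \<open>energy_lower_bound\<close> has eliminated it before \<open>\<eta>\<close> tends to
  0.\<close>

lemma min_log_energy_eq: "min_log_energy (disk1 A \<union> disk2 B) = ereal (- robin A B)"
proof (rule antisym)
  let ?E = "disk1 A \<union> disk2 B"
  show "min_log_energy ?E \<le> ereal (- robin A B)"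
    unfolding min_log_energy_def by (rule INF_lower2[OF eq_measure_prob]) (rule eq_measure_energy)
  obtain R where R: "R \<ge> 1" "\<And>z w. z \<in> ?E \<Longrightarrow> w \<in> ?E \<Longrightarrow> cmod (z - w) \<le> R"
    using disks_diameter by blast
  have E: "?E \<in> sets borel" unfolding disk1_def disk2_def by auto
  show "ereal (- robin A B) \<le> min_log_energy ?E"
    unfolding min_log_energy_def
  proof (rule INF_greatest)
    fix \<mu> assume \<mu>: "\<mu> \<in> prob_measures_on ?E"
    show "ereal (- robin A B) \<le> log_energy \<mu>"
    proof (rule ereal_le_epsilon2)
      fix \<eta> :: real assume "\<eta> > 0"
      then obtain C where C: "C > 0" "\<forall>k. \<exists>q::complex poly. degree q = k \<and> lead_coeff q = 1 \<and>
        (\<forall>u\<in>?E. cmod (poly q u) \<le> C * exp (real k * (robin A B + \<eta>)))"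
        using monic_poly_bound by blast
      then obtain q :: "nat \<Rightarrow> complex poly" where q: "\<And>k. degree (q k) = k" "\<And>k. lead_coeff (q k) = 1"
        "\<And>k u. u \<in> ?E \<Longrightarrow> cmod (poly (q k) u) \<le> C * exp (real k * (robin A B + \<eta>))" by metis
      have "ereal (- (robin A B + \<eta>)) \<le> log_energy \<mu>" by (rule energy_lower_bound[OF \<mu> E R q C(1)])
      then have "ereal (- (robin A B + \<eta>)) + ereal \<eta> \<le> log_energy \<mu> + ereal \<eta>" by (rule add_right_mono)
      then show "ereal (- robin A B) \<le> log_energy \<mu> + ereal \<eta>" by simp
    qed
  qed
qed

lemma gamma_eq_1_iff: "gamma_AB A B = 1 \<longleftrightarrow> robin A B = 0"
  unfolding gamma_AB_def log_capacity_def min_log_energy_eq by simp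

end

section \<open>Pigeonhole argument for a unitriangular lattice\<close>

lemma pigeonhole_multiple:
  assumes "finite A" "finite B" "f ` A \<subseteq> B" "m * card B < card A"
  shows "\<exists>y\<in>B. m < card {x \<in> A. f x = y}"
proof (rule ccontr)
  assume "\<not> ?thesis"
  then have le: "card {x \<in> A. f x = y} \<le> m" if "y \<in> B" for y using that by (auto simp: not_less)
  have "A = (\<Union>y\<in>B. {x \<in> A. f x = y})" using assms(3) by auto
  then have "card A = card (\<Union>y\<in>B. {x \<in> A. f x = y})" by simp
  also have "\<dots> \<le> (\<Sum>y\<in>B. card {x \<in> A. f x = y})" by (rule card_UN_le[OF assms(2)])
  also have "\<dots> \<le> (\<Sum>y\<in>B. m)" by (rule sum_mono) (rule le)
  finally show False using assms(4) by (simp add: mult.commute)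
qed

text \<open>One term of the series for \<open>exp N\<close>, together with
  \<open>exp 1 \<le> 3\<close>.\<close>

lemma fact_lower_bound: "real N ^ N \<le> 3 ^ N * fact N"
proof -
  have s: "(\<lambda>n. real N ^ n / fact n) sums exp (real N)"
    using exp_converges[of "real N"] by (simp add: divide_inverse mult.commute)
  have "(\<Sum>n\<in>{N}. real N ^ n / fact n) \<le> (\<Sum>n. real N ^ n / fact n)"
    by (rule sum_le_suminf[OF sums_summable[OF s]]) auto
  then have "real N ^ N / fact N \<le> exp (real N)" using s by (simp add: sums_iff)
  also have "exp (real N) = exp 1 ^ N" by (simp add: exp_of_nat_mult[symmetric])
  also have "\<dots> \<le> 3 ^ N" by (intro power_mono exp_le) auto
  finally show ?thesis by (simp add: divide_le_eq)
qed

text \<open>Blichfeldt's argument for the lattice of integer vectors in the coordinates \<open>x k\<close>, which are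
  unitriangular in the integer coordinates. The sizes of the boxes are chosen such that the product of
  the sides beats \<open>2 ^ N\<close> although the weighted sum of their squares stays bounded.\<close>

lemma many_small_lattice_points:
  fixes t :: "nat \<Rightarrow> nat \<Rightarrow> real" and \<tau> :: "nat \<Rightarrow> real"
  assumes t: "\<And>j. t j j = 1"
    and \<tau>: "\<And>k. 0 \<le> \<tau> k" "\<And>k. \<tau> k \<le> D / (real k + 1)"
  defines "x \<equiv> (\<lambda>N a k. \<Sum>j\<in>{k..<N}. real_of_int (a j) * t j k)"
  shows "\<exists>N S. finite S \<and> m < card S \<and> (\<forall>a\<in>S. (\<forall>k\<ge>N. a k = 0) \<and> (\<Sum>k<N. (x N a k)\<^sup>2 * \<tau> k) \<le> 48 * D)"
proof -
  \<comment> \<open>What matters is \<open>m < 2 ^ N\<close>, since \<open>2 ^ N\<close> is the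
    surplus left by the volume count.\<close>
  define N where "N = Suc m"
  \<comment> \<open>Side of the cube that gets filled with lattice points. It has to dominate every
    \<open>l k\<close>, and \<open>sqrt 48 < 7\<close>.\<close>
  define M where "M = (7::nat)"
  have N0: "real N > 0" by (simp add: N_def)
  \<comment> \<open>Growth like \<open>sqrt (k + 1)\<close> makes every coordinate contribute at
    most \<open>48 * D / N\<close>. As \<open>48 = 16 * 3\<close>, the product of the sides is at
    least \<open>4 ^ N\<close> by \<open>fact_lower_bound\<close>.\<close>
  define l where "l k = sqrt (48 * (real k + 1) / real N)" for k
  have l0: "l k > 0" for k using N0 by (simp add: l_def)
  have l7: "l k \<le> 7" if "k < N" for k
  proof -
    have "48 * (real k + 1) / real N \<le> 48" using that N0 by (simp add: divide_le_eq)
    then have "l k \<le> sqrt 49" unfolding l_def by (intro real_sqrt_le_mono) simp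
    then show ?thesis by simp
  qed
  \<comment> \<open>Number of slabs in direction \<open>k\<close>. Rounding up at most doubles it,
    so of the factor \<open>4 ^ N\<close> a factor \<open>2 ^ N\<close> is lost.\<close>
  define c where "c k = nat \<lceil>real M / l k\<rceil>" for k
  have c: "real M / l k \<le> real (c k)" "real (c k) \<le> 2 * real M / l k" "0 < c k" if "k < N" for k
  proof -
    have 1: "1 \<le> real M / l k" using l7[OF that] l0[of k] by (simp add: M_def)
    then show "real M / l k \<le> real (c k)" "0 < c k" unfolding c_def by linarith+
    have "real (c k) \<le> real M / l k + 1" using 1 unfolding c_def by linarith
    also have "\<dots> \<le> 2 * real M / l k" using 1 by simp
    finally show "real (c k) \<le> 2 * real M / l k" .
  qed
  have prod_l: "4 ^ N \<le> (\<Prod>k<N. l k)"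
  proof -
    have "(\<Prod>k<N. 48 * (real k + 1) / real N) = 48 ^ N * fact N / real N ^ N"
    proof -
      have "(\<Prod>k<N. real k + 1) = fact N" by (induction N) (auto simp: algebra_simps)
      moreover have "(\<Prod>k<N. 48 * (real k + 1) / real N) = (\<Prod>k<N. 48) * (\<Prod>k<N. real k + 1) / (\<Prod>k<N. real N)"
        by (simp only: prod_dividef prod.distrib)
      ultimately show ?thesis by (simp only: prod_constant card_lessThan)
    qed
    moreover have "16 ^ N \<le> 48 ^ N * fact N / real N ^ N"
    proof -
      have "16 ^ N * real N ^ N \<le> 16 ^ N * (3 ^ N * fact N)" using fact_lower_bound by (intro mult_left_mono) auto
      also have "\<dots> = 48 ^ N * fact N" by (simp flip: power_mult_distrib mult.assoc)
      finally show ?thesis using N0 by (simp add: le_divide_eq)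
    qed
    ultimately have "sqrt (16 ^ N) \<le> sqrt (\<Prod>k<N. 48 * (real k + 1) / real N)" by simp
    also have "sqrt (\<Prod>k<N. 48 * (real k + 1) / real N) = (\<Prod>k<N. l k)" unfolding l_def
    proof -
      have "sqrt (\<Prod>k<n. g k) = (\<Prod>k<n. sqrt (g k))" for n and g :: "nat \<Rightarrow> real"
        by (induction n) (simp_all add: real_sqrt_mult)
      then show "sqrt (\<Prod>k<N. 48 * (real k + 1) / real N) = (\<Prod>k<N. sqrt (48 * (real k + 1) / real N))" .
    qed
    also have "sqrt (16 ^ N) = 4 ^ N" by (simp add: real_sqrt_power)
    finally show ?thesis .
  qed
  define Dg where "Dg = ({..<N} \<rightarrow>\<^sub>E {..<M})"
  have cD: "finite Dg" "card Dg = M ^ N" unfolding Dg_def by (auto simp: finite_PiE card_PiE)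
  \<comment> \<open>\<open>x N a k\<close> involves only the entries \<open>a j\<close> with
    \<open>j \<ge> k\<close>, and \<open>a k\<close> with coefficient 1, so integer parts can be
    prescribed from the top index downwards. Hence the cube contains \<open>M ^ N\<close> lattice
    points.\<close>
  have ex: "\<exists>a::nat \<Rightarrow> int. (\<forall>k\<ge>N. a k = 0) \<and> (\<forall>k<N. \<lfloor>x N a k\<rfloor> = int (d k))" for d :: "nat \<Rightarrow> nat"
  proof -
    have "\<exists>a::nat \<Rightarrow> int. (\<forall>k\<ge>N. a k = 0) \<and> (\<forall>k<N. N - i \<le> k \<longrightarrow> \<lfloor>x N a k\<rfloor> = int (d k))" if "i \<le> N" for i
      using that
    proof (induction i)
      case 0
      show ?case by (intro exI[of _ "\<lambda>_. 0"]) auto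
    next
      case (Suc i)
      then obtain a :: "nat \<Rightarrow> int" where a: "\<forall>k\<ge>N. a k = 0" "\<forall>k<N. N - i \<le> k \<longrightarrow> \<lfloor>x N a k\<rfloor> = int (d k)" by auto
      define p where "p = N - Suc i"
      have p: "p < N" "Suc p = N - i" using Suc.prems by (auto simp: p_def)
      define s where "s = (\<Sum>j\<in>{Suc p..<N}. real_of_int (a j) * t j p)"
      define a' where "a' = a(p := int (d p) - \<lfloor>s\<rfloor>)"
      have keep: "x N a' k = x N a k" if "k > p" for k
        unfolding x_def a'_def using that by (intro sum.cong) auto
      have "x N a' p = real_of_int (a' p) * t p p + (\<Sum>j\<in>{Suc p..<N}. real_of_int (a' j) * t j p)"
        unfolding x_def by (rule sum.atLeast_Suc_lessThan[OF p(1)])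
      also have "(\<Sum>j\<in>{Suc p..<N}. real_of_int (a' j) * t j p) = s"
        unfolding s_def a'_def by (intro sum.cong) auto
      also have "a' p = int (d p) - \<lfloor>s\<rfloor>" by (simp add: a'_def)
      finally have xp: "x N a' p = real_of_int (int (d p) - \<lfloor>s\<rfloor>) + s" by (simp only: t mult_1_right)
      have fp: "\<lfloor>x N a' p\<rfloor> = int (d p)" unfolding xp by simp
      have "\<lfloor>x N a' k\<rfloor> = int (d k)" if "k < N" "N - Suc i \<le> k" for k
      proof (cases "k = p")
        case False
        then have "p < k" using that by (simp add: p_def)
        then show ?thesis using keep[of k] a(2) that p by auto
      qed (simp add: fp)
      moreover have "\<forall>k\<ge>N. a' k = 0" using a(1) p by (auto simp: a'_def)
      ultimately show ?case by blast
    qed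
    from this[of N] show ?thesis by simp
  qed
  define a where "a d = (SOME a::nat \<Rightarrow> int. (\<forall>k\<ge>N. a k = 0) \<and> (\<forall>k<N. \<lfloor>x N a k\<rfloor> = int (d k)))" for d
  have a: "\<And>k. k \<ge> N \<Longrightarrow> a d k = 0" "\<And>k. k < N \<Longrightarrow> \<lfloor>x N (a d) k\<rfloor> = int (d k)" for d
    using someI_ex[OF ex[of d], folded a_def] by auto
  have inj: "inj_on a Dg"
  proof (rule inj_onI)
    fix d d' assume dd: "d \<in> Dg" "d' \<in> Dg" "a d = a d'"
    have "d k = d' k" if "k < N" for k using a(2)[OF that, of d] a(2)[OF that, of d'] dd(3) by simp
    then show "d = d'" using dd(1,2) unfolding Dg_def by (intro PiE_ext) auto
  qed
  have xr: "0 \<le> x N (a d) k" "x N (a d) k < real M" if "d \<in> Dg" "k < N" for d k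
  proof -
    have "d k < M" using that by (auto simp: Dg_def PiE_def Pi_def)
    then show "0 \<le> x N (a d) k" "x N (a d) k < real M" using a(2)[OF that(2), of d] by linarith+
  qed
  define cell where "cell d = (\<lambda>k\<in>{..<N}. nat \<lfloor>x N (a d) k * real (c k) / real M\<rfloor>)" for d
  have M0: "real M > 0" by (simp add: M_def)
  have cellr: "cell ` Dg \<subseteq> (\<Pi>\<^sub>E k\<in>{..<N}. {..<c k})"
  proof clarify
    fix d assume d: "d \<in> Dg"
    have "nat \<lfloor>x N (a d) k * real (c k) / real M\<rfloor> < c k" if k: "k < N" for k
    proof -
      have "x N (a d) k * real (c k) / real M < real (c k)"
        using xr[OF d k] c(3)[OF k] M0 by (simp add: divide_less_eq mult.commute)
      moreover have "0 \<le> x N (a d) k * real (c k) / real M" using xr[OF d k] by simp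
      ultimately show ?thesis by linarith
    qed
    then show "cell d \<in> (\<Pi>\<^sub>E k\<in>{..<N}. {..<c k})" by (auto simp: cell_def)
  qed
  have cC: "finite (\<Pi>\<^sub>E k\<in>{..<N}. {..<c k})" "card (\<Pi>\<^sub>E k\<in>{..<N}. {..<c k}) = (\<Prod>k<N. c k)"
    by (auto simp: finite_PiE card_PiE)
  have "m * card (\<Pi>\<^sub>E k\<in>{..<N}. {..<c k}) < card Dg"
  proof -
    have pl: "(\<Prod>k<N. l k) > 0" using l0 by (intro prod_pos) auto
    have "real (\<Prod>k<N. c k) \<le> (\<Prod>k<N. 2 * real M / l k)"
      unfolding of_nat_prod by (intro prod_mono) (use c in auto)
    also have "\<dots> = 2 ^ N * real M ^ N / (\<Prod>k<N. l k)" by (simp add: prod_dividef power_mult_distrib)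
    also have "\<dots> \<le> 2 ^ N * real M ^ N / 4 ^ N" using prod_l pl by (intro divide_left_mono) auto
    also have "\<dots> = real M ^ N / 2 ^ N"
    proof -
      have "(4::real) ^ N = 2 ^ N * 2 ^ N" by (simp flip: power_mult_distrib)
      then show ?thesis by simp
    qed
    finally have "real m * real (\<Prod>k<N. c k) \<le> real m * (real M ^ N / 2 ^ N)" by (intro mult_left_mono) auto
    also have "\<dots> < 2 ^ N * (real M ^ N / 2 ^ N)"
    proof (rule mult_strict_right_mono)
      have "m < 2 ^ m" by (rule less_exp)
      also have "(2::nat) ^ m \<le> 2 ^ N" by (simp add: N_def)
      finally have "m < 2 ^ N" .
      then have "real m < real (2 ^ N)" by (simp only: of_nat_less_iff)
      then show "real m < 2 ^ N" by simp
    qed (use M0 in simp)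
    also have "\<dots> = real (M ^ N)" by simp
    finally show ?thesis unfolding cC(2) cD(2) by (simp only: of_nat_mult[symmetric] of_nat_less_iff)
  qed
  then obtain y where y: "m < card {d \<in> Dg. cell d = y}"
    using pigeonhole_multiple[OF cD(1) cC(1) cellr] by blast
  define T where "T = {d \<in> Dg. cell d = y}"
  have finT: "finite T" using cD(1) by (simp add: T_def)
  have "card T \<noteq> 0" using y by (simp add: T_def)
  then have "T \<noteq> {}" by auto
  then obtain d0 where d0: "d0 \<in> T" by blast
  \<comment> \<open>Points of one cell minus a fixed point of it are again lattice points, have
    small coordinates by linearity, and are as numerous as the points of the cell.\<close>
  define b where "b d k = a d k - a d0 k" for d k
  have injb: "inj_on b T"
  proof (rule inj_onI)
    fix d d' assume dd: "d \<in> T" "d' \<in> T" "b d = b d'"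
    have "a d = a d'" using dd(3) by (auto simp: b_def fun_eq_iff)
    then show "d = d'" using inj dd(1,2) by (auto simp: T_def inj_on_def)
  qed
  show ?thesis
  proof (intro exI[of _ N] exI[of _ "b ` T"] conjI ballI)
    show "finite (b ` T)" using finT by simp
    show "m < card (b ` T)" using y card_image[OF injb] by (simp add: T_def)
    fix f assume "f \<in> b ` T"
    then obtain d where d: "d \<in> T" "f = b d" by blast
    show "\<forall>k\<ge>N. f k = 0" using a(1) by (simp add: d b_def)
    have bound: "(x N f k)\<^sup>2 * \<tau> k \<le> 48 * D / real N" if k: "k < N" for k
    proof -
      have xd: "x N f k = x N (a d) k - x N (a d0) k"
        unfolding x_def d b_def by (simp add: left_diff_distrib sum_subtractf)
      have "cell d k = cell d0 k" using d(1) d0 by (simp add: T_def)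
      then have "nat \<lfloor>x N (a d) k * real (c k) / real M\<rfloor> = nat \<lfloor>x N (a d0) k * real (c k) / real M\<rfloor>"
        using k by (simp add: cell_def)
      moreover have "0 \<le> x N (a d) k * real (c k) / real M" "0 \<le> x N (a d0) k * real (c k) / real M"
        using xr k d(1) d0 by (auto simp: T_def)
      ultimately have "\<bar>x N (a d) k * real (c k) / real M - x N (a d0) k * real (c k) / real M\<bar> < 1" by linarith
      moreover have "x N (a d) k * real (c k) / real M - x N (a d0) k * real (c k) / real M = x N f k * (real (c k) / real M)"
        by (simp add: xd left_diff_distrib diff_divide_distrib)
      ultimately have "\<bar>x N f k\<bar> * (real (c k) / real M) < 1" using M0 by (simp add: abs_mult)
      moreover have "1 / l k \<le> real (c k) / real M"
        using c(1)[OF k] M0 l0[of k] by (simp add: field_simps)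
      ultimately have "\<bar>x N f k\<bar> * (1 / l k) < 1"
        by (meson abs_ge_zero mult_left_mono order_le_less_trans)
      then have "\<bar>x N f k\<bar> \<le> l k" using l0[of k] by (simp add: divide_less_eq)
      then have "(x N f k)\<^sup>2 \<le> (l k)\<^sup>2" using l0[of k] by (simp add: abs_le_square_iff[symmetric])
      also have "(l k)\<^sup>2 = 48 * (real k + 1) / real N" using N0 by (simp add: l_def)
      finally have "(x N f k)\<^sup>2 * \<tau> k \<le> 48 * (real k + 1) / real N * (D / (real k + 1))"
        using \<tau> N0 by (intro mult_mono) auto
      also have "\<dots> = 48 * D / real N"
      proof -
        have cancel: "48 * c / real N * (D / c) = 48 * D / real N" if "c \<noteq> 0" for c using that by simp
        show ?thesis by (rule cancel) simp
      qed
      finally show ?thesis .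
    qed
    have "(\<Sum>k<N. (x N f k)\<^sup>2 * \<tau> k) \<le> (\<Sum>k<N. 48 * D / real N)" by (rule sum_mono) (use bound in auto)
    also have "\<dots> = 48 * D" using N0 by simp
    finally show "(\<Sum>k<N. (x N f k)\<^sup>2 * \<tau> k) \<le> 48 * D" .
  qed
qed

section \<open>Gram-Schmidt for semidefinite forms on polynomials\<close>

lemma smult_sum_right: "smult c (\<Sum>i\<in>I. f i) = (\<Sum>i\<in>I. smult c (f i))"
  by (induction I rule: infinite_finite_induct) (auto simp: smult_add_right)

text \<open>Null vectors are harmless for Gram-Schmidt: by \<open>ip_null\<close> they are
  orthogonal to everything, and the coefficient with denominator 0 is 0 in HOL.\<close>

locale poly_form =
  fixes ip :: "real poly \<Rightarrow> real poly \<Rightarrow> real"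
  assumes ip_add: "ip (p + q) r = ip p r + ip q r"
    and ip_smult: "ip (smult c p) r = c * ip p r"
    and ip_commute: "ip p q = ip q p"
    and ip_nonneg: "0 \<le> ip p p"
begin

lemma ip_zero: "ip 0 r = 0" using ip_smult[of 0 0 r] by simp

lemma ip_diff: "ip (p - q) r = ip p r - ip q r"
  using ip_add[of "p - q" q r] by simp

lemma ip_sum: "ip (\<Sum>i\<in>I. f i) r = (\<Sum>i\<in>I. ip (f i) r)"
  by (induction I rule: infinite_finite_induct) (auto simp: ip_zero ip_add)

lemma ip_sum_right: "ip r (\<Sum>i\<in>I. f i) = (\<Sum>i\<in>I. ip r (f i))"
  by (simp add: ip_commute[of r] ip_sum)

lemma ip_smult_right: "ip r (smult c p) = c * ip r p"
  by (simp add: ip_commute[of r] ip_smult)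

lemma ip_add_right: "ip r (p + q) = ip r p + ip r q"
  by (simp add: ip_commute[of r] ip_add)

lemma ip_null: assumes "ip w w = 0" shows "ip f w = 0"
proof (rule ccontr)
  assume n: "ip f w \<noteq> 0"
  \<comment> \<open>Chosen so that the quadratic expression below takes the value -1.\<close>
  define s where "s = - (ip f f + 1) / (2 * ip f w)"
  have "0 \<le> ip (f + smult s w) (f + smult s w)" by (rule ip_nonneg)
  also have "\<dots> = ip f f + 2 * s * ip f w + s * s * ip w w"
    by (simp add: ip_add ip_smult ip_add_right ip_smult_right ip_commute[of w f] algebra_simps)
  also have "2 * s * ip f w = - (ip f f + 1)" using n by (simp add: s_def)
  also have "ip f f + - (ip f f + 1) + s * s * ip w w = -1" using assms by simp
  finally show False by simp
qed

fun gram_schmidt :: "(nat \<Rightarrow> real poly) \<Rightarrow> nat \<Rightarrow> real poly" where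
  "gram_schmidt v k = v k - (\<Sum>j<k. smult (ip (v k) (gram_schmidt v j) / ip (gram_schmidt v j) (gram_schmidt v j)) (gram_schmidt v j))"

declare gram_schmidt.simps [simp del]

lemma gram_schmidt_orthogonal: "i < k \<Longrightarrow> ip (gram_schmidt v k) (gram_schmidt v i) = 0"
proof (induction k arbitrary: i rule: less_induct)
  case (less k)
  let ?w = "gram_schmidt v"
  have o: "ip (?w j) (?w i) = 0" if "j < k" "j \<noteq> i" for j
    using less.IH[of j i] less.IH[of i j] less.prems that ip_commute[of "?w j" "?w i"] by (cases "i < j") auto
  have "ip (?w k) (?w i) = ip (v k) (?w i) - (\<Sum>j<k. ip (v k) (?w j) / ip (?w j) (?w j) * ip (?w j) (?w i))"
    by (subst gram_schmidt.simps) (simp add: ip_diff ip_sum ip_smult)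
  also have "(\<Sum>j<k. ip (v k) (?w j) / ip (?w j) (?w j) * ip (?w j) (?w i)) =
      (\<Sum>j<k. if j = i then ip (v k) (?w i) / ip (?w i) (?w i) * ip (?w i) (?w i) else 0)"
    by (rule sum.cong) (auto simp: o)
  also have "\<dots> = ip (v k) (?w i)" using less.prems ip_null[of "?w i" "v k"] by auto
  finally show ?case by simp
qed

lemma gram_schmidt_norm_sum:
  "ip (\<Sum>k<N. smult (x k) (gram_schmidt v k)) (\<Sum>k<N. smult (x k) (gram_schmidt v k)) =
     (\<Sum>k<N. (x k)\<^sup>2 * ip (gram_schmidt v k) (gram_schmidt v k))"
proof -
  let ?w = "gram_schmidt v"
  have o: "ip (?w j) (?w i) = 0" if "j \<noteq> i" for i j
    using gram_schmidt_orthogonal[of i j v] gram_schmidt_orthogonal[of j i v] that ip_commute[of "?w j" "?w i"] by (cases "i < j") auto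
  have "ip (\<Sum>k<N. smult (x k) (?w k)) (\<Sum>k<N. smult (x k) (?w k)) = (\<Sum>k<N. \<Sum>j<N. x k * (x j * ip (?w k) (?w j)))"
    by (simp only: ip_sum ip_smult) (simp only: ip_sum_right ip_smult_right sum_distrib_left)
  also have "\<dots> = (\<Sum>k<N. \<Sum>j<N. if j = k then (x k)\<^sup>2 * ip (?w k) (?w k) else 0)"
    by (intro sum.cong refl) (auto simp: o power2_eq_square)
  finally show ?thesis by (simp add: sum.delta')
qed

lemma gram_schmidt_norm_le: "ip (gram_schmidt v k) (gram_schmidt v k) \<le> ip (v k) (v k)"
proof -
  let ?w = "gram_schmidt v"
  define u where "u = (\<Sum>j<k. smult (ip (v k) (?w j) / ip (?w j) (?w j)) (?w j))"
  have v: "v k = ?w k + u" using gram_schmidt.simps[of v k] by (simp add: u_def)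
  have "ip (?w k) u = 0" unfolding u_def by (simp add: ip_sum_right ip_smult_right gram_schmidt_orthogonal)
  then have "ip (v k) (v k) = ip (?w k) (?w k) + ip u u"
    unfolding v by (simp add: ip_add ip_add_right ip_commute[of u "?w k"])
  then show ?thesis using ip_nonneg[of u] by simp
qed

text \<open>The passages from \<open>e\<close> to \<open>v\<close> and from \<open>v\<close> to its
  orthogonalization are both unitriangular, hence so is the inverse of their composition. The
  diagonal entry 1 is what \<open>many_small_lattice_points\<close> requires.\<close>

lemma gram_schmidt_triangular:
  assumes v: "\<And>k. v k = e k + (\<Sum>i<k. smult (s k i) (e i))"
  shows "\<exists>t. t j = 1 \<and> (\<forall>k>j. t k = 0) \<and> e j = (\<Sum>k\<le>j. smult (t k) (gram_schmidt v k))"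
proof (induction j rule: less_induct)
  case (less j)
  let ?w = "gram_schmidt v"
  obtain T where T: "\<And>i. i < j \<Longrightarrow> T i i = 1 \<and> (\<forall>k>i. T i k = 0) \<and> e i = (\<Sum>k\<le>i. smult (T i k) (?w k))"
    using less.IH by metis
  define c where "c k = ip (v j) (?w k) / ip (?w k) (?w k)" for k
  define t where "t k = (if k < j then c k - (\<Sum>i<j. s j i * T i k) else if k = j then 1 else 0)" for k
  have ei: "e i = (\<Sum>k<j. smult (T i k) (?w k))" if "i < j" for i
  proof -
    have "e i = (\<Sum>k\<le>i. smult (T i k) (?w k))" using T[OF that] by simp
    also have "\<dots> = (\<Sum>k<j. smult (T i k) (?w k))"
      by (rule sum.mono_neutral_left) (use T[OF that] that in auto)
    finally show ?thesis .
  qed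
  have "e j = v j - (\<Sum>i<j. smult (s j i) (e i))" using v[of j] by simp
  also have "(\<Sum>i<j. smult (s j i) (e i)) = (\<Sum>i<j. \<Sum>k<j. smult (s j i * T i k) (?w k))"
    by (rule sum.cong) (auto simp: ei smult_sum_right)
  also have "\<dots> = (\<Sum>k<j. \<Sum>i<j. smult (s j i * T i k) (?w k))" by (rule sum.swap)
  also have "\<dots> = (\<Sum>k<j. smult (\<Sum>i<j. s j i * T i k) (?w k))" by (simp add: smult_sum)
  also have "v j = ?w j + (\<Sum>k<j. smult (c k) (?w k))" using gram_schmidt.simps[of v j] by (simp add: c_def)
  finally have "e j = ?w j + (\<Sum>k<j. smult (c k - (\<Sum>i<j. s j i * T i k)) (?w k))"
    by (simp add: smult_diff_left sum_subtractf)
  also have "\<dots> = (\<Sum>k\<le>j. smult (t k) (?w k))"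
    unfolding lessThan_Suc_atMost[symmetric] sum.lessThan_Suc by (simp add: t_def)
  finally show ?case by (intro exI[of _ t]) (auto simp: t_def)
qed

text \<open>In the orthogonal coordinates the form is diagonal, and its entries inherit the bound
  \<open>D / (k + 1)\<close> because Gram-Schmidt does not lengthen vectors.\<close>

lemma many_small_integer_combinations:
  assumes v: "\<And>k. v k = e k + (\<Sum>i<k. smult (s k i) (e i))"
    and norm: "\<And>k. ip (v k) (v k) \<le> D / (real k + 1)"
  shows "\<exists>N S. finite S \<and> m < card S \<and> (\<forall>a\<in>S. (\<forall>k\<ge>N. a k = 0) \<and>
    ip (\<Sum>k<N. smult (real_of_int (a k)) (e k)) (\<Sum>k<N. smult (real_of_int (a k)) (e k)) \<le> 48 * D)"
proof -
  let ?w = "gram_schmidt v"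
  obtain t where t: "\<And>j. t j j = 1" "\<And>j k. k > j \<Longrightarrow> t j k = 0" "\<And>j. e j = (\<Sum>k\<le>j. smult (t j k) (?w k))"
    using gram_schmidt_triangular[OF v] by metis
  define x where "x \<equiv> (\<lambda>N (a :: nat \<Rightarrow> int) k. \<Sum>j\<in>{k..<N}. real_of_int (a j) * t j k)"
  have "\<exists>N S. finite S \<and> m < card S \<and> (\<forall>a\<in>S. (\<forall>k\<ge>N. a k = 0) \<and> (\<Sum>k<N. (x N a k)\<^sup>2 * ip (?w k) (?w k)) \<le> 48 * D)"
    unfolding x_def
  proof (rule many_small_lattice_points[OF t(1)])
    show "0 \<le> ip (?w k) (?w k)" for k by (rule ip_nonneg)
    show "ip (?w k) (?w k) \<le> D / (real k + 1)" for k by (rule order_trans[OF gram_schmidt_norm_le norm])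
  qed
  moreover have "(\<Sum>k<N. smult (real_of_int (a k)) (e k)) = (\<Sum>k<N. smult (x N a k) (?w k))" for N a
  proof -
    have ej: "e j = (\<Sum>k<N. smult (t j k) (?w k))" if "j < N" for j
      unfolding t(3)[of j] by (rule sum.mono_neutral_left) (use that t(2) in auto)
    have "(\<Sum>j<N. smult (real_of_int (a j)) (e j)) = (\<Sum>j<N. \<Sum>k<N. smult (real_of_int (a j) * t j k) (?w k))"
      by (rule sum.cong) (auto simp: ej smult_sum_right)
    also have "\<dots> = (\<Sum>k<N. \<Sum>j<N. smult (real_of_int (a j) * t j k) (?w k))" by (rule sum.swap)
    also have "\<dots> = (\<Sum>k<N. smult (\<Sum>j<N. real_of_int (a j) * t j k) (?w k))" by (simp add: smult_sum)
    also have "\<dots> = (\<Sum>k<N. smult (x N a k) (?w k))"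
    proof (rule sum.cong)
      fix k assume "k \<in> {..<N}"
      have "(\<Sum>j<N. real_of_int (a j) * t j k) = x N a k"
        unfolding x_def by (rule sum.mono_neutral_right) (use t(2) in \<open>auto simp: not_le\<close>)
      then show "smult (\<Sum>j<N. real_of_int (a j) * t j k) (?w k) = smult (x N a k) (?w k)" by simp
    qed simp
    finally show ?thesis .
  qed
  ultimately show ?thesis by (simp add: gram_schmidt_norm_sum)
qed

end

section \<open>The integer-valued basis and the weighted form\<close>

text \<open>The basis of \<open>newton_expansion\<close>; its integer combinations are
  integer-valued.\<close>

definition binom_poly :: "nat \<Rightarrow> real poly" where
  "binom_poly k = smult (1 / fact k) (\<Prod>i=0..<k. [:of_nat k - of_nat i, 1:])"

lemma poly_binom_poly: "poly (binom_poly k) x = (x + of_nat k) gchoose k"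
  unfolding binom_poly_def gbinomial_prod_rev by (simp add: poly_prod algebra_simps)

lemma degree_binom_poly: "degree (binom_poly k) = k"
proof -
  have "degree (\<Prod>i=0..<k. [:of_nat k - of_nat i, 1:] :: real poly) = (\<Sum>i=0..<k. degree ([:of_nat k - of_nat i, 1:] :: real poly))"
    by (rule degree_prod_eq_sum_degree) auto
  then show ?thesis by (simp add: binom_poly_def)
qed

lemma coeff_binom_poly: "coeff (binom_poly k) k = 1 / fact k"
proof -
  have "lead_coeff (binom_poly k) = 1 / fact k"
    unfolding binom_poly_def lead_coeff_smult lead_coeff_prod by simp
  then show ?thesis by (simp add: degree_binom_poly)
qed

lemma binom_poly_independent:
  "(\<Sum>k<N. smult (b k) (binom_poly k)) = 0 \<Longrightarrow> k < N \<Longrightarrow> b k = 0"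
proof (induction N arbitrary: k)
  case (Suc N)
  have "coeff (\<Sum>k<N. smult (b k) (binom_poly k)) N = 0"
    unfolding coeff_sum by (rule sum.neutral) (auto simp: degree_binom_poly coeff_eq_0)
  then have "b N * coeff (binom_poly N) N = 0"
    using arg_cong[OF Suc.prems(1), of "\<lambda>p. coeff p N"] by simp
  then have "b N = 0" by (simp add: coeff_binom_poly)
  then show ?case using Suc by (cases "k = N") auto
qed simp

text \<open>Having the same leading coefficient as \<open>binom_poly k\<close>, these arise from the
  integer-valued basis by a change of determinant 1.\<close>

definition unitriangular_poly :: "(nat \<Rightarrow> real) \<Rightarrow> nat \<Rightarrow> real poly" where
  "unitriangular_poly s k = binom_poly k + (\<Sum>i<k. smult (s i) (binom_poly i))"

definition complex_poly :: "real poly \<Rightarrow> complex poly" where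
  "complex_poly = map_poly of_real"

lemma poly_complex_poly: "poly (complex_poly p) (of_real x) = of_real (poly p x)"
  unfolding complex_poly_def by (induction p) (auto simp: map_poly_pCons)

lemma complex_poly_inj: "complex_poly p = complex_poly q \<Longrightarrow> p = q"
  unfolding complex_poly_def by (auto simp: poly_eq_iff coeff_map_poly)

lemma poly_weight_summable:
  fixes p q :: "real poly"
  assumes "0 < x" "x < 1" and f: "\<And>n. \<exists>j::int. f n = of_int j \<and> \<bar>j\<bar> = int n"
  shows "(\<lambda>n::nat. poly p (f n) * poly q (f n) / (real n + 1) * x ^ (2 * n)) summable_on S"
proof -
  obtain K where K: "K \<ge> 0" "\<And>n::int. norm (poly (p * q) (of_int n)) * x powi \<bar>n\<bar> \<le> K"
    using poly_exp_bound[OF assms(1,2), of "p * q"] by blast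
  have g: "(\<lambda>n::nat. K * x ^ n) summable_on S" using assms by (intro summable_on_cmult_right summable_on_geometric) auto
  have "norm (poly p (f n) * poly q (f n) / (real n + 1) * x ^ (2 * n)) \<le> K * x ^ n" for n
  proof -
    obtain j where j: "f n = of_int j" "\<bar>j\<bar> = int n" using f by blast
    define X where "X = norm (poly p (f n) * poly q (f n))"
    have "norm (poly p (f n) * poly q (f n) / (real n + 1) * x ^ (2 * n)) = X / (real n + 1) * x ^ (2 * n)"
      using assms(1) by (simp add: X_def abs_mult)
    also have "\<dots> \<le> X / 1 * x ^ (2 * n)"
      using assms(1) by (intro mult_right_mono divide_left_mono) (auto simp: X_def)
    also have "\<dots> = X * x ^ n * x ^ n" by (simp add: mult_2 power_add)
    also have "\<dots> \<le> K * x ^ n"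
    proof (rule mult_right_mono)
      show "X * x ^ n \<le> K" using K(2)[of j] j by (simp add: X_def)
    qed (use assms(1) in simp)
    finally show ?thesis .
  qed
  then have "(\<lambda>n::nat. norm (poly p (f n) * poly q (f n) / (real n + 1) * x ^ (2 * n))) summable_on S"
    by (intro summable_on_comparison_test[OF g]) auto
  then show ?thesis by (rule abs_summable_summable)
qed

context annulus
begin

definition form_pos :: "real poly \<Rightarrow> real poly \<Rightarrow> real" where
  "form_pos p q = (\<Sum>\<^sub>\<infinity>n::nat. poly p (of_nat n) * poly q (of_nat n) / (real n + 1) * (1 / A) ^ (2 * n))"

definition form_neg :: "real poly \<Rightarrow> real poly \<Rightarrow> real" where
  "form_neg p q = (\<Sum>\<^sub>\<infinity>n\<in>{1::nat..}. poly p (- of_nat n) * poly q (- of_nat n) / (real n + 1) * (1 / B) ^ (2 * n))"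

lemma form_summable:
  "(\<lambda>n::nat. poly p (of_nat n) * poly q (of_nat n) / (real n + 1) * (1 / A) ^ (2 * n)) summable_on S"
  "(\<lambda>n::nat. poly p (- of_nat n) * poly q (- of_nat n) / (real n + 1) * (1 / B) ^ (2 * n)) summable_on S"
proof -
  show "(\<lambda>n::nat. poly p (of_nat n) * poly q (of_nat n) / (real n + 1) * (1 / A) ^ (2 * n)) summable_on S"
    by (rule poly_weight_summable[where f=of_nat]) (use A1 in \<open>auto intro: exI[of _ "int _"]\<close>)
  show "(\<lambda>n::nat. poly p (- of_nat n) * poly q (- of_nat n) / (real n + 1) * (1 / B) ^ (2 * n)) summable_on S"
    by (rule poly_weight_summable[where f="\<lambda>n. - of_nat n"]) (use B1 in \<open>auto intro: exI[of _ "- int _"]\<close>)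
qed

text \<open>Both sums in (2) are nonnegative, so a bound for this single form bounds each of
  them.\<close>

lemma form_poly_form: "poly_form (\<lambda>p q. form_pos p q + form_neg p q)"
proof
  fix p q r :: "real poly" and c :: real
  have "form_pos (p + q) r = form_pos p r + form_pos q r"
    unfolding form_pos_def infsum_add[OF form_summable(1) form_summable(1), symmetric]
    by (rule infsum_cong) (simp add: distrib_right add_divide_distrib)
  moreover have "form_neg (p + q) r = form_neg p r + form_neg q r"
    unfolding form_neg_def infsum_add[OF form_summable(2) form_summable(2), symmetric]
    by (rule infsum_cong) (simp add: distrib_right add_divide_distrib)
  ultimately show "form_pos (p + q) r + form_neg (p + q) r = form_pos p r + form_neg p r + (form_pos q r + form_neg q r)"
    by simp
  have "form_pos (smult c p) r = c * form_pos p r"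
    unfolding form_pos_def infsum_cmult_right'[symmetric] by (rule infsum_cong) simp
  moreover have "form_neg (smult c p) r = c * form_neg p r"
    unfolding form_neg_def infsum_cmult_right'[symmetric] by (rule infsum_cong) simp
  ultimately show "form_pos (smult c p) r + form_neg (smult c p) r = c * (form_pos p r + form_neg p r)"
    by (simp add: distrib_left)
  show "form_pos p q + form_neg p q = form_pos q p + form_neg q p"
    unfolding form_pos_def form_neg_def by (simp add: mult.commute)
  show "0 \<le> form_pos p p + form_neg p p"
    unfolding form_pos_def form_neg_def using A1 B1 by (intro add_nonneg_nonneg infsum_nonneg) auto
qed

lemma form_nonneg: "0 \<le> form_pos p p" "0 \<le> form_neg p p"
  unfolding form_pos_def form_neg_def using A1 B1 by (auto intro!: infsum_nonneg)

text \<open>At \<open>robin A B = 0\<close> the top Newton coefficient of the Faber-type sequence of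
  order \<open>k + 1\<close> is exactly 1. Taking real parts keeps it and does not increase the
  norms; the factor 2 in \<open>2 * C\<close> counts the two half sums.\<close>

lemma small_triangular_polys:
  assumes "robin A B = 0"
  shows "\<exists>D s. \<forall>k. form_pos (unitriangular_poly (s k) k) (unitriangular_poly (s k) k) +
    form_neg (unitriangular_poly (s k) k) (unitriangular_poly (s k) k) \<le> D / (real k + 1)"
proof -
  obtain C where C: "C > 0" "\<And>k. k > 0 \<Longrightarrow> \<exists>p. short_faber_seq C k p"
    using faber_norms by blast
  have "\<exists>s. form_pos (unitriangular_poly s k) (unitriangular_poly s k) +
    form_neg (unitriangular_poly s k) (unitriangular_poly s k) \<le> (2 * C) / (real k + 1)" for k
  proof -
    obtain p where p: "(ldiff ^^ Suc k) p = (\<lambda>_. 0)" "(ldiff ^^ k) p = (\<lambda>_. 1)"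
      "(\<lambda>n::nat. (norm (p (int n)))\<^sup>2 / (real n + 1) * (1 / A) ^ (2 * n)) summable_on UNIV"
      "(\<Sum>\<^sub>\<infinity>n::nat. (norm (p (int n)))\<^sup>2 / (real n + 1) * (1 / A) ^ (2 * n)) \<le> C / real (Suc k)"
      "(\<lambda>n::nat. (norm (p (- int n)))\<^sup>2 / (real n + 1) * (1 / B) ^ (2 * n)) summable_on UNIV"
      "(\<Sum>\<^sub>\<infinity>n::nat. (norm (p (- int n)))\<^sup>2 / (real n + 1) * (1 / B) ^ (2 * n)) \<le> C / real (Suc k)"
      using C(2)[of "Suc k"] assms by (auto simp: short_faber_seq_def)
    define s where "s i = Re ((ldiff ^^ i) p (-1))" for i
    define v where "v = unitriangular_poly s k"
    have v_eq: "poly v (of_int n) = Re (p n)" for n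
    proof -
      have g: "((of_int n + of_nat i :: complex) gchoose i) = of_real (poly (binom_poly i) (of_int n))" for i
        unfolding poly_binom_poly gbinomial_prod_rev by simp
      have "p n = (\<Sum>i<Suc k. (ldiff ^^ i) p (-1) * ((of_int n + of_nat i) gchoose i))"
        by (rule newton_expansion[OF p(1)])
      then have "Re (p n) = (\<Sum>i<Suc k. s i * poly (binom_poly i) (of_int n))"
        unfolding g by (simp add: s_def del: sum.lessThan_Suc)
      moreover have "s k = 1" by (simp add: s_def p(2))
      ultimately show ?thesis by (simp add: v_def unitriangular_poly_def poly_sum)
    qed
    have le: "poly v (of_int n) * poly v (of_int n) \<le> (norm (p n))\<^sup>2" for n
      unfolding v_eq cmod_power2 by (simp add: power2_eq_square)
    have "form_pos v v \<le> (\<Sum>\<^sub>\<infinity>n::nat. (norm (p (int n)))\<^sup>2 / (real n + 1) * (1 / A) ^ (2 * n))"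
      unfolding form_pos_def
    proof (rule infsum_mono[OF form_summable(1) p(3)])
      fix n :: nat
      show "poly v (of_nat n) * poly v (of_nat n) / (real n + 1) * (1 / A) ^ (2 * n) \<le> (norm (p (int n)))\<^sup>2 / (real n + 1) * (1 / A) ^ (2 * n)"
        using le[of "int n"] A1 by (intro mult_right_mono divide_right_mono) auto
    qed
    moreover have "form_neg v v \<le> (\<Sum>\<^sub>\<infinity>n\<in>{1::nat..}. (norm (p (- int n)))\<^sup>2 / (real n + 1) * (1 / B) ^ (2 * n))"
      unfolding form_neg_def
    proof (rule infsum_mono[OF form_summable(2) summable_on_subset_banach[OF p(5)]])
      fix n :: nat
      show "poly v (- of_nat n) * poly v (- of_nat n) / (real n + 1) * (1 / B) ^ (2 * n) \<le> (norm (p (- int n)))\<^sup>2 / (real n + 1) * (1 / B) ^ (2 * n)"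
        using le[of "- int n"] B1 by (intro mult_right_mono divide_right_mono) auto
    qed auto
    moreover have "(\<Sum>\<^sub>\<infinity>n\<in>{1::nat..}. (norm (p (- int n)))\<^sup>2 / (real n + 1) * (1 / B) ^ (2 * n)) \<le>
        (\<Sum>\<^sub>\<infinity>n::nat. (norm (p (- int n)))\<^sup>2 / (real n + 1) * (1 / B) ^ (2 * n))"
      by (rule infsum_mono2[OF summable_on_subset_banach[OF p(5)] p(5)]) (use B1 in auto)
    ultimately have "form_pos v v + form_neg v v \<le> C / real (Suc k) + C / real (Suc k)" using p(4,6) by linarith
    also have "\<dots> = (2 * C) / (real k + 1)" by (simp add: add_divide_distrib[symmetric] add.commute)
    finally show ?thesis unfolding v_def by blast
  qed
  then have "\<forall>k. \<exists>s. form_pos (unitriangular_poly s k) (unitriangular_poly s k) +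
    form_neg (unitriangular_poly s k) (unitriangular_poly s k) \<le> (2 * C) / (real k + 1)" by blast
  from choice[OF this] show ?thesis by blast
qed

section \<open>The two halves of the theorem\<close>

text \<open>The bound \<open>48 * D\<close> does not depend on how many integer combinations are
  requested. Asking for more than a finite set could hold gives the contradiction.\<close>

lemma infinitely_many_small:
  assumes "robin A B = 0"
  shows "\<exists>C>0. infinite {P :: complex poly. integer_valued P \<and>
        (\<Sum>\<^sub>\<infinity>n\<in>(UNIV :: nat set). (cmod (poly P (of_nat n)))\<^sup>2 / (real n + 1) * A powi (- 2 * int n)) \<le> C \<and>
        (\<Sum>\<^sub>\<infinity>n\<in>{1::nat..}. (cmod (poly P (- of_nat n)))\<^sup>2 / (real n + 1) * B powi (- 2 * int n)) \<le> C}"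
proof -
  interpret F: poly_form "\<lambda>p q. form_pos p q + form_neg p q" by (rule form_poly_form)
  obtain D s where nv: "\<And>k. form_pos (unitriangular_poly (s k) k) (unitriangular_poly (s k) k) +
    form_neg (unitriangular_poly (s k) k) (unitriangular_poly (s k) k) \<le> D / (real k + 1)"
    using small_triangular_polys[OF assms] by blast
  have D0: "D \<ge> 0"
    using nv[of 0] F.ip_nonneg[of "unitriangular_poly (s 0) 0"] by simp
  \<comment> \<open>The added 1 makes the constant positive, as \<open>D\<close> is only known to be
    nonnegative.\<close>
  define G where "G = {P :: complex poly. integer_valued P \<and>
        (\<Sum>\<^sub>\<infinity>n\<in>(UNIV :: nat set). (cmod (poly P (of_nat n)))\<^sup>2 / (real n + 1) * A powi (- 2 * int n)) \<le> 48 * D + 1 \<and>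
        (\<Sum>\<^sub>\<infinity>n\<in>{1::nat..}. (cmod (poly P (- of_nat n)))\<^sup>2 / (real n + 1) * B powi (- 2 * int n)) \<le> 48 * D + 1}"
  have "infinite G"
  proof
    assume fG: "finite G"
    obtain N S where S: "finite S" "card G < card S" "\<And>a k. a \<in> S \<Longrightarrow> k \<ge> N \<Longrightarrow> a k = (0::int)"
      "\<And>a. a \<in> S \<Longrightarrow> form_pos (\<Sum>k<N. smult (real_of_int (a k)) (binom_poly k)) (\<Sum>k<N. smult (real_of_int (a k)) (binom_poly k))
        + form_neg (\<Sum>k<N. smult (real_of_int (a k)) (binom_poly k)) (\<Sum>k<N. smult (real_of_int (a k)) (binom_poly k)) \<le> 48 * D"
      using F.many_small_integer_combinations[OF unitriangular_poly_def nv, of "card G"] by blast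
    define R where "R a = (\<Sum>k<N. smult (real_of_int (a k)) (binom_poly k))" for a :: "nat \<Rightarrow> int"
    have inj: "inj_on (\<lambda>a. complex_poly (R a)) S"
    proof (rule inj_onI)
      fix a b assume ab: "a \<in> S" "b \<in> S" "complex_poly (R a) = complex_poly (R b)"
      then have "R a = R b" by (intro complex_poly_inj)
      then have z: "(\<Sum>k<N. smult (real_of_int (a k - b k)) (binom_poly k)) = 0"
        unfolding R_def by (simp add: smult_diff_left sum_subtractf)
      have "a k = b k" for k
      proof (cases "k < N")
        case True
        then have "real_of_int (a k - b k) = 0"
          by (rule binom_poly_independent[where b="\<lambda>k. real_of_int (a k - b k)", OF z])
        then show ?thesis by simp
      next
        case False
        then show ?thesis using S(3)[OF ab(1), of k] S(3)[OF ab(2), of k] by simp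
      qed
      then show "a = b" by auto
    qed
    have "complex_poly (R a) \<in> G" if a: "a \<in> S" for a
    proof -
      have "integer_valued (complex_poly (R a))"
        unfolding integer_valued_def
      proof
        fix n :: nat
        have "poly (R a) (real n) = of_int (\<Sum>k<N. a k * int ((n + k) choose k))"
          by (simp add: R_def poly_sum poly_binom_poly binomial_gbinomial)
        then have "poly (complex_poly (R a)) (of_real (real n)) = of_int (\<Sum>k<N. a k * int ((n + k) choose k))"
          unfolding poly_complex_poly by (simp only: of_real_of_int_eq)
        then have "poly (complex_poly (R a)) (of_nat n) = of_int (\<Sum>k<N. a k * int ((n + k) choose k))"
          by (simp only: of_real_of_nat_eq)
        then show "poly (complex_poly (R a)) (of_nat n) \<in> \<int>" by (simp only: Ints_of_int)
      qed
      moreover have "(\<Sum>\<^sub>\<infinity>n\<in>(UNIV :: nat set). (cmod (poly (complex_poly (R a)) (of_nat n)))\<^sup>2 / (real n + 1) * A powi (- 2 * int n)) = form_pos (R a) (R a)"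
        unfolding form_pos_def
      proof (rule infsum_cong)
        fix n :: nat
        have "poly (complex_poly (R a)) (of_nat n) = of_real (poly (R a) (real n))" using poly_complex_poly[of "R a" "real n"] by simp
        moreover have "A powi (- 2 * int n) = (1 / A) ^ (2 * n)"
          by (simp add: power_int_minus power_divide inverse_eq_divide power_int_def nat_mult_distrib)
        ultimately show "(cmod (poly (complex_poly (R a)) (of_nat n)))\<^sup>2 / (real n + 1) * A powi (- 2 * int n) =
            poly (R a) (real n) * poly (R a) (real n) / (real n + 1) * (1 / A) ^ (2 * n)" by (simp add: power2_eq_square)
      qed
      moreover have "(\<Sum>\<^sub>\<infinity>n\<in>{1::nat..}. (cmod (poly (complex_poly (R a)) (- of_nat n)))\<^sup>2 / (real n + 1) * B powi (- 2 * int n)) = form_neg (R a) (R a)"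
        unfolding form_neg_def
      proof (rule infsum_cong)
        fix n :: nat
        have "poly (complex_poly (R a)) (- of_nat n) = of_real (poly (R a) (- real n))" using poly_complex_poly[of "R a" "- real n"] by simp
        moreover have "B powi (- 2 * int n) = (1 / B) ^ (2 * n)"
          by (simp add: power_int_minus power_divide inverse_eq_divide power_int_def nat_mult_distrib)
        ultimately show "(cmod (poly (complex_poly (R a)) (- of_nat n)))\<^sup>2 / (real n + 1) * B powi (- 2 * int n) =
            poly (R a) (- real n) * poly (R a) (- real n) / (real n + 1) * (1 / B) ^ (2 * n)" by (simp add: power2_eq_square)
      qed
      ultimately show ?thesis
        using S(4)[OF a, folded R_def] form_nonneg[of "R a"] by (simp add: G_def)
    qed
    then have "(\<lambda>a. complex_poly (R a)) ` S \<subseteq> G" by auto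
    then have "card S \<le> card G" using card_image[OF inj] card_mono[OF fG] by metis
    then show False using S(2) by simp
  qed
  then show ?thesis unfolding G_def using D0 by (intro exI[of _ "48 * D + 1"]) auto
qed

lemma no_small:
  assumes "robin A B = 0"
  shows "\<exists>C>0. \<not> (\<exists>P :: complex poly. integer_valued P \<and> P \<noteq> 0 \<and>
        (\<Sum>\<^sub>\<infinity>n\<in>(UNIV :: nat set). (cmod (poly P (of_nat n)))\<^sup>2 * A powi (- 2 * int n)) \<le> C \<and>
        (\<Sum>\<^sub>\<infinity>n\<in>{1::nat..}. (cmod (poly P (- of_nat n)))\<^sup>2 * B powi (- 2 * int n)) \<le> C)"
\<comment> \<open>With \<open>\<epsilon>\<close> the square root of this constant, the right side of
  \<open>integer_valued_lower_bound\<close> is at most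
  \<open>\<epsilon> + B * \<epsilon> = 1 / 2\<close>, below the required 1.\<close>
proof (intro exI[of _ "(1 / (2 * (1 + B)))\<^sup>2"] conjI notI)
  define \<epsilon> where "\<epsilon> = 1 / (2 * (1 + B))"
  have e: "\<epsilon> > 0" using B1 by (simp add: \<epsilon>_def)
  have "\<epsilon> + B * \<epsilon> = (1 + B) * \<epsilon>" by (simp add: distrib_right)
  also have "\<dots> = 1 / 2" using B1 by (simp add: \<epsilon>_def)
  finally have e2: "\<epsilon> + B * \<epsilon> = 1 / 2" .
  show "0 < (1 / (2 * (1 + B)))\<^sup>2" using B1 by simp
  assume "\<exists>P :: complex poly. integer_valued P \<and> P \<noteq> 0 \<and>
        (\<Sum>\<^sub>\<infinity>n\<in>(UNIV :: nat set). (cmod (poly P (of_nat n)))\<^sup>2 * A powi (- 2 * int n)) \<le> (1 / (2 * (1 + B)))\<^sup>2 \<and>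
        (\<Sum>\<^sub>\<infinity>n\<in>{1::nat..}. (cmod (poly P (- of_nat n)))\<^sup>2 * B powi (- 2 * int n)) \<le> (1 / (2 * (1 + B)))\<^sup>2"
  then obtain P :: "complex poly" where P: "integer_valued P" "P \<noteq> 0"
    "(\<Sum>\<^sub>\<infinity>n\<in>(UNIV :: nat set). (cmod (poly P (of_nat n)))\<^sup>2 * A powi (- 2 * int n)) \<le> \<epsilon>\<^sup>2"
    "(\<Sum>\<^sub>\<infinity>n\<in>{1::nat..}. (cmod (poly P (- of_nat n)))\<^sup>2 * B powi (- 2 * int n)) \<le> \<epsilon>\<^sup>2"
    unfolding \<epsilon>_def by blast
  have "1 \<le> sqrt (\<Sum>\<^sub>\<infinity>n::nat. (cmod (poly P (of_nat n)))\<^sup>2 * A powi (- 2 * int n))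
       + B * sqrt (\<Sum>\<^sub>\<infinity>n\<in>{1::nat..}. (cmod (poly P (- of_nat n)))\<^sup>2 * B powi (- 2 * int n))"
    by (rule integer_valued_lower_bound) (use assms P in auto)
  also have "\<dots> \<le> \<epsilon> + B * \<epsilon>"
    using P(3,4) e B1 by (intro add_mono mult_left_mono real_le_lsqrt) auto
  finally show False using e2 by simp
qed

end

theorem theorem2p3:
  fixes A B :: real
  assumes "A > 1" and "B > 1" and "gamma_AB A B = 1"
  shows
    "(\<exists>C\<^sub>2>0. \<not> (\<exists>P :: complex poly. integer_valued P \<and> P \<noteq> 0 \<and>
        (\<Sum>\<^sub>\<infinity>n\<in>(UNIV :: nat set). (cmod (poly P (of_nat n)))\<^sup>2 * A powi (- 2 * int n)) \<le> C\<^sub>2 \<and>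
        (\<Sum>\<^sub>\<infinity>n\<in>{1::nat..}. (cmod (poly P (- of_nat n)))\<^sup>2 * B powi (- 2 * int n)) \<le> C\<^sub>2)) \<and>
     (\<exists>C\<^sub>3>0. infinite {P :: complex poly. integer_valued P \<and>
        (\<Sum>\<^sub>\<infinity>n\<in>(UNIV :: nat set).
            (cmod (poly P (of_nat n)))\<^sup>2 / (real n + 1) * A powi (- 2 * int n)) \<le> C\<^sub>3 \<and>
        (\<Sum>\<^sub>\<infinity>n\<in>{1::nat..}.
            (cmod (poly P (- of_nat n)))\<^sup>2 / (real n + 1) * B powi (- 2 * int n)) \<le> C\<^sub>3})"
proof -
  interpret annulus A B using assms(1,2) by unfold_locales
  have "robin A B = 0" using assms(3) by (simp add: gamma_eq_1_iff)
  then show ?thesis by (intro conjI no_small infinitely_many_small)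
qed

end
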